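(* Let $\mathcal{C}$ be a standard category over a field $K$, let $\mathbb{D}$ be a standard duality on $\mathcal{C}$, and let $T\in\mathcal{C}$ be a tilting object. For each $\lambda\in\Lambda$ let $G_T^\lambda=\{g_i^\lambda\mid i\in\mathcal{I}_T^\lambda\}$ be any $K$-basis of $\mathrm{Hom}_{\mathcal{C}}(\Delta(\lambda),T)$ and $\hat G_T^\lambda=\{\hat g_i^\lambda\mid i\in\mathcal{I}_T^\lambda\}$ any choice of lifts. Put $\hat f_i^\lambda=\Phi_{T(\lambda)}\circ\mathbb{D}(\hat g_i^\lambda)\circ\Phi_T^{-1}:T\to T(\lambda)$ for $i\in\mathcal{I}_T^\lambda$. Then the set $$\hat G_T\,\mathbb{D}(\hat G_T)=\{c_{ij}^\lambda:=\hat g_i^\lambda\circ\hat f_j^\lambda\mid\lambda\in\Lambda,\ i,j\in\mathcal{I}_T^\lambda\}$$ is a cellular basis (in the sense of Graham--Lehrer) of $E_T=\mathrm{End}_{\mathcal{C}}(T)$ with respect to the anti-involution $\alpha$ on $E_T$ induced by $\mathbb{D}$, namely $\alpha(\varphi)=\Phi_T\circ\mathbb{D}(\varphi)\circ\Phi_T^{-1}$.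
   Context: **Standard categories.** Let $K$ be a field. A standard category over $K$ is a $K$-linear abelian category $\mathcal{C}$ satisfying the following. (A1) $\mathcal{C}$ is essentially small and locally finite: all objects have finite length and all $\mathrm{Hom}_{\mathcal{C}}(X,Y)$ are finite-dimensional over $K$. Write $[X:S]$ for the multiplicity of a simple object $S$ in a composition series of $X$; $\mathrm{Rad}\,X$ is the intersection of all maximal subobjects, $\mathrm{Hd}\,X=X/\mathrm{Rad}\,X$, and $\mathrm{Soc}\,X$ is the union (sum) of all minimal subobjects. (A2) There is a complete set $\{L(\lambda)\}_{\lambda\in\Lambda}$ of representatives of isomorphism classes of simple objects, indexed by a (possibly infinite) partially ordered set $(\Lambda,\le)$. (A3) Each $L(\lambda)$ has a costandard object $\nabla(\lambda)$ (i.e. $\mathrm{Soc}\,\nabla(\lambda)\simeq L(\lambda)$ and all composition factors $L(\mu)$ of $\nabla(\lambda)/\mathrm{Soc}\,\nabla(\lambda)$ satisfy $\mu<\lambda$) and a standard object $\Delta(\lambda)$ (i.e. $\mathrm{Hd}\,\Delta(\lambda)\simeq L(\lambda)$ and all composition factors $L(\mu)$ of $\mathrm{Rad}\,\Delta(\lambda)$ satisfy $\mu<\lambda$), such that for all $\lambda,\mu\in\Lambda$ and $0\le i\le 2$ the Yoneda Ext-group $\mathrm{Ext}^i_{\mathcal{C}}(\Delta(\lambda),\nabla(\mu))$ is $K$ if $i=0$ and $\lambda=\mu$, and is $0$ otherwise. An object has a costandard (resp. standard) filtration if it has a finite filtration by subobjects whose successive quotients are isomorphic to objects $\nabla(\lambda_i)$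 (resp. $\Delta(\lambda_i)$). A tilting object is an object having both a standard and a costandard filtration. (A4) For each $\lambda\in\Lambda$ there is an indecomposable tilting object $T(\lambda)$ such that: $[T(\lambda):L(\mu)]\ne 0$ implies $\mu\le\lambda$, and $[T(\lambda):L(\lambda)]=1$; there is a monomorphism $\Delta(\lambda)\hookrightarrow T(\lambda)$; there is an epimorphism $T(\lambda)\twoheadrightarrow\nabla(\lambda)$. Moreover $\lambda\mapsto T(\lambda)$ is a bijection between $\Lambda$ and the set of isomorphism classes of indecomposable tilting objects. **Lifts.** For each $\lambda$ fix a monomorphism $i^\lambda:\Delta(\lambda)\hookrightarrow T(\lambda)$. For $N$ with a costandard filtration, a lift of $g:\Delta(\lambda)\to N$ is a morphism $\hat g:T(\lambda)\to N$ with $\hat g\circ i^\lambda=g$; lifts exist but are not unique. $\mathcal{I}_T^\lambda=\{1,\dots,\dim_K\mathrm{Hom}_{\mathcal{C}}(\Delta(\lambda),T)\}$. **Dualities.** A duality on $\mathcal{C}$ is a contravariant $K$-linear functor $\mathbb{D}:\mathcal{C}\to\mathcal{C}$ together with an isomorphism of functors $\xi:\mathrm{id}_{\mathcal{C}}\to\mathbb{D}^2$ satisfying $\mathrm{id}_{\mathbb{D}(X)}=\mathbb{D}(\xi_X)\circ\xi_{\mathbb{D}(X)}$ for all $X$. An object $X$ is fixed by $\mathbb{D}$ (is a fixed point) if there is an isomorphism $\Phi_X:\mathbb{D}(X)\to X$ with $\Phi_X\circ\mathbb{D}(\Phi_X^{-1})\circ\xi_X=\mathrm{id}_X$. A standard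 duality on a standard category is a duality $\mathbb{D}$ with $\mathbb{D}(\nabla(\lambda))\simeq\Delta(\lambda)$ for all $\lambda\in\Lambda$ (it exchanges standard and costandard objects) and such that every indecomposable tilting object is fixed by $\mathbb{D}$. Then every tilting object is fixed by $\mathbb{D}$. Fix isomorphisms $\Phi_T:\mathbb{D}(T)\to T$ and $\Phi_{T(\lambda)}:\mathbb{D}(T(\lambda))\to T(\lambda)$ ($\lambda\in\Lambda$) satisfying $\Phi_T\circ\mathbb{D}(\Phi_T^{-1})\circ\xi_T=\mathrm{id}_T$ and $\Phi_{T(\lambda)}\circ\mathbb{D}(\Phi_{T(\lambda)}^{-1})\circ\xi_{T(\lambda)}=\mathrm{id}_{T(\lambda)}$. **Standard and cellular bases.** A standard basis (Du--Rui) of a finite-dimensional $K$-algebra $E$ is a $K$-basis $\mathcal{B}=\coprod_{\lambda\in\Lambda}\mathcal{B}^\lambda$ fibered over a poset $\Lambda$, together with index sets $\mathcal{I}^\lambda,\mathcal{J}^\lambda$ (possibly empty) with $\mathcal{B}^\lambda=\{c_{ij}^\lambda\mid(i,j)\in\mathcal{I}^\lambda\times\mathcal{J}^\lambda\}$, such that for all $\varphi\in E$ and $c_{ij}^\lambda\in\mathcal{B}^\lambda$ $$\varphi\cdot c_{ij}^\lambda\equiv\sum_{k\in\mathcal{I}^\lambda}r_k^\lambda(\varphi,i)\,c_{kj}^\lambda \pmod{E^{<\lambda}},\qquad c_{ij}^\lambda\cdot\varphi\equiv\sum_{l\in\mathcal{J}^\lambda}r_l^\lambda(j,\varphi)\,c_{il}^\lambda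 \pmod{E^{<\lambda}},$$ where $r_k^\lambda(\varphi,i)\in K$ is independent of $j$, $r_l^\lambda(j,\varphi)\in K$ is independent of $i$, and $E^{<\lambda}$ is the $K$-span of $\bigcup_{\mu<\lambda}\mathcal{B}^\mu$. A cellular basis (Graham--Lehrer) is a standard basis together with an algebra anti-involution $\iota$ of $E$ such that $\mathcal{I}^\lambda=\mathcal{J}^\lambda$ for all $\lambda$ and $\iota(c_{ij}^\lambda)=c_{ji}^\lambda$ for all $i,j\in\mathcal{I}^\lambda$. *)

theory Defs
  imports Complex_Main
begin

section \<open>Linear and abelian categories\<close>

text \<open>
  All Hom-spaces are subspaces of one vector space, the type \<open>'m\<close>. Every small \<open>K\<close>-linear category
  is isomorphic to one of this shape: take for \<open>'m\<close> the direct sum of all Hom-spaces, on which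
  composition and linear functors are defined without reference to source and target.
  An element of \<open>'m\<close> may lie in several Hom-spaces (0 lies in all of them), so the notions below
  take source and target as arguments. \<open>Comp C g f\<close> is ``g after f''.
\<close>

record ('o, 'm, 'k) lin_cat =
  Obj :: "'o set"
  Hom :: "'o \<Rightarrow> 'o \<Rightarrow> 'm set"
  Id :: "'o \<Rightarrow> 'm"
  Comp :: "'m \<Rightarrow> 'm \<Rightarrow> 'm"  (infixl \<open>\<cdot>\<index>\<close> 70)
  Scale :: "'k \<Rightarrow> 'm \<Rightarrow> 'm"

locale linear_category =
  fixes C :: "('o, 'm::ab_group_add, 'k::field) lin_cat" (structure)
  assumes scale: "vector_space (Scale C)"
    and hom_obj: "f \<in> Hom C X Y \<Longrightarrow> X \<in> Obj C \<and> Y \<in> Obj C"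
    and hom_subspace: "X \<in> Obj C \<Longrightarrow> Y \<in> Obj C \<Longrightarrow> module.subspace (Scale C) (Hom C X Y)"
    and id_hom: "X \<in> Obj C \<Longrightarrow> Id C X \<in> Hom C X X"
    and comp_hom: "f \<in> Hom C X Y \<Longrightarrow> g \<in> Hom C Y Z \<Longrightarrow> g \<cdot> f \<in> Hom C X Z"
    and comp_assoc: "f \<in> Hom C W X \<Longrightarrow> g \<in> Hom C X Y \<Longrightarrow> h \<in> Hom C Y Z \<Longrightarrow>
          (h \<cdot> g) \<cdot> f = h \<cdot> (g \<cdot> f)"
    and id_left: "f \<in> Hom C X Y \<Longrightarrow> Id C Y \<cdot> f = f"
    and id_right: "f \<in> Hom C X Y \<Longrightarrow> f \<cdot> Id C X = f"
    and comp_add_left: "f \<in> Hom C X Y \<Longrightarrow> g \<in> Hom C Y Z \<Longrightarrow> g' \<in> Hom C Y Z \<Longrightarrow>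
          (g + g') \<cdot> f = g \<cdot> f + g' \<cdot> f"
    and comp_add_right: "f \<in> Hom C X Y \<Longrightarrow> f' \<in> Hom C X Y \<Longrightarrow> g \<in> Hom C Y Z \<Longrightarrow>
          g \<cdot> (f + f') = g \<cdot> f + g \<cdot> f'"
    and comp_scale_left: "f \<in> Hom C X Y \<Longrightarrow> g \<in> Hom C Y Z \<Longrightarrow>
          Scale C a g \<cdot> f = Scale C a (g \<cdot> f)"
    and comp_scale_right: "f \<in> Hom C X Y \<Longrightarrow> g \<in> Hom C Y Z \<Longrightarrow>
          g \<cdot> Scale C a f = Scale C a (g \<cdot> f)"

definition is_mono :: "('o, 'm, 'k) lin_cat \<Rightarrow> 'o \<Rightarrow> 'o \<Rightarrow> 'm \<Rightarrow> bool" where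
  "is_mono C X Y f \<longleftrightarrow> f \<in> Hom C X Y \<and>
     (\<forall>W. \<forall>u \<in> Hom C W X. \<forall>v \<in> Hom C W X. f \<cdot>\<^bsub>C\<^esub> u = f \<cdot>\<^bsub>C\<^esub> v \<longrightarrow> u = v)"

definition is_epi :: "('o, 'm, 'k) lin_cat \<Rightarrow> 'o \<Rightarrow> 'o \<Rightarrow> 'm \<Rightarrow> bool" where
  "is_epi C X Y f \<longleftrightarrow> f \<in> Hom C X Y \<and>
     (\<forall>W. \<forall>u \<in> Hom C Y W. \<forall>v \<in> Hom C Y W. u \<cdot>\<^bsub>C\<^esub> f = v \<cdot>\<^bsub>C\<^esub> f \<longrightarrow> u = v)"

definition inverse_mor :: "('o, 'm, 'k) lin_cat \<Rightarrow> 'o \<Rightarrow> 'o \<Rightarrow> 'm \<Rightarrow> 'm \<Rightarrow> bool" where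
  "inverse_mor C X Y f g \<longleftrightarrow> g \<in> Hom C Y X \<and> g \<cdot>\<^bsub>C\<^esub> f = Id C X \<and> f \<cdot>\<^bsub>C\<^esub> g = Id C Y"

definition is_iso :: "('o, 'm, 'k) lin_cat \<Rightarrow> 'o \<Rightarrow> 'o \<Rightarrow> 'm \<Rightarrow> bool" where
  "is_iso C X Y f \<longleftrightarrow> f \<in> Hom C X Y \<and> (\<exists>g. inverse_mor C X Y f g)"

definition inv_mor :: "('o, 'm, 'k) lin_cat \<Rightarrow> 'o \<Rightarrow> 'o \<Rightarrow> 'm \<Rightarrow> 'm" where
  "inv_mor C X Y f = (THE g. inverse_mor C X Y f g)"

definition isomorphic :: "('o, 'm, 'k) lin_cat \<Rightarrow> 'o \<Rightarrow> 'o \<Rightarrow> bool" where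
  "isomorphic C X Y \<longleftrightarrow> (\<exists>f. is_iso C X Y f)"

definition zero_obj :: "('o, 'm, 'k) lin_cat \<Rightarrow> 'o \<Rightarrow> bool" where
  "zero_obj C Z \<longleftrightarrow> Z \<in> Obj C \<and>
     (\<forall>X \<in> Obj C. (\<exists>!f. f \<in> Hom C Z X) \<and> (\<exists>!f. f \<in> Hom C X Z))"

definition is_biproduct ::
  "('o, 'm::ab_group_add, 'k) lin_cat \<Rightarrow> 'o \<Rightarrow> 'o \<Rightarrow> 'o \<Rightarrow> 'm \<Rightarrow> 'm \<Rightarrow> 'm \<Rightarrow> 'm \<Rightarrow> bool" where
  "is_biproduct C A B S i j p q \<longleftrightarrow>
     i \<in> Hom C A S \<and> j \<in> Hom C B S \<and> p \<in> Hom C S A \<and> q \<in> Hom C S B \<and>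
     p \<cdot>\<^bsub>C\<^esub> i = Id C A \<and> q \<cdot>\<^bsub>C\<^esub> j = Id C B \<and> q \<cdot>\<^bsub>C\<^esub> i = 0 \<and> p \<cdot>\<^bsub>C\<^esub> j = 0 \<and>
     i \<cdot>\<^bsub>C\<^esub> p + j \<cdot>\<^bsub>C\<^esub> q = Id C S"

definition is_kernel :: "('o, 'm::ab_group_add, 'k) lin_cat \<Rightarrow> 'o \<Rightarrow> 'o \<Rightarrow> 'm \<Rightarrow> 'o \<Rightarrow> 'm \<Rightarrow> bool" where
  "is_kernel C X Y f K k \<longleftrightarrow> f \<in> Hom C X Y \<and> k \<in> Hom C K X \<and> f \<cdot>\<^bsub>C\<^esub> k = 0 \<and>
     (\<forall>W. \<forall>u \<in> Hom C W X. f \<cdot>\<^bsub>C\<^esub> u = 0 \<longrightarrow> (\<exists>!v. v \<in> Hom C W K \<and> k \<cdot>\<^bsub>C\<^esub> v = u))"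

definition is_cokernel :: "('o, 'm::ab_group_add, 'k) lin_cat \<Rightarrow> 'o \<Rightarrow> 'o \<Rightarrow> 'm \<Rightarrow> 'o \<Rightarrow> 'm \<Rightarrow> bool" where
  "is_cokernel C X Y f Q q \<longleftrightarrow> f \<in> Hom C X Y \<and> q \<in> Hom C Y Q \<and> q \<cdot>\<^bsub>C\<^esub> f = 0 \<and>
     (\<forall>W. \<forall>u \<in> Hom C Y W. u \<cdot>\<^bsub>C\<^esub> f = 0 \<longrightarrow> (\<exists>!v. v \<in> Hom C Q W \<and> v \<cdot>\<^bsub>C\<^esub> q = u))"

locale abelian_category = linear_category +
  assumes zero_exists: "\<exists>Z. zero_obj C Z"
    and biproduct_exists: "A \<in> Obj C \<Longrightarrow> B \<in> Obj C \<Longrightarrow> \<exists>S i j p q. is_biproduct C A B S i j p q"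
    and kernel_exists: "f \<in> Hom C X Y \<Longrightarrow> \<exists>K k. is_kernel C X Y f K k"
    and cokernel_exists: "f \<in> Hom C X Y \<Longrightarrow> \<exists>Q q. is_cokernel C X Y f Q q"
    and mono_is_kernel: "is_mono C X Y f \<Longrightarrow> \<exists>Z g. is_kernel C Y Z g X f"
    and epi_is_cokernel: "is_epi C X Y f \<Longrightarrow> \<exists>Z g. is_cokernel C Z X g Y f"

text \<open>\<open>0 \<rightarrow> A \<rightarrow> B \<rightarrow> Q \<rightarrow> 0\<close>\<close>

definition short_exact :: "('o, 'm::ab_group_add, 'k) lin_cat \<Rightarrow> 'o \<Rightarrow> 'o \<Rightarrow> 'o \<Rightarrow> 'm \<Rightarrow> 'm \<Rightarrow> bool" where
  "short_exact C A B Q f g \<longleftrightarrow> is_kernel C B Q g A f \<and> is_cokernel C A B f Q g"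

text \<open>Exactness at \<open>Y\<close>: the mono part of an epi-mono factorization of \<open>f\<close>, that is the image
  of \<open>f\<close>, is the kernel of \<open>g\<close>.\<close>

definition exact_at :: "('o, 'm::ab_group_add, 'k) lin_cat \<Rightarrow> 'o \<Rightarrow> 'o \<Rightarrow> 'o \<Rightarrow> 'm \<Rightarrow> 'm \<Rightarrow> bool" where
  "exact_at C X Y Z f g \<longleftrightarrow>
     (\<exists>K k e. is_kernel C Y Z g K k \<and> is_epi C X K e \<and> f = k \<cdot>\<^bsub>C\<^esub> e)"


section \<open>Yoneda Ext\<close>

text \<open>
  An \<open>n\<close>-fold extension \<open>0 \<rightarrow> Y = E 0 \<rightarrow> E 1 \<rightarrow> \<dots> \<rightarrow> E n \<rightarrow> E (n + 1) = X \<rightarrow> 0\<close>, for \<open>n \<ge> 1\<close>, with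
  \<open>d i : E i \<rightarrow> E (i + 1)\<close>. Values of \<open>E\<close> and \<open>d\<close> beyond this range are irrelevant, also for
  the equivalence relation below.
\<close>

definition is_extension ::
  "('o, 'm::ab_group_add, 'k) lin_cat \<Rightarrow> nat \<Rightarrow> 'o \<Rightarrow> 'o \<Rightarrow> (nat \<Rightarrow> 'o) \<times> (nat \<Rightarrow> 'm) \<Rightarrow> bool" where
  "is_extension C n X Y = (\<lambda>(E, d).
     E 0 = Y \<and> E (Suc n) = X \<and> (\<forall>i \<le> n. d i \<in> Hom C (E i) (E (Suc i))) \<and>
     is_mono C (E 0) (E 1) (d 0) \<and> is_epi C (E n) (E (Suc n)) (d n) \<and>
     (\<forall>i < n. exact_at C (E i) (E (Suc i)) (E (Suc (Suc i))) (d i) (d (Suc i))))"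

text \<open>Morphisms of extensions that are the identity on both ends.\<close>

definition extension_rel ::
  "('o, 'm::ab_group_add, 'k) lin_cat \<Rightarrow> nat \<Rightarrow> 'o \<Rightarrow> 'o \<Rightarrow> ((nat \<Rightarrow> 'o) \<times> (nat \<Rightarrow> 'm)) rel" where
  "extension_rel C n X Y = {((E, d), (E', d')).
     is_extension C n X Y (E, d) \<and> is_extension C n X Y (E', d') \<and>
     (\<exists>\<phi>. (\<forall>i \<le> Suc n. \<phi> i \<in> Hom C (E i) (E' i)) \<and> \<phi> 0 = Id C Y \<and> \<phi> (Suc n) = Id C X \<and>
          (\<forall>i \<le> n. \<phi> (Suc i) \<cdot>\<^bsub>C\<^esub> d i = d' i \<cdot>\<^bsub>C\<^esub> \<phi> i))}"

text \<open>The underlying set of \<open>Ext\<^sup>n(X, Y)\<close>, \<open>n \<ge> 1\<close>: extensions modulo the equivalence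
  relation generated by these morphisms. The group \<open>Ext\<^sup>n(X, Y)\<close> is 0 iff this set is a
  singleton. (\<open>Ext\<^sup>0(X, Y)\<close> is \<open>Hom C X Y\<close>.)\<close>

definition Ext ::
  "('o, 'm::ab_group_add, 'k) lin_cat \<Rightarrow> nat \<Rightarrow> 'o \<Rightarrow> 'o \<Rightarrow> ((nat \<Rightarrow> 'o) \<times> (nat \<Rightarrow> 'm)) set set" where
  "Ext C n X Y =
     {e. is_extension C n X Y e} // (extension_rel C n X Y \<union> (extension_rel C n X Y)\<inverse>)\<^sup>*"


section \<open>Filtrations, composition factors, radical and socle\<close>

text \<open>A finite filtration of \<open>X\<close> by subobjects, with its list of successive quotients from top
  to bottom.\<close>

inductive filtration :: "('o, 'm::ab_group_add, 'k) lin_cat \<Rightarrow> 'o \<Rightarrow> 'o list \<Rightarrow> bool" for C where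
  filtration_zero: "zero_obj C X \<Longrightarrow> filtration C X []"
| filtration_step: "filtration C X Qs \<Longrightarrow> short_exact C X Y Q f g \<Longrightarrow> filtration C Y (Q # Qs)"

definition filtered_by :: "('o, 'm::ab_group_add, 'k) lin_cat \<Rightarrow> 'o set \<Rightarrow> 'o \<Rightarrow> bool" where
  "filtered_by C \<F> X \<longleftrightarrow> (\<exists>Qs. filtration C X Qs \<and> (\<forall>Q \<in> set Qs. \<exists>F \<in> \<F>. isomorphic C Q F))"

definition simple_obj :: "('o, 'm, 'k) lin_cat \<Rightarrow> 'o \<Rightarrow> bool" where
  "simple_obj C S \<longleftrightarrow> S \<in> Obj C \<and> \<not> zero_obj C S \<and>
     (\<forall>M m. is_mono C M S m \<longrightarrow> zero_obj C M \<or> is_iso C M S m)"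

definition composition_series :: "('o, 'm::ab_group_add, 'k) lin_cat \<Rightarrow> 'o \<Rightarrow> 'o list \<Rightarrow> bool" where
  "composition_series C X Ss \<longleftrightarrow> filtration C X Ss \<and> (\<forall>S \<in> set Ss. simple_obj C S)"

text \<open>\<open>[X : S]\<close>; the choice of composition series is irrelevant by Jordan-Hoelder.\<close>

definition comp_mult :: "('o, 'm::ab_group_add, 'k) lin_cat \<Rightarrow> 'o \<Rightarrow> 'o \<Rightarrow> nat" where
  "comp_mult C X S = length (filter (isomorphic C S) (SOME Ss. composition_series C X Ss))"

text \<open>A subobject of \<open>X\<close> is given by a monomorphism \<open>m : M \<rightarrow> X\<close>; inclusion of subobjects is
  factorization.\<close>

definition sub_le :: "('o, 'm, 'k) lin_cat \<Rightarrow> 'o \<Rightarrow> 'm \<Rightarrow> 'o \<Rightarrow> 'm \<Rightarrow> bool" where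
  "sub_le C M m N n \<longleftrightarrow> (\<exists>u \<in> Hom C M N. n \<cdot>\<^bsub>C\<^esub> u = m)"

definition maximal_sub :: "('o, 'm, 'k) lin_cat \<Rightarrow> 'o \<Rightarrow> 'o \<Rightarrow> 'm \<Rightarrow> bool" where
  "maximal_sub C X M m \<longleftrightarrow> is_mono C M X m \<and> \<not> is_iso C M X m \<and>
     (\<forall>N n. is_mono C N X n \<and> sub_le C M m N n \<longrightarrow> sub_le C N n M m \<or> is_iso C N X n)"

definition minimal_sub :: "('o, 'm, 'k) lin_cat \<Rightarrow> 'o \<Rightarrow> 'o \<Rightarrow> 'm \<Rightarrow> bool" where
  "minimal_sub C X M m \<longleftrightarrow> is_mono C M X m \<and> \<not> zero_obj C M \<and>
     (\<forall>N n. is_mono C N X n \<and> sub_le C N n M m \<longrightarrow> sub_le C M m N n \<or> zero_obj C N)"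

text \<open>Intersections and sums of subobjects are infima and suprema for inclusion.\<close>

definition is_radical :: "('o, 'm, 'k) lin_cat \<Rightarrow> 'o \<Rightarrow> 'o \<Rightarrow> 'm \<Rightarrow> bool" where
  "is_radical C X R r \<longleftrightarrow> is_mono C R X r \<and>
     (\<forall>M m. maximal_sub C X M m \<longrightarrow> sub_le C R r M m) \<and>
     (\<forall>N n. is_mono C N X n \<and> (\<forall>M m. maximal_sub C X M m \<longrightarrow> sub_le C N n M m) \<longrightarrow>
        sub_le C N n R r)"

definition is_socle :: "('o, 'm, 'k) lin_cat \<Rightarrow> 'o \<Rightarrow> 'o \<Rightarrow> 'm \<Rightarrow> bool" where
  "is_socle C X S s \<longleftrightarrow> is_mono C S X s \<and>
     (\<forall>M m. minimal_sub C X M m \<longrightarrow> sub_le C M m S s) \<and>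
     (\<forall>N n. is_mono C N X n \<and> (\<forall>M m. minimal_sub C X M m \<longrightarrow> sub_le C M m N n) \<longrightarrow>
        sub_le C S s N n)"

definition indecomposable :: "('o, 'm::ab_group_add, 'k) lin_cat \<Rightarrow> 'o \<Rightarrow> bool" where
  "indecomposable C X \<longleftrightarrow> X \<in> Obj C \<and> \<not> zero_obj C X \<and>
     (\<forall>A B i j p q. is_biproduct C A B X i j p q \<longrightarrow> zero_obj C A \<or> zero_obj C B)"


section \<open>Standard categories\<close>

definition is_costandard ::
  "('o, 'm::ab_group_add, 'k) lin_cat \<Rightarrow> 'l::order set \<Rightarrow> ('l \<Rightarrow> 'o) \<Rightarrow> 'l \<Rightarrow> 'o \<Rightarrow> bool" where
  "is_costandard C \<Lambda> L l N \<longleftrightarrow>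
     (\<exists>S s Q q. is_socle C N S s \<and> isomorphic C S (L l) \<and> is_cokernel C S N s Q q \<and>
        (\<forall>m \<in> \<Lambda>. comp_mult C Q (L m) \<noteq> 0 \<longrightarrow> m < l))"

definition is_standard ::
  "('o, 'm::ab_group_add, 'k) lin_cat \<Rightarrow> 'l::order set \<Rightarrow> ('l \<Rightarrow> 'o) \<Rightarrow> 'l \<Rightarrow> 'o \<Rightarrow> bool" where
  "is_standard C \<Lambda> L l M \<longleftrightarrow>
     (\<exists>R r H h. is_radical C M R r \<and> is_cokernel C R M r H h \<and> isomorphic C H (L l) \<and>
        (\<forall>m \<in> \<Lambda>. comp_mult C R (L m) \<noteq> 0 \<longrightarrow> m < l))"

definition tilting ::
  "('o, 'm::ab_group_add, 'k) lin_cat \<Rightarrow> 'l set \<Rightarrow> ('l \<Rightarrow> 'o) \<Rightarrow> ('l \<Rightarrow> 'o) \<Rightarrow> 'o \<Rightarrow> bool" where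
  "tilting C \<Lambda> Nabla \<Delta> X \<longleftrightarrow> filtered_by C (\<Delta> ` \<Lambda>) X \<and> filtered_by C (Nabla ` \<Lambda>) X"

text \<open>Essential smallness holds automatically, since the objects and the morphisms are elements
  of types.\<close>

locale standard_category = abelian_category C
  for C :: "('o, 'm::ab_group_add, 'k::field) lin_cat" (structure) +
  fixes \<Lambda> :: "'l::order set" and L Nabla \<Delta> T :: "'l \<Rightarrow> 'o"
  assumes finite_length: "X \<in> Obj C \<Longrightarrow> \<exists>Ss. composition_series C X Ss"
    and finite_dim_hom: "X \<in> Obj C \<Longrightarrow> Y \<in> Obj C \<Longrightarrow>
          \<exists>B. finite B \<and> module.span (Scale C) B = Hom C X Y"
    and simple_L: "l \<in> \<Lambda> \<Longrightarrow> simple_obj C (L l)"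
    and L_complete: "simple_obj C S \<Longrightarrow> \<exists>!l. l \<in> \<Lambda> \<and> isomorphic C S (L l)"
    and costandard: "l \<in> \<Lambda> \<Longrightarrow> is_costandard C \<Lambda> L l (Nabla l)"
    and standard: "l \<in> \<Lambda> \<Longrightarrow> is_standard C \<Lambda> L l (\<Delta> l)"
    and Ext0: "l \<in> \<Lambda> \<Longrightarrow> m \<in> \<Lambda> \<Longrightarrow>
          vector_space.dim (Scale C) (Hom C (\<Delta> l) (Nabla m)) = (if l = m then 1 else 0)"
    and Ext1: "l \<in> \<Lambda> \<Longrightarrow> m \<in> \<Lambda> \<Longrightarrow> is_singleton (Ext C 1 (\<Delta> l) (Nabla m))"
    and Ext2: "l \<in> \<Lambda> \<Longrightarrow> m \<in> \<Lambda> \<Longrightarrow> is_singleton (Ext C 2 (\<Delta> l) (Nabla m))"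
    and T_tilting: "l \<in> \<Lambda> \<Longrightarrow> tilting C \<Lambda> Nabla \<Delta> (T l)"
    and T_indecomposable: "l \<in> \<Lambda> \<Longrightarrow> indecomposable C (T l)"
    and T_weights: "l \<in> \<Lambda> \<Longrightarrow> m \<in> \<Lambda> \<Longrightarrow> comp_mult C (T l) (L m) \<noteq> 0 \<Longrightarrow> m \<le> l"
    and T_highest: "l \<in> \<Lambda> \<Longrightarrow> comp_mult C (T l) (L l) = 1"
    and T_mono: "l \<in> \<Lambda> \<Longrightarrow> \<exists>f. is_mono C (\<Delta> l) (T l) f"
    and T_epi: "l \<in> \<Lambda> \<Longrightarrow> \<exists>f. is_epi C (T l) (Nabla l) f"
    and T_complete: "tilting C \<Lambda> Nabla \<Delta> X \<Longrightarrow> indecomposable C X \<Longrightarrow>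
          \<exists>!l. l \<in> \<Lambda> \<and> isomorphic C X (T l)"


section \<open>Dualities\<close>

locale duality = linear_category C
  for C :: "('o, 'm::ab_group_add, 'k::field) lin_cat" (structure) +
  fixes Dob :: "'o \<Rightarrow> 'o" and Dmor :: "'m \<Rightarrow> 'm" and \<xi> :: "'o \<Rightarrow> 'm"
  assumes Dob_obj: "X \<in> Obj C \<Longrightarrow> Dob X \<in> Obj C"
    and Dmor_hom: "f \<in> Hom C X Y \<Longrightarrow> Dmor f \<in> Hom C (Dob Y) (Dob X)"
    and Dmor_id: "X \<in> Obj C \<Longrightarrow> Dmor (Id C X) = Id C (Dob X)"
    and Dmor_comp: "f \<in> Hom C X Y \<Longrightarrow> g \<in> Hom C Y Z \<Longrightarrow> Dmor (g \<cdot> f) = Dmor f \<cdot> Dmor g"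
    and Dmor_add: "f \<in> Hom C X Y \<Longrightarrow> f' \<in> Hom C X Y \<Longrightarrow> Dmor (f + f') = Dmor f + Dmor f'"
    and Dmor_scale: "f \<in> Hom C X Y \<Longrightarrow> Dmor (Scale C a f) = Scale C a (Dmor f)"
    and \<xi>_iso: "X \<in> Obj C \<Longrightarrow> is_iso C X (Dob (Dob X)) (\<xi> X)"
    and \<xi>_natural: "f \<in> Hom C X Y \<Longrightarrow> Dmor (Dmor f) \<cdot> \<xi> X = \<xi> Y \<cdot> f"
    and \<xi>_dual: "X \<in> Obj C \<Longrightarrow> Dmor (\<xi> X) \<cdot> \<xi> (Dob X) = Id C (Dob X)"

definition fixed_via ::
  "('o, 'm, 'k) lin_cat \<Rightarrow> ('o \<Rightarrow> 'o) \<Rightarrow> ('m \<Rightarrow> 'm) \<Rightarrow> ('o \<Rightarrow> 'm) \<Rightarrow> 'o \<Rightarrow> 'm \<Rightarrow> bool" where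
  "fixed_via C Dob Dmor \<xi> X \<Phi> \<longleftrightarrow> is_iso C (Dob X) X \<Phi> \<and>
     \<Phi> \<cdot>\<^bsub>C\<^esub> Dmor (inv_mor C (Dob X) X \<Phi>) \<cdot>\<^bsub>C\<^esub> \<xi> X = Id C X"

locale standard_duality =
  standard_category C \<Lambda> L Nabla \<Delta> T + duality C Dob Dmor \<xi>
  for C :: "('o, 'm::ab_group_add, 'k::field) lin_cat" (structure)
    and \<Lambda> :: "'l::order set" and L Nabla \<Delta> T :: "'l \<Rightarrow> 'o"
    and Dob :: "'o \<Rightarrow> 'o" and Dmor :: "'m \<Rightarrow> 'm" and \<xi> :: "'o \<Rightarrow> 'm" +
  assumes dual_costandard: "l \<in> \<Lambda> \<Longrightarrow> isomorphic C (Dob (Nabla l)) (\<Delta> l)"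
    and tilting_fixed: "tilting C \<Lambda> Nabla \<Delta> X \<Longrightarrow> indecomposable C X \<Longrightarrow>
          \<exists>\<Phi>. fixed_via C Dob Dmor \<xi> X \<Phi>"


section \<open>Standard and cellular bases\<close>

definition family_basis ::
  "('k::field \<Rightarrow> 'm::ab_group_add \<Rightarrow> 'm) \<Rightarrow> 'm set \<Rightarrow> 'i set \<Rightarrow> ('i \<Rightarrow> 'm) \<Rightarrow> bool" where
  "family_basis scale V I b \<longleftrightarrow>
     inj_on b I \<and> \<not> module.dependent scale (b ` I) \<and> module.span scale (b ` I) = V"

text \<open>A finite-dimensional unital associative algebra on a subspace \<open>E\<close> of a vector space.\<close>

locale fin_dim_algebra = vector_space scale
  for scale :: "'k::field \<Rightarrow> 'm::ab_group_add \<Rightarrow> 'm" (infixr \<open>*s\<close> 75) +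
  fixes E :: "'m set" and mult :: "'m \<Rightarrow> 'm \<Rightarrow> 'm" (infixl \<open>**\<close> 70) and one :: 'm
  assumes subspace_E: "subspace E"
    and finite_dim: "\<exists>B. finite B \<and> span B = E"
    and mult_closed: "x \<in> E \<Longrightarrow> y \<in> E \<Longrightarrow> x ** y \<in> E"
    and mult_assoc: "x \<in> E \<Longrightarrow> y \<in> E \<Longrightarrow> z \<in> E \<Longrightarrow> (x ** y) ** z = x ** (y ** z)"
    and one_closed: "one \<in> E"
    and one_left: "x \<in> E \<Longrightarrow> one ** x = x"
    and one_right: "x \<in> E \<Longrightarrow> x ** one = x"
    and distrib_left: "x \<in> E \<Longrightarrow> y \<in> E \<Longrightarrow> z \<in> E \<Longrightarrow> x ** (y + z) = x ** y + x ** z"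
    and distrib_right: "x \<in> E \<Longrightarrow> y \<in> E \<Longrightarrow> z \<in> E \<Longrightarrow> (x + y) ** z = x ** z + y ** z"
    and scale_left: "x \<in> E \<Longrightarrow> y \<in> E \<Longrightarrow> (a *s x) ** y = a *s (x ** y)"
    and scale_right: "x \<in> E \<Longrightarrow> y \<in> E \<Longrightarrow> x ** (a *s y) = a *s (x ** y)"

definition lower_span ::
  "('k::field \<Rightarrow> 'm::ab_group_add \<Rightarrow> 'm) \<Rightarrow> 'l::order set \<Rightarrow> ('l \<Rightarrow> 'i set) \<Rightarrow> ('l \<Rightarrow> 'j set) \<Rightarrow>
     ('l \<Rightarrow> 'i \<Rightarrow> 'j \<Rightarrow> 'm) \<Rightarrow> 'l \<Rightarrow> 'm set" where
  "lower_span scale \<Lambda> I J c l =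
     module.span scale {c m i j | m i j. m \<in> \<Lambda> \<and> m < l \<and> i \<in> I m \<and> j \<in> J m}"

text \<open>
  In \<open>left_mult\<close> the coefficients \<open>r k\<close> may depend on \<open>l\<close>, \<open>\<phi>\<close>, \<open>i\<close> but not on \<open>j\<close>, and
  symmetrically in \<open>right_mult\<close>. If \<open>J l\<close> is nonempty then \<open>I l\<close> is finite, because
  the basis is, and vice versa; so the sums never range over infinite sets.
\<close>

locale standard_basis = fin_dim_algebra scale E mult one
  for scale :: "'k::field \<Rightarrow> 'm::ab_group_add \<Rightarrow> 'm" (infixr \<open>*s\<close> 75)
    and E :: "'m set" and mult :: "'m \<Rightarrow> 'm \<Rightarrow> 'm" (infixl \<open>**\<close> 70) and one :: 'm +
  fixes \<Lambda> :: "'l::order set" and I :: "'l \<Rightarrow> 'i set" and J :: "'l \<Rightarrow> 'j set"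
    and c :: "'l \<Rightarrow> 'i \<Rightarrow> 'j \<Rightarrow> 'm"
  assumes basis: "family_basis scale E (SIGMA l : \<Lambda>. I l \<times> J l) (\<lambda>(l, i, j). c l i j)"
    and left_mult: "l \<in> \<Lambda> \<Longrightarrow> \<phi> \<in> E \<Longrightarrow> i \<in> I l \<Longrightarrow>
          \<exists>r :: 'i \<Rightarrow> 'k. \<forall>j \<in> J l.
            \<phi> ** c l i j - (\<Sum>k \<in> I l. r k *s c l k j) \<in> lower_span scale \<Lambda> I J c l"
    and right_mult: "l \<in> \<Lambda> \<Longrightarrow> \<phi> \<in> E \<Longrightarrow> j \<in> J l \<Longrightarrow>
          \<exists>r :: 'j \<Rightarrow> 'k. \<forall>i \<in> I l.
            c l i j ** \<phi> - (\<Sum>k \<in> J l. r k *s c l i k) \<in> lower_span scale \<Lambda> I J c l"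

locale cellular_basis = standard_basis scale E mult one \<Lambda> I I c
  for scale :: "'k::field \<Rightarrow> 'm::ab_group_add \<Rightarrow> 'm" (infixr \<open>*s\<close> 75)
    and E :: "'m set" and mult :: "'m \<Rightarrow> 'm \<Rightarrow> 'm" (infixl \<open>**\<close> 70) and one :: 'm
    and \<Lambda> :: "'l::order set" and I :: "'l \<Rightarrow> 'i set" and c :: "'l \<Rightarrow> 'i \<Rightarrow> 'i \<Rightarrow> 'm" +
  fixes \<iota> :: "'m \<Rightarrow> 'm"
  assumes \<iota>_closed: "x \<in> E \<Longrightarrow> \<iota> x \<in> E"
    and \<iota>_add: "x \<in> E \<Longrightarrow> y \<in> E \<Longrightarrow> \<iota> (x + y) = \<iota> x + \<iota> y"
    and \<iota>_scale: "x \<in> E \<Longrightarrow> \<iota> (a *s x) = a *s \<iota> x"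
    and \<iota>_one: "\<iota> one = one"
    and \<iota>_mult: "x \<in> E \<Longrightarrow> y \<in> E \<Longrightarrow> \<iota> (x ** y) = \<iota> y ** \<iota> x"
    and \<iota>_involution: "x \<in> E \<Longrightarrow> \<iota> (\<iota> x) = x"
    and \<iota>_cell: "l \<in> \<Lambda> \<Longrightarrow> i \<in> I l \<Longrightarrow> j \<in> I l \<Longrightarrow> \<iota> (c l i j) = c l j i"

text \<open>The index set \<open>{1, \<dots>, dim Hom(X, Y)}\<close>.\<close>

definition hom_index :: "('o, 'm::ab_group_add, 'k::field) lin_cat \<Rightarrow> 'o \<Rightarrow> 'o \<Rightarrow> nat set" where
  "hom_index C X Y = {1..vector_space.dim (Scale C) (Hom C X Y)}"

end

theory Submission
  imports Defs
begin

text \<open>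
  Write \<open>E\<close> for the endomorphism algebra of the tilting object \<open>X\<close>, \<open>I l\<close> for the index set of the
  given basis of \<open>Hom(\<Delta> l, X)\<close>, and \<open>c l i j\<close> for the composite \<open>X \<rightarrow> Tl l \<rightarrow> X\<close> of \<open>fhat l j\<close> and
  \<open>ghat l i\<close>. The proof shows that these composites span \<open>E\<close>, and that there are exactly \<open>dim E\<close>
  of them. The multiplication rules come out of the argument for spanning.

  \<^emph>\<open>Counting.\<close> Since \<open>Ext\<^sup>1(\<Delta> l, Nabla m)\<close> vanishes, so does \<open>Ext\<^sup>1(M, N)\<close> whenever \<open>M\<close> has a
  standard and \<open>N\<close> a costandard filtration (\<open>ext_orth_filtration\<close>). Hence \<open>dim Hom(M, N)\<close> is the
  sum of \<open>dim Hom(M, Nabla m)\<close> over the labels \<open>m\<close> of the costandard filtration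
  (\<open>dim_Hom_Nabla_filtered\<close>). For \<open>M = \<Delta> l\<close> this says that \<open>card (I l)\<close> is the
  multiplicity of \<open>Nabla l\<close> in \<open>X\<close>. For \<open>M = X\<close>, as the duality identifies \<open>Hom(\<Delta> m, X)\<close> with
  \<open>Hom(X, Nabla m)\<close> (\<open>dim_Hom_Nabla\<close>), it says that \<open>dim E\<close> is the sum of the squares
  \<open>(card (I l))\<^sup>2\<close>, the number of triples \<open>(l, i, j)\<close>.

  \<^emph>\<open>Spanning.\<close> Let \<open>proj l : Tl l \<rightarrow> Nabla l\<close> be the transpose of the inclusion of \<open>\<Delta> l\<close>. Transposing
  the basis of \<open>Hom(\<Delta> l, X)\<close> shows that the composites of \<open>proj l\<close> with the \<open>fhat l j\<close> are a basis of
  \<open>Hom(X, Nabla l)\<close>. Take a step \<open>N' \<rightarrow> N \<rightarrow> Nabla m\<close> of a costandard filtration of \<open>X\<close> and a map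
  \<open>\<phi> : X \<rightarrow> N\<close>. Its component in \<open>Nabla m\<close> is \<open>proj m\<close> after a combination \<open>f\<close> of the \<open>fhat m j\<close>;
  as \<open>Ext\<^sup>1(Tl m, N')\<close> vanishes, \<open>proj m\<close> lifts to \<open>e : Tl m \<rightarrow> N\<close>, and \<open>\<phi>\<close> minus \<open>e\<close> after \<open>f\<close> lands
  in \<open>N'\<close>. So an endomorphism of \<open>X\<close> is a sum of composites \<open>X \<rightarrow> Tl m \<rightarrow> X\<close> whose first factor is a
  combination of the \<open>fhat m j\<close>. The second factor agrees on \<open>\<Delta> m\<close> with a
  combination of the \<open>ghat m i\<close>, and the difference from it factors through \<open>Tl m / \<Delta> m\<close>, an object all of
  whose composition factors are smaller than \<open>m\<close> (\<open>T_quotient_supported\<close>). This suggests a recursion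
  over sets of labels, carried by \<open>factors_through_span\<close>: for a downward closed set \<open>P\<close>, an endomorphism
  that factors through an object with composition factors labelled by \<open>P\<close> is a combination of
  the \<open>c l i j\<close> with \<open>l\<close> in \<open>P\<close>. Only labels in \<open>P\<close> occur because a nonzero map \<open>Z \<rightarrow> Nabla m\<close>
  forces \<open>L m\<close> to be a composition factor of \<open>Z\<close> (\<open>nonzero_to_Nabla\<close>).

  \<^emph>\<open>Multiplication.\<close> For \<open>\<phi>\<close> in \<open>E\<close>, compare \<open>\<phi>\<close> after \<open>ghat l i\<close> with a combination of the
  \<open>ghat l k\<close> on \<open>\<Delta> l\<close>: the coefficients do not involve \<open>j\<close>, and the error factors through
  \<open>Tl l / \<Delta> l\<close>, so it lies in the span of smaller cells. This is the left rule. The anti-involution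
  exchanges \<open>c l i j\<close> and \<open>c l j i\<close>, which is a formal consequence of the fixed point
  conditions (\<open>transpose_transpose\<close>), and turns the left rule into the right rule.
\<close>

section \<open>Linear categories and their opposites\<close>

text \<open>
  The axioms of an abelian category are symmetric, so a general fact needs a proof in one direction
  only: its dual is the same fact in the opposite category.
\<close>

definition op_cat :: "('o, 'm, 'k) lin_cat \<Rightarrow> ('o, 'm, 'k) lin_cat" where
  "op_cat C = \<lparr>Obj = Obj C, Hom = (\<lambda>X Y. Hom C Y X), Id = Id C, Comp = (\<lambda>g f. f \<cdot>\<^bsub>C\<^esub> g), Scale = Scale C\<rparr>"

lemma op_cat_sel [simp]:
  "Obj (op_cat C) = Obj C" "Hom (op_cat C) X Y = Hom C Y X" "Id (op_cat C) = Id C"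
  "g \<cdot>\<^bsub>op_cat C\<^esub> f = f \<cdot>\<^bsub>C\<^esub> g" "Scale (op_cat C) = Scale C"
  by (simp_all add: op_cat_def)

lemma op_cat_notions [simp]:
  "is_mono (op_cat C) X Y f \<longleftrightarrow> is_epi C Y X f"
  "is_epi (op_cat C) X Y f \<longleftrightarrow> is_mono C Y X f"
  "zero_obj (op_cat C) Z \<longleftrightarrow> zero_obj C Z"
  "is_kernel (op_cat C) X Y f K k \<longleftrightarrow> is_cokernel C Y X f K k"
  "is_cokernel (op_cat C) X Y f K k \<longleftrightarrow> is_kernel C Y X f K k"
  "short_exact (op_cat C) A B Q f g \<longleftrightarrow> short_exact C Q B A g f"
  "is_biproduct (op_cat C) A B S i j p q \<longleftrightarrow> is_biproduct C A B S p q i j"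
proof -
  show "is_mono (op_cat C) X Y f \<longleftrightarrow> is_epi C Y X f"
    "is_epi (op_cat C) X Y f \<longleftrightarrow> is_mono C Y X f"
    "zero_obj (op_cat C) Z \<longleftrightarrow> zero_obj C Z"
    by (auto simp: is_mono_def is_epi_def zero_obj_def)
  show *: "is_kernel (op_cat C) X Y f K k \<longleftrightarrow> is_cokernel C Y X f K k"
    "is_cokernel (op_cat C) X Y f K k \<longleftrightarrow> is_kernel C Y X f K k" for X Y f K k
    by (simp_all add: is_kernel_def is_cokernel_def)
  show "short_exact (op_cat C) A B Q f g \<longleftrightarrow> short_exact C Q B A g f"
    unfolding short_exact_def * by auto
  show "is_biproduct (op_cat C) A B S i j p q \<longleftrightarrow> is_biproduct C A B S p q i j"
    by (auto simp: is_biproduct_def)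
qed

lemma op_cat_op_cat [simp]: "op_cat (op_cat C) = C"
  by (simp add: op_cat_def)

sublocale linear_category \<subseteq> V: vector_space "Scale C"
  by (rule scale)

context linear_category
begin

lemma linear_category_op: "linear_category (op_cat C)"
proof
  fix W X Y Z f g h
  assume *: "f \<in> Hom (op_cat C) W X" "g \<in> Hom (op_cat C) X Y" "h \<in> Hom (op_cat C) Y Z"
  then show "h \<cdot>\<^bsub>op_cat C\<^esub> g \<cdot>\<^bsub>op_cat C\<^esub> f = h \<cdot>\<^bsub>op_cat C\<^esub> (g \<cdot>\<^bsub>op_cat C\<^esub> f)"
    using comp_assoc[of h Z Y g X f W] by simp
qed (auto simp: V.scale_right_distrib V.scale_left_distrib id_hom id_left id_right
      intro: hom_obj hom_subspace comp_hom comp_add_left comp_add_right comp_scale_left comp_scale_right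
      dest: hom_obj)

lemma hom_objD: "f \<in> Hom C X Y \<Longrightarrow> X \<in> Obj C" "f \<in> Hom C X Y \<Longrightarrow> Y \<in> Obj C"
  using hom_obj by auto

lemma hom_closed:
  "X \<in> Obj C \<Longrightarrow> Y \<in> Obj C \<Longrightarrow> 0 \<in> Hom C X Y"
  "f \<in> Hom C X Y \<Longrightarrow> g \<in> Hom C X Y \<Longrightarrow> f + g \<in> Hom C X Y"
  "f \<in> Hom C X Y \<Longrightarrow> g \<in> Hom C X Y \<Longrightarrow> f - g \<in> Hom C X Y"
  "f \<in> Hom C X Y \<Longrightarrow> Scale C a f \<in> Hom C X Y"
  "X \<in> Obj C \<Longrightarrow> Y \<in> Obj C \<Longrightarrow> (\<And>i. i \<in> I \<Longrightarrow> F i \<in> Hom C X Y) \<Longrightarrow> sum F I \<in> Hom C X Y"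
  using hom_subspace[of X Y] V.subspace_0 V.subspace_add V.subspace_diff V.subspace_scale V.subspace_sum
    hom_objD by metis+

lemma comp_zero_left: "f \<in> Hom C X Y \<Longrightarrow> 0 \<cdot> f = 0"
  using comp_add_left[of f X Y 0 Y 0] hom_closed(1)[of Y Y] hom_objD by auto

lemma comp_diff_left:
  assumes "f \<in> Hom C X Y" "g \<in> Hom C Y Z" "g' \<in> Hom C Y Z"
  shows "(g - g') \<cdot> f = g \<cdot> f - g' \<cdot> f"
  using comp_add_left[OF assms(1) hom_closed(3)[OF assms(2,3)] assms(3)] by simp

lemma comp_sum_left:
  assumes "f \<in> Hom C X Y" "Z \<in> Obj C" "\<And>i. i \<in> I \<Longrightarrow> F i \<in> Hom C Y Z"
  shows "sum F I \<cdot> f = (\<Sum>i\<in>I. F i \<cdot> f)"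
  using assms(3)
proof (induction I rule: infinite_finite_induct)
  case (insert i I)
  then show ?case
    using comp_add_left[OF assms(1), of "F i" Z "sum F I"] hom_closed(5)[of Y Z I F] assms hom_objD
    by simp
qed (simp_all add: comp_zero_left[OF assms(1)])

lemma comp_zero_right: "g \<in> Hom C Y Z \<Longrightarrow> g \<cdot> 0 = 0"
  using linear_category.comp_zero_left[OF linear_category_op] by simp

lemma comp_diff_right:
  "f \<in> Hom C X Y \<Longrightarrow> f' \<in> Hom C X Y \<Longrightarrow> g \<in> Hom C Y Z \<Longrightarrow> g \<cdot> (f - f') = g \<cdot> f - g \<cdot> f'"
  using linear_category.comp_diff_left[OF linear_category_op] by simp

lemma monoI:
  assumes "f \<in> Hom C X Y" "\<And>W u. u \<in> Hom C W X \<Longrightarrow> f \<cdot> u = 0 \<Longrightarrow> u = 0"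
  shows "is_mono C X Y f"
  unfolding is_mono_def
  using assms comp_diff_right[OF _ _ assms(1)] hom_closed(3) by (metis eq_iff_diff_eq_0)

lemma mono_hom: "is_mono C X Y f \<Longrightarrow> f \<in> Hom C X Y"
  by (simp add: is_mono_def)

lemma mono_cancel: "is_mono C X Y f \<Longrightarrow> u \<in> Hom C W X \<Longrightarrow> v \<in> Hom C W X \<Longrightarrow> f \<cdot> u = f \<cdot> v \<Longrightarrow> u = v"
  by (auto simp: is_mono_def)

lemma mono_zeroD: "is_mono C X Y f \<Longrightarrow> u \<in> Hom C W X \<Longrightarrow> f \<cdot> u = 0 \<Longrightarrow> u = 0"
  using mono_cancel[of X Y f u W 0] comp_zero_right hom_closed(1) hom_objD mono_hom by metis

lemma epiI:
  "f \<in> Hom C X Y \<Longrightarrow> (\<And>W u. u \<in> Hom C Y W \<Longrightarrow> u \<cdot> f = 0 \<Longrightarrow> u = 0) \<Longrightarrow> is_epi C X Y f"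
  using linear_category.monoI[OF linear_category_op] by simp

lemma epi_hom: "is_epi C X Y f \<Longrightarrow> f \<in> Hom C X Y"
  by (simp add: is_epi_def)

lemma epi_cancel: "is_epi C X Y f \<Longrightarrow> u \<in> Hom C Y W \<Longrightarrow> v \<in> Hom C Y W \<Longrightarrow> u \<cdot> f = v \<cdot> f \<Longrightarrow> u = v"
  by (auto simp: is_epi_def)

lemma epi_zeroD: "is_epi C X Y f \<Longrightarrow> u \<in> Hom C Y W \<Longrightarrow> u \<cdot> f = 0 \<Longrightarrow> u = 0"
  using linear_category.mono_zeroD[OF linear_category_op] by simp

lemma mono_comp:
  assumes "is_mono C X Y f" "is_mono C Y Z g" shows "is_mono C X Z (g \<cdot> f)"
proof (rule monoI)
  show "g \<cdot> f \<in> Hom C X Z" using assms comp_hom mono_hom by blast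
  fix W u assume u: "u \<in> Hom C W X" "g \<cdot> f \<cdot> u = 0"
  then have "g \<cdot> (f \<cdot> u) = 0" using comp_assoc[OF u(1) mono_hom mono_hom] assms by metis
  then show "u = 0" using assms u mono_zeroD comp_hom mono_hom by meson
qed

lemma mono_right_factor:
  assumes "is_mono C X Z (g \<cdot> f)" "f \<in> Hom C X Y" "g \<in> Hom C Y Z" shows "is_mono C X Y f"
proof (rule monoI[OF assms(2)])
  fix W u assume u: "u \<in> Hom C W X" "f \<cdot> u = 0"
  then have "g \<cdot> f \<cdot> u = 0" using comp_assoc[OF u(1) assms(2,3)] comp_zero_right[OF assms(3)] by simp
  then show "u = 0" using assms(1) u mono_zeroD by blast
qed

lemma epi_left_factor:
  "is_epi C X Z (g \<cdot> f) \<Longrightarrow> f \<in> Hom C X Y \<Longrightarrow> g \<in> Hom C Y Z \<Longrightarrow> is_epi C Y Z g"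
  using linear_category.mono_right_factor[OF linear_category_op, of Z X f g Y] by simp

lemma epi_comp: "is_epi C X Y f \<Longrightarrow> is_epi C Y Z g \<Longrightarrow> is_epi C X Z (g \<cdot> f)"
  using linear_category.mono_comp[OF linear_category_op] by simp

lemma kernelI:
  assumes "f \<in> Hom C X Y" "is_mono C K X k" "f \<cdot> k = 0"
    "\<And>W u. u \<in> Hom C W X \<Longrightarrow> f \<cdot> u = 0 \<Longrightarrow> \<exists>v \<in> Hom C W K. k \<cdot> v = u"
  shows "is_kernel C X Y f K k"
  unfolding is_kernel_def
proof (intro conjI allI ballI impI)
  fix W u assume u: "u \<in> Hom C W X" "f \<cdot> u = 0"
  then show "\<exists>!v. v \<in> Hom C W K \<and> k \<cdot> v = u"
    using assms(4)[OF u] mono_cancel[OF assms(2)] by metis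
qed (use assms mono_hom in auto)

lemma kernelE:
  assumes "is_kernel C X Y f K k" "u \<in> Hom C W X" "f \<cdot> u = 0"
  obtains v where "v \<in> Hom C W K" "k \<cdot> v = u"
  using assms unfolding is_kernel_def by blast

lemma kernelD:
  assumes "is_kernel C X Y f K k"
  shows "f \<in> Hom C X Y" "k \<in> Hom C K X" "f \<cdot> k = 0" "is_mono C K X k"
proof -
  show f: "f \<in> Hom C X Y" and k: "k \<in> Hom C K X" and 0: "f \<cdot> k = 0"
    using assms unfolding is_kernel_def by auto
  show "is_mono C K X k" unfolding is_mono_def
  proof (intro conjI k allI ballI impI)
    fix W u v assume uv: "u \<in> Hom C W K" "v \<in> Hom C W K" "k \<cdot> u = k \<cdot> v"
    have "k \<cdot> u \<in> Hom C W X" "f \<cdot> (k \<cdot> u) = 0"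
      using comp_hom[OF uv(1) k] comp_assoc[OF uv(1) k f] 0 comp_zero_left[OF uv(1)] by auto
    then show "u = v" using assms uv unfolding is_kernel_def by metis
  qed
qed

lemma cokernelI:
  "f \<in> Hom C X Y \<Longrightarrow> is_epi C Y Q q \<Longrightarrow> q \<cdot> f = 0 \<Longrightarrow>
    (\<And>W u. u \<in> Hom C Y W \<Longrightarrow> u \<cdot> f = 0 \<Longrightarrow> \<exists>v \<in> Hom C Q W. v \<cdot> q = u) \<Longrightarrow> is_cokernel C X Y f Q q"
  using linear_category.kernelI[OF linear_category_op] by simp

lemma cokernelE:
  assumes "is_cokernel C X Y f Q q" "u \<in> Hom C Y W" "u \<cdot> f = 0"
  obtains v where "v \<in> Hom C Q W" "v \<cdot> q = u"
  using assms unfolding is_cokernel_def by blast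

lemma cokernelD:
  "is_cokernel C X Y f Q q \<Longrightarrow> f \<in> Hom C X Y"
  "is_cokernel C X Y f Q q \<Longrightarrow> q \<in> Hom C Y Q"
  "is_cokernel C X Y f Q q \<Longrightarrow> q \<cdot> f = 0"
  "is_cokernel C X Y f Q q \<Longrightarrow> is_epi C Y Q q"
  using linear_category.kernelD[OF linear_category_op, of Y X f Q q] by simp_all

lemma short_exactD:
  assumes "short_exact C A B Q f g"
  shows "f \<in> Hom C A B" "g \<in> Hom C B Q" "g \<cdot> f = 0" "is_mono C A B f" "is_epi C B Q g"
    "is_kernel C B Q g A f" "is_cokernel C A B f Q g"
    "A \<in> Obj C" "B \<in> Obj C" "Q \<in> Obj C"
  using assms kernelD[of B Q g A f] cokernelD[of A B f Q g] hom_objD unfolding short_exact_def by blast+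

lemma zero_obj_iff: "zero_obj C Z \<longleftrightarrow> Z \<in> Obj C \<and> Id C Z = 0"
proof
  assume "zero_obj C Z"
  then show "Z \<in> Obj C \<and> Id C Z = 0"
    using id_hom hom_closed(1)[of Z Z] unfolding zero_obj_def by metis
next
  assume *: "Z \<in> Obj C \<and> Id C Z = 0"
  then have "f = 0" if "f \<in> Hom C Z X" for f X
    using id_right[OF that] comp_zero_right[OF that] by simp
  moreover have "f = 0" if "f \<in> Hom C X Z" for f X
    using * id_left[OF that] comp_zero_left[OF that] by simp
  ultimately show "zero_obj C Z"
    using hom_closed(1) * unfolding zero_obj_def by metis
qed

lemma zero_obj_hom:
  "zero_obj C Z \<Longrightarrow> f \<in> Hom C Z X \<Longrightarrow> f = 0" "zero_obj C Z \<Longrightarrow> f \<in> Hom C X Z \<Longrightarrow> f = 0"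
  using hom_closed(1) hom_objD unfolding zero_obj_def by metis+

lemma mono_into_zero: "is_mono C X Z f \<Longrightarrow> zero_obj C Z \<Longrightarrow> zero_obj C X"
  using zero_obj_hom(2) mono_zeroD[of X Z f "Id C X" X] id_hom id_right mono_hom hom_objD
  unfolding zero_obj_iff by metis

lemma epi_from_zero: "is_epi C Z X f \<Longrightarrow> zero_obj C Z \<Longrightarrow> zero_obj C X"
  using linear_category.mono_into_zero[OF linear_category_op] by simp

lemma inverse_mor_unique:
  assumes "f \<in> Hom C X Y" "inverse_mor C X Y f g" "inverse_mor C X Y f h" shows "g = h"
  using assms comp_assoc[of h Y X f Y g X] id_left[of h Y X] id_right[of g Y X]
  unfolding inverse_mor_def by metis

lemma inv_morD:
  assumes "is_iso C X Y f"
  shows "f \<in> Hom C X Y" "inv_mor C X Y f \<in> Hom C Y X" "inv_mor C X Y f \<cdot> f = Id C X"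
    "f \<cdot> inv_mor C X Y f = Id C Y"
proof -
  show f: "f \<in> Hom C X Y" using assms by (simp add: is_iso_def)
  obtain g where g: "inverse_mor C X Y f g" using assms by (auto simp: is_iso_def)
  then have "inv_mor C X Y f = g"
    unfolding inv_mor_def using inverse_mor_unique[OF f] by blast
  then show "inv_mor C X Y f \<in> Hom C Y X" "inv_mor C X Y f \<cdot> f = Id C X" "f \<cdot> inv_mor C X Y f = Id C Y"
    using g by (auto simp: inverse_mor_def)
qed

lemma isoI: "f \<in> Hom C X Y \<Longrightarrow> g \<in> Hom C Y X \<Longrightarrow> g \<cdot> f = Id C X \<Longrightarrow> f \<cdot> g = Id C Y \<Longrightarrow> is_iso C X Y f"
  by (auto simp: is_iso_def inverse_mor_def)

lemma is_iso_inv: "is_iso C X Y f \<Longrightarrow> is_iso C Y X (inv_mor C X Y f)"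
  using inv_morD[of X Y f] by (intro isoI[of _ _ _ f]) auto

lemma is_iso_comp:
  assumes "is_iso C X Y f" "is_iso C Y Z g" shows "is_iso C X Z (g \<cdot> f)"
proof -
  note F = inv_morD[OF assms(1)] and G = inv_morD[OF assms(2)]
  let ?h = "inv_mor C X Y f \<cdot> inv_mor C Y Z g"
  have "?h \<cdot> (g \<cdot> f) = inv_mor C X Y f \<cdot> (inv_mor C Y Z g \<cdot> (g \<cdot> f))"
    using comp_assoc[OF comp_hom[OF F(1) G(1)] G(2) F(2)] by simp
  also have "\<dots> = Id C X"
    using comp_assoc[OF F(1) G(1) G(2)] G(3) F id_left[OF F(1)] by simp
  finally have 1: "?h \<cdot> (g \<cdot> f) = Id C X" .
  have "g \<cdot> f \<cdot> ?h = g \<cdot> (f \<cdot> ?h)"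
    using comp_assoc[OF comp_hom[OF G(2) F(2)] F(1) G(1)] by simp
  also have "\<dots> = Id C Z"
    using comp_assoc[OF G(2) F(2) F(1)] F(4) G id_left[OF G(2)] by simp
  finally show ?thesis
    using 1 F G comp_hom by (intro isoI[of _ _ _ ?h]) blast+
qed

lemma iso_mono: "is_iso C X Y f \<Longrightarrow> is_mono C X Y f"
proof (rule monoI)
  assume f: "is_iso C X Y f"
  note F = inv_morD[OF f]
  fix W u assume u: "u \<in> Hom C W X" "f \<cdot> u = 0"
  have "u = inv_mor C X Y f \<cdot> (f \<cdot> u)"
    using comp_assoc[OF u(1) F(1,2)] F(3) id_left[OF u(1)] by simp
  then show "u = 0" using u comp_zero_right[OF F(2)] by simp
qed (simp add: is_iso_def)

lemma iso_op [simp]: "is_iso (op_cat C) X Y f \<longleftrightarrow> is_iso C Y X f"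
  by (auto simp: is_iso_def inverse_mor_def)

lemma iso_epi: "is_iso C X Y f \<Longrightarrow> is_epi C X Y f"
  using linear_category.iso_mono[OF linear_category_op, of Y X f] by simp

lemma isomorphic_sym: "isomorphic C X Y \<Longrightarrow> isomorphic C Y X"
  unfolding isomorphic_def using is_iso_inv by blast

lemma isomorphic_trans: "isomorphic C X Y \<Longrightarrow> isomorphic C Y Z \<Longrightarrow> isomorphic C X Z"
  unfolding isomorphic_def using is_iso_comp by blast

lemma short_exact_iso_quotient:
  assumes "short_exact C A B Q f g" "is_iso C Q R h"
  shows "short_exact C A B R f (h \<cdot> g)"
proof -
  note S = short_exactD[OF assms(1)]
  note H = inv_morD[OF assms(2)]
  have hg: "h \<cdot> g \<in> Hom C B R" using comp_hom[OF S(2) H(1)] .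
  have z: "h \<cdot> g \<cdot> f = 0" using comp_assoc[OF S(1,2) H(1)] S(3) comp_zero_right[OF H(1)] by simp
  have "is_kernel C B R (h \<cdot> g) A f"
  proof (rule kernelI[OF hg S(4) z])
    fix W u assume u: "u \<in> Hom C W B" "h \<cdot> g \<cdot> u = 0"
    then have "h \<cdot> (g \<cdot> u) = 0" using comp_assoc[OF u(1) S(2) H(1)] by simp
    then have "g \<cdot> u = 0" using mono_zeroD[OF iso_mono[OF assms(2)]] comp_hom[OF u(1) S(2)] by blast
    then show "\<exists>v\<in>Hom C W A. f \<cdot> v = u" using kernelE[OF S(6) u(1)] by blast
  qed
  moreover have "is_cokernel C A B f R (h \<cdot> g)"
  proof (rule cokernelI[OF S(1) epi_comp[OF S(5) iso_epi[OF assms(2)]] z])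
    fix W u assume u: "u \<in> Hom C B W" "u \<cdot> f = 0"
    then obtain v where v: "v \<in> Hom C Q W" "v \<cdot> g = u" using cokernelE[OF S(7)] by blast
    have "v \<cdot> inv_mor C Q R h \<cdot> (h \<cdot> g) = v \<cdot> (inv_mor C Q R h \<cdot> (h \<cdot> g))"
      by (rule comp_assoc[OF hg H(2) v(1)])
    also have "\<dots> = u" using comp_assoc[OF S(2) H(1,2)] H(3) id_left[OF S(2)] v by simp
    finally show "\<exists>w\<in>Hom C R W. w \<cdot> (h \<cdot> g) = u" using comp_hom[OF H(2) v(1)] by blast
  qed
  ultimately show ?thesis by (simp add: short_exact_def)
qed

end

section \<open>Abelian categories\<close>

context abelian_category
begin

lemma abelian_category_op: "abelian_category (op_cat C)"
proof -
  interpret op: linear_category "op_cat C" by (rule linear_category_op)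
  show ?thesis
  proof
    show "\<exists>S i j p q. is_biproduct (op_cat C) A B S i j p q"
      if "A \<in> Obj (op_cat C)" "B \<in> Obj (op_cat C)" for A B
      using biproduct_exists[of A B] that by simp blast
  qed (use zero_exists kernel_exists cokernel_exists mono_is_kernel epi_is_cokernel in \<open>simp_all\<close>)
qed

text \<open>
  A monomorphism is by assumption the kernel of some map \<open>h\<close>. As \<open>h\<close> factors through the cokernel
  \<open>q\<close>, anything killed by \<open>q\<close> is killed by \<open>h\<close>, so the monomorphism is also the kernel of \<open>q\<close>.
\<close>

lemma mono_short_exact:
  assumes "is_mono C X Y f" "is_cokernel C X Y f Q q" shows "short_exact C X Y Q f q"
proof -
  note Q = cokernelD[OF assms(2)]
  obtain Z h where h: "is_kernel C Y Z h X f" using mono_is_kernel[OF assms(1)] by blast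
  note H = kernelD[OF h]
  obtain v where v: "v \<in> Hom C Q Z" "v \<cdot> q = h" using cokernelE[OF assms(2) H(1,3)] by blast
  have "is_kernel C Y Q q X f"
  proof (rule kernelI[OF Q(2) assms(1) Q(3)])
    fix W u assume u: "u \<in> Hom C W Y" "q \<cdot> u = 0"
    then have "h \<cdot> u = 0" using comp_assoc[OF u(1) Q(2) v(1)] v comp_zero_right[OF v(1)] by simp
    then show "\<exists>v\<in>Hom C W X. f \<cdot> v = u" using kernelE[OF h u(1)] by blast
  qed
  then show ?thesis using assms(2) by (simp add: short_exact_def)
qed

lemma epi_short_exact: "is_epi C X Y f \<Longrightarrow> is_kernel C X Y f K k \<Longrightarrow> short_exact C K X Y k f"
  using abelian_category.mono_short_exact[OF abelian_category_op, of Y X f K k] by simp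

lemma mono_short_exactE:
  assumes "is_mono C X Y f" obtains Q q where "short_exact C X Y Q f q"
  using assms cokernel_exists[OF mono_hom[OF assms]] mono_short_exact by blast

lemma epi_short_exactE:
  assumes "is_epi C X Y f" obtains K k where "short_exact C K X Y k f"
  using assms kernel_exists[OF epi_hom[OF assms]] epi_short_exact by blast

text \<open>
  The map induced on the coimage is mono, which gives epi-mono factorizations. If it
  kills \<open>x\<close>, it factors through the cokernel \<open>c\<close> of \<open>x\<close>; then \<open>f\<close> factors through the epimorphism
  \<open>c \<cdot> q\<close>, whose kernel can be no larger than that of \<open>f\<close>. This gives a left inverse of \<open>c\<close>, so \<open>x = 0\<close>.
\<close>

lemma coimage_mono:
  assumes "is_kernel C X Y f K k" "is_cokernel C K X k I q" "m \<in> Hom C I Y" "m \<cdot> q = f"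
  shows "is_mono C I Y m"
proof (rule monoI[OF assms(3)])
  note K = kernelD[OF assms(1)] and Q = cokernelD[OF assms(2)]
  fix W x assume x: "x \<in> Hom C W I" "m \<cdot> x = 0"
  obtain J c where c: "is_cokernel C W I x J c" using cokernel_exists[OF x(1)] by blast
  note J = cokernelD[OF c]
  obtain m' where m': "m' \<in> Hom C J Y" "m' \<cdot> c = m" using cokernelE[OF c assms(3) x(2)] by blast
  have cq: "is_epi C X J (c \<cdot> q)" using epi_comp[OF Q(4) J(4)] .
  obtain Z y where y: "is_cokernel C Z X y J (c \<cdot> q)" using epi_is_cokernel[OF cq] by blast
  note Y = cokernelD[OF y]
  have "m' \<cdot> (c \<cdot> q) = f" using comp_assoc[OF Q(2) J(2) m'(1)] m' assms(4) by simp
  then have "f \<cdot> y = 0" using comp_assoc[OF Y(1,2) m'(1)] Y(3) comp_zero_right[OF m'(1)] by simp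
  then obtain t where t: "t \<in> Hom C Z K" "k \<cdot> t = y" using kernelE[OF assms(1) Y(1)] by blast
  have "q \<cdot> y = 0" using comp_assoc[OF t(1) K(2) Q(2)] Q(3) t comp_zero_left[OF t(1)] by simp
  then obtain s where s: "s \<in> Hom C J I" "s \<cdot> (c \<cdot> q) = q" using cokernelE[OF y Q(2)] by blast
  have "s \<cdot> c \<cdot> q = Id C I \<cdot> q"
    using comp_assoc[OF Q(2) J(2) s(1)] s id_left[OF Q(2)] by simp
  then have sc: "s \<cdot> c = Id C I"
    using epi_cancel[OF Q(4)] comp_hom[OF J(2) s(1)] id_hom hom_objD(2)[OF Q(2)] by blast
  have "x = s \<cdot> (c \<cdot> x)" using comp_assoc[OF x(1) J(2) s(1)] sc id_left[OF x(1)] by simp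
  then show "x = 0" using J(3) comp_zero_right[OF s(1)] by simp
qed

lemma epi_mono_factorization:
  assumes "f \<in> Hom C X Y"
  obtains I q m where "is_epi C X I q" "is_mono C I Y m" "m \<cdot> q = f"
proof -
  obtain K k where k: "is_kernel C X Y f K k" using kernel_exists[OF assms] by blast
  note K = kernelD[OF k]
  obtain I q where q: "is_cokernel C K X k I q" using cokernel_exists[OF K(2)] by blast
  obtain m where m: "m \<in> Hom C I Y" "m \<cdot> q = f" using cokernelE[OF q K(1,3)] by blast
  show ?thesis using that cokernelD(4)[OF q] coimage_mono[OF k q m] m(2) by blast
qed

lemma mono_epi_iso:
  assumes "is_mono C X Y f" "is_epi C X Y f" shows "is_iso C X Y f"
proof -
  obtain Q q where q: "short_exact C X Y Q f q" using mono_short_exactE[OF assms(1)] by blast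
  note S = short_exactD[OF q]
  have "q = 0" using epi_zeroD[OF assms(2) S(2,3)] .
  then have "q \<cdot> Id C Y = 0" using id_right[OF S(2)] by simp
  then obtain g where g: "g \<in> Hom C Y X" "f \<cdot> g = Id C Y"
    using kernelE[OF S(6) id_hom[OF S(9)]] by blast
  have "f \<cdot> (g \<cdot> f) = f \<cdot> Id C X"
    using comp_assoc[OF S(1) g(1) S(1)] g(2) id_left[OF S(1)] id_right[OF S(1)] by simp
  then have "g \<cdot> f = Id C X"
    using mono_cancel[OF S(4)] comp_hom[OF S(1) g(1)] id_hom[OF S(8)] by blast
  then show ?thesis using isoI[OF S(1) g(1)] g(2) by blast
qed

lemma epi_with_zero_kernel_iso:
  assumes "short_exact C K X Y k f" "zero_obj C K" shows "is_iso C X Y f"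
proof (rule mono_epi_iso)
  note S = short_exactD[OF assms(1)]
  show "is_epi C X Y f" by (rule S(5))
  show "is_mono C X Y f"
  proof (rule monoI[OF S(2)])
    fix W u assume u: "u \<in> Hom C W X" "f \<cdot> u = 0"
    then obtain v where v: "v \<in> Hom C W K" "k \<cdot> v = u" using kernelE[OF S(6)] by blast
    then show "u = 0" using zero_obj_hom(2)[OF assms(2) v(1)] comp_zero_right[OF S(1)] by simp
  qed
qed

text \<open>
  The isomorphism theorem \<open>(X/A) / (X'/A) = X/X'\<close> for \<open>A \<subseteq> X' \<subseteq> X\<close>, with \<open>B = X/A\<close>, \<open>B' = X'/A\<close>
  and \<open>S = X/X'\<close>. That \<open>v\<close> is mono is an instance of \<open>coimage_mono\<close>, because \<open>a'\<close> is the kernel of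
  \<open>b \<cdot> x\<close>.
\<close>

lemma short_exact_quotients:
  assumes ab: "short_exact C A X B a b" and xs: "short_exact C X' X S x s"
    and a': "a' \<in> Hom C A X'" "x \<cdot> a' = a" and b': "is_cokernel C A X' a' B' b'"
  obtains v w where "short_exact C B' B S v w" "v \<cdot> b' = b \<cdot> x" "w \<cdot> b = s"
proof -
  note P = short_exactD[OF ab] and S = short_exactD[OF xs] and B' = cokernelD[OF b']
  have bx: "b \<cdot> x \<in> Hom C X' B" using comp_hom[OF S(1) P(2)] .
  have bxa: "b \<cdot> x \<cdot> a' = 0" using comp_assoc[OF a'(1) S(1) P(2)] a' P(3) by simp
  have sa: "s \<cdot> a = 0"
    using comp_assoc[OF a'(1) S(1,2)] a'(2) S(3) comp_zero_left[OF a'(1)] by simp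
  obtain v where v: "v \<in> Hom C B' B" "v \<cdot> b' = b \<cdot> x" using cokernelE[OF b' bx bxa] by blast
  obtain w where w: "w \<in> Hom C B S" "w \<cdot> b = s" using cokernelE[OF P(7) S(2) sa] by blast
  have "is_kernel C X' B (b \<cdot> x) A a'"
  proof (rule kernelI[OF bx _ bxa])
    show "is_mono C A X' a'" using mono_right_factor[OF _ a'(1) S(1)] a'(2) P(4) by simp
    fix W u assume u: "u \<in> Hom C W X'" "b \<cdot> x \<cdot> u = 0"
    then have "b \<cdot> (x \<cdot> u) = 0" using comp_assoc[OF u(1) S(1) P(2)] by simp
    then obtain t where t: "t \<in> Hom C W A" "a \<cdot> t = x \<cdot> u"
      using kernelE[OF P(6) comp_hom[OF u(1) S(1)]] by blast
    then have "x \<cdot> (a' \<cdot> t) = x \<cdot> u" using comp_assoc[OF t(1) a'(1) S(1)] a'(2) by simp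
    then have "a' \<cdot> t = u" using mono_cancel[OF S(4)] comp_hom[OF t(1) a'(1)] u(1) by blast
    then show "\<exists>v\<in>Hom C W A. a' \<cdot> v = u" using t(1) by blast
  qed
  then have v_mono: "is_mono C B' B v" using coimage_mono b' v by blast
  have "is_epi C B S w"
    using epi_left_factor[OF _ P(2) w(1)] S(5) w(2) by simp
  moreover have "w \<cdot> v = 0"
  proof -
    have "w \<cdot> v \<cdot> b' = w \<cdot> (b \<cdot> x)" using comp_assoc[OF B'(2) v(1) w(1)] v(2) by simp
    also have "\<dots> = 0" using comp_assoc[OF S(1) P(2) w(1)] w(2) S(3) by simp
    finally show ?thesis using epi_zeroD[OF B'(4)] comp_hom[OF v(1) w(1)] by blast
  qed
  ultimately have "is_cokernel C B' B v S w"
  proof (rule cokernelI[OF v(1)])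
    fix W t assume t: "t \<in> Hom C B W" "t \<cdot> v = 0"
    have tb: "t \<cdot> b \<in> Hom C X W" using comp_hom[OF P(2) t(1)] .
    have "t \<cdot> b \<cdot> x = t \<cdot> (v \<cdot> b')" using comp_assoc[OF S(1) P(2) t(1)] v(2) by simp
    also have "\<dots> = 0"
      using comp_assoc[OF B'(2) v(1) t(1)] t(2) comp_zero_left[OF B'(2)] by simp
    finally obtain z where z: "z \<in> Hom C S W" "z \<cdot> s = t \<cdot> b" using cokernelE[OF S(7) tb] by blast
    have "z \<cdot> w \<cdot> b = t \<cdot> b" using comp_assoc[OF P(2) w(1) z(1)] w(2) z(2) by simp
    then have "z \<cdot> w = t" using epi_cancel[OF P(5)] comp_hom[OF w(1) z(1)] t(1) by blast
    then show "\<exists>z\<in>Hom C S W. z \<cdot> w = t" using z(1) by blast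
  qed
  then have "short_exact C B' B S v w" using mono_short_exact[OF v_mono] by blast
  then show ?thesis using that v w by blast
qed

text \<open>
  Dually, for quotients \<open>E \<rightarrow> M \<rightarrow> M2\<close>: the kernel of \<open>E \<rightarrow> M2\<close> modulo that of \<open>E \<rightarrow> M\<close> is the kernel
  of \<open>M \<rightarrow> M2\<close>.
\<close>

lemma short_exact_subobjects:
  assumes "short_exact C N E M f g" "short_exact C K E M2 k h"
    "y \<in> Hom C M M2" "y \<cdot> g = h" "is_kernel C M M2 y M1 x"
  obtains v w where "short_exact C N K M1 v w" "x \<cdot> w = g \<cdot> k" "k \<cdot> v = f"
  by (rule abelian_category.short_exact_quotients[OF abelian_category_op, simplified, OF assms(2,1,3,4,5)])
    (use that in blast)

end

section \<open>Vanishing of the first Ext group\<close>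

text \<open>
  The vanishing of \<open>Ext\<^sup>1(M, N)\<close> in the form in which it is used: all extensions split. A retraction
  of \<open>f\<close> and a section of \<open>g\<close> determine each other, so that the notion is self-dual.
\<close>

definition ext_orth :: "('o, 'm::ab_group_add, 'k) lin_cat \<Rightarrow> 'o \<Rightarrow> 'o \<Rightarrow> bool" where
  "ext_orth C M N \<longleftrightarrow> (\<forall>E f g. short_exact C N E M f g \<longrightarrow> (\<exists>r \<in> Hom C E N. r \<cdot>\<^bsub>C\<^esub> f = Id C N))"

context linear_category
begin

lemma retraction_imp_section:
  assumes "short_exact C N E M f g" "r \<in> Hom C E N" "r \<cdot> f = Id C N"
  obtains s where "s \<in> Hom C M E" "g \<cdot> s = Id C M"
proof -
  note S = short_exactD[OF assms(1)]
  let ?p = "Id C E - f \<cdot> r"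
  have fr: "f \<cdot> r \<in> Hom C E E" using comp_hom[OF assms(2) S(1)] .
  have e: "?p \<in> Hom C E E" using hom_closed(3)[OF id_hom[OF S(9)] fr] .
  have "?p \<cdot> f = f - f \<cdot> (r \<cdot> f)"
    using comp_diff_left[OF S(1) id_hom[OF S(9)] fr] comp_assoc[OF S(1) assms(2) S(1)] id_left[OF S(1)]
    by simp
  then have "?p \<cdot> f = 0" using assms(3) id_right[OF S(1)] by simp
  then obtain s where s: "s \<in> Hom C M E" "s \<cdot> g = ?p" using cokernelE[OF S(7) e] by blast
  have "g \<cdot> s \<cdot> g = g \<cdot> ?p" using comp_assoc[OF S(2) s(1) S(2)] s(2) by simp
  also have "\<dots> = g - g \<cdot> f \<cdot> r"
    using comp_diff_right[OF id_hom[OF S(9)] fr S(2)] comp_assoc[OF assms(2) S(1,2)] id_right[OF S(2)]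
    by simp
  also have "\<dots> = Id C M \<cdot> g" using S(3) comp_zero_left[OF assms(2)] id_left[OF S(2)] by simp
  finally have "g \<cdot> s = Id C M"
    using epi_cancel[OF S(5)] comp_hom[OF s(1) S(2)] id_hom[OF S(10)] by blast
  then show ?thesis using that s(1) by blast
qed

lemma section_imp_retraction:
  assumes "short_exact C N E M f g" "s \<in> Hom C M E" "g \<cdot> s = Id C M"
  obtains r where "r \<in> Hom C E N" "r \<cdot> f = Id C N"
  by (rule linear_category.retraction_imp_section[OF linear_category_op, simplified, OF assms that])

lemma ext_orth_op: "ext_orth C M N \<Longrightarrow> ext_orth (op_cat C) N M"
  unfolding ext_orth_def
proof (intro allI impI)
  fix E f g
  assume *: "\<forall>E f g. short_exact C N E M f g \<longrightarrow> (\<exists>r\<in>Hom C E N. r \<cdot> f = Id C N)"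
    and "short_exact (op_cat C) M E N f g"
  then have fg: "short_exact C N E M g f" by simp
  then obtain r where "r \<in> Hom C E N" "r \<cdot> g = Id C N" using * by blast
  then obtain s where "s \<in> Hom C M E" "f \<cdot> s = Id C M" using retraction_imp_section[OF fg] by blast
  then show "\<exists>r\<in>Hom (op_cat C) E M. r \<cdot>\<^bsub>op_cat C\<^esub> f = Id (op_cat C) M" by auto
qed

end

context abelian_category
begin

text \<open>
  The pushout of an extension along a map on its subobject, constructed as the cokernel of
  \<open>A \<rightarrow> B \<oplus> N\<close>.
\<close>

lemma pushout_short_exact:
  assumes "short_exact C A B M f g" "a \<in> Hom C A N"
  obtains P n c h where "short_exact C N P M n h" "c \<in> Hom C B P" "c \<cdot> f = n \<cdot> a"
proof -
  note S = short_exactD[OF assms(1)]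
  have N: "N \<in> Obj C" using hom_objD(2)[OF assms(2)] .
  obtain D i j p q where "is_biproduct C B N D i j p q" using biproduct_exists[OF S(9) N] by blast
  then have i: "i \<in> Hom C B D" and j: "j \<in> Hom C N D" and p: "p \<in> Hom C D B" and q: "q \<in> Hom C D N"
    and pi: "p \<cdot> i = Id C B" and qj: "q \<cdot> j = Id C N" and qi: "q \<cdot> i = 0" and pj: "p \<cdot> j = 0"
    and ipjq: "i \<cdot> p + j \<cdot> q = Id C D"
    unfolding is_biproduct_def by blast+
  define d where "d = i \<cdot> f - j \<cdot> a"
  have if': "i \<cdot> f \<in> Hom C A D" and ja: "j \<cdot> a \<in> Hom C A D"
    using comp_hom[OF S(1) i] comp_hom[OF assms(2) j] .
  have d: "d \<in> Hom C A D" unfolding d_def using hom_closed(3)[OF if' ja] .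
  have pd: "p \<cdot> d = f"
    unfolding d_def comp_diff_right[OF if' ja p] comp_assoc[OF S(1) i p, symmetric]
      comp_assoc[OF assms(2) j p, symmetric] pi pj
    using id_left[OF S(1)] comp_zero_left[OF assms(2)] by simp
  have qd: "q \<cdot> d = - a"
    unfolding d_def comp_diff_right[OF if' ja q] comp_assoc[OF S(1) i q, symmetric]
      comp_assoc[OF assms(2) j q, symmetric] qi qj
    using id_left[OF assms(2)] comp_zero_left[OF S(1)] by simp
  have "is_mono C A D d" using mono_right_factor[OF _ d p] pd S(4) by simp
  then obtain P e where e: "short_exact C A D P d e" using mono_short_exactE by blast
  note E = short_exactD[OF e]
  have ei: "e \<cdot> i \<in> Hom C B P" and ej: "e \<cdot> j \<in> Hom C N P"
    using comp_hom[OF i E(2)] comp_hom[OF j E(2)] .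
  have sq: "e \<cdot> i \<cdot> f = e \<cdot> j \<cdot> a"
    using E(3) unfolding d_def comp_diff_right[OF if' ja E(2)]
    using comp_assoc[OF S(1) i E(2)] comp_assoc[OF assms(2) j E(2)] by simp
  have "is_mono C N P (e \<cdot> j)"
  proof (rule monoI[OF ej])
    fix W u assume u: "u \<in> Hom C W N" "e \<cdot> j \<cdot> u = 0"
    then have "e \<cdot> (j \<cdot> u) = 0" using comp_assoc[OF u(1) j E(2)] by simp
    then obtain t where t: "t \<in> Hom C W A" "d \<cdot> t = j \<cdot> u"
      using kernelE[OF E(6) comp_hom[OF u(1) j]] by blast
    have "f \<cdot> t = p \<cdot> (j \<cdot> u)" using comp_assoc[OF t(1) d p] pd t(2) by simp
    also have "\<dots> = 0" using comp_assoc[OF u(1) j p] pj comp_zero_left[OF u(1)] by simp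
    finally have "t = 0" using mono_zeroD[OF S(4) t(1)] by blast
    then have "j \<cdot> u = 0" using t(2) comp_zero_right[OF d] by simp
    then show "u = 0"
      using comp_assoc[OF u(1) j q] qj id_left[OF u(1)] comp_zero_right[OF q] by simp
  qed
  moreover
  have gpd: "g \<cdot> p \<cdot> d = 0" using comp_assoc[OF d p S(2)] pd S(3) by simp
  obtain h where h: "h \<in> Hom C P M" "h \<cdot> e = g \<cdot> p"
    using cokernelE[OF E(7) comp_hom[OF p S(2)] gpd] by blast
  have hi: "h \<cdot> (e \<cdot> i) = g"
    using comp_assoc[OF i E(2) h(1)] h(2) comp_assoc[OF i p S(2)] pi id_right[OF S(2)] by simp
  have "is_cokernel C N P (e \<cdot> j) M h"
  proof (rule cokernelI[OF ej])
    show "is_epi C P M h"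
      using epi_left_factor[OF _ ei h(1)] S(5) hi by simp
    show "h \<cdot> (e \<cdot> j) = 0"
      using comp_assoc[OF j E(2) h(1)] h(2) comp_assoc[OF j p S(2)] pj comp_zero_right[OF S(2)] by simp
    fix W u assume u: "u \<in> Hom C P W" "u \<cdot> (e \<cdot> j) = 0"
    have uei: "u \<cdot> (e \<cdot> i) \<in> Hom C B W" using comp_hom[OF ei u(1)] .
    have "u \<cdot> (e \<cdot> i) \<cdot> f = u \<cdot> (e \<cdot> j \<cdot> a)" using comp_assoc[OF S(1) ei u(1)] sq by simp
    also have "\<dots> = 0"
      using comp_assoc[OF assms(2) ej u(1)] u(2) comp_zero_left[OF assms(2)] by simp
    finally obtain v where v: "v \<in> Hom C M W" "v \<cdot> g = u \<cdot> (e \<cdot> i)" using cokernelE[OF S(7) uei] by blast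
    have ue: "u \<cdot> e \<in> Hom C D W" using comp_hom[OF E(2) u(1)] .
    have vgp: "v \<cdot> g \<cdot> p = u \<cdot> e \<cdot> (i \<cdot> p)"
      using v(2) comp_assoc[OF p i ue] comp_assoc[OF i E(2) u(1)] by simp
    have "u \<cdot> e = u \<cdot> e \<cdot> (i \<cdot> p + j \<cdot> q)" using ipjq id_right[OF ue] by simp
    also have "\<dots> = u \<cdot> e \<cdot> (i \<cdot> p) + u \<cdot> e \<cdot> j \<cdot> q"
      using comp_add_right[OF comp_hom[OF p i] comp_hom[OF q j] ue] comp_assoc[OF q j ue] by simp
    also have "\<dots> = v \<cdot> g \<cdot> p"
      using vgp comp_assoc[OF j E(2) u(1)] u(2) comp_zero_left[OF q] by simp
    also have "\<dots> = v \<cdot> h \<cdot> e"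
      using comp_assoc[OF p S(2) v(1)] comp_assoc[OF E(2) h(1) v(1)] h(2) by simp
    finally have "v \<cdot> h = u" using epi_cancel[OF E(5)] comp_hom[OF h(1) v(1)] u(1) by metis
    then show "\<exists>v\<in>Hom C M W. v \<cdot> h = u" using v(1) by blast
  qed
  ultimately have "short_exact C N P M (e \<cdot> j) h" by (rule mono_short_exact)
  then show ?thesis using that ei sq by blast
qed

text \<open>
  Half of the long exact sequence: a retraction of the pushout of the extension along \<open>a\<close> extends \<open>a\<close>.
\<close>

lemma ext_orth_extend:
  assumes "ext_orth C M N" "short_exact C A B M f g" "a \<in> Hom C A N"
  obtains b where "b \<in> Hom C B N" "b \<cdot> f = a"
proof -
  obtain P n c h where *: "short_exact C N P M n h" "c \<in> Hom C B P" "c \<cdot> f = n \<cdot> a"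
    by (rule pushout_short_exact[OF assms(2,3)])
  note S = short_exactD[OF assms(2)] and N = short_exactD[OF *(1)]
  obtain r where r: "r \<in> Hom C P N" "r \<cdot> n = Id C N"
    using assms(1) *(1) unfolding ext_orth_def by blast
  have "r \<cdot> c \<cdot> f = r \<cdot> (n \<cdot> a)" using comp_assoc[OF S(1) *(2) r(1)] *(3) by simp
  also have "\<dots> = a" using comp_assoc[OF assms(3) N(1) r(1)] r(2) id_left[OF assms(3)] by simp
  finally show ?thesis using that comp_hom[OF *(2) r(1)] by blast
qed

lemma ext_orth_lift:
  assumes "ext_orth C M N" "short_exact C N E Q f g" "h \<in> Hom C M Q"
  obtains e where "e \<in> Hom C M E" "g \<cdot> e = h"
  using that
  by (rule abelian_category.ext_orth_extend[OF abelian_category_op ext_orth_op[OF assms(1)], simplified,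
        OF assms(2,3)])

text \<open>
  Given an extension \<open>E\<close> of \<open>M\<close>, let \<open>K\<close> be the preimage of \<open>M1\<close>. A retraction exists on \<open>K\<close>, since \<open>K\<close>
  is an extension of \<open>M1\<close>, and it extends to \<open>E\<close> because \<open>E/K = M2\<close>.
\<close>

lemma ext_orth_extension_left:
  assumes "short_exact C M1 M M2 x y" "ext_orth C M1 N" "ext_orth C M2 N"
  shows "ext_orth C M N"
  unfolding ext_orth_def
proof (intro allI impI)
  fix E f g assume fg: "short_exact C N E M f g"
  note S = short_exactD[OF assms(1)] and F = short_exactD[OF fg]
  have "is_epi C E M2 (y \<cdot> g)" using epi_comp[OF F(5) S(5)] .
  then obtain K k where k: "short_exact C K E M2 k (y \<cdot> g)" using epi_short_exactE by blast
  note K = short_exactD[OF k]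
  obtain v w where vw: "short_exact C N K M1 v w" "k \<cdot> v = f"
    using short_exact_subobjects[OF fg k S(2) refl S(6)] by blast
  note V = short_exactD[OF vw(1)]
  obtain r where r: "r \<in> Hom C K N" "r \<cdot> v = Id C N" using assms(2) vw(1) unfolding ext_orth_def by blast
  obtain t where t: "t \<in> Hom C E N" "t \<cdot> k = r" using ext_orth_extend[OF assms(3) k r(1)] by blast
  have "t \<cdot> f = Id C N" using comp_assoc[OF V(1) K(1) t(1)] t(2) r(2) vw(2) by simp
  then show "\<exists>r\<in>Hom C E N. r \<cdot> f = Id C N" using t(1) by blast
qed

lemma ext_orth_extension_right:
  assumes "short_exact C N1 N N2 x y" "ext_orth C M N1" "ext_orth C M N2"
  shows "ext_orth C M N"
proof -
  have "ext_orth (op_cat C) N M"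
    using abelian_category.ext_orth_extension_left[OF abelian_category_op, of N2 N N1 y x M]
      assms ext_orth_op by simp
  then show ?thesis
    using linear_category.ext_orth_op[OF linear_category_op, of N M] by simp
qed

lemma ext_orth_zero:
  assumes "zero_obj C Z" "X \<in> Obj C" shows "ext_orth C Z X" "ext_orth C X Z"
proof -
  show *: "ext_orth C X Z" for X
    unfolding ext_orth_def
  proof (intro allI impI)
    fix E f g assume "short_exact C Z E X f g"
    note S = short_exactD[OF this]
    show "\<exists>r\<in>Hom C E Z. r \<cdot> f = Id C Z"
      using hom_closed(1)[OF S(9,8)] comp_zero_left[OF S(1)] assms(1) zero_obj_iff by metis
  qed
  show "ext_orth C Z X"
    unfolding ext_orth_def
  proof (intro allI impI)
    fix E f g assume fg: "short_exact C X E Z f g"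
    note S = short_exactD[OF this]
    have "g \<cdot> 0 = Id C Z" using comp_zero_right[OF S(2)] assms(1) zero_obj_iff by simp
    then show "\<exists>r\<in>Hom C E X. r \<cdot> f = Id C X"
      using section_imp_retraction[OF fg hom_closed(1)[OF S(10,9)]] by blast
  qed
qed

lemma filtration_obj: "filtration C X Qs \<Longrightarrow> X \<in> Obj C"
  by (induction rule: filtration.induct) (auto simp: zero_obj_def dest: short_exactD(9))

lemma ext_orth_filtration_right:
  assumes "filtration C N Qs" "\<And>Q. Q \<in> set Qs \<Longrightarrow> ext_orth C M Q" "M \<in> Obj C"
  shows "ext_orth C M N"
  using assms(1,2)
  by (induction rule: filtration.induct) (auto intro: ext_orth_zero[OF _ assms(3)] ext_orth_extension_right)

lemma ext_orth_filtration:
  assumes "filtration C M Ps" "filtration C N Qs"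
    "\<And>P Q. P \<in> set Ps \<Longrightarrow> Q \<in> set Qs \<Longrightarrow> P \<in> Obj C \<and> ext_orth C P Q"
  shows "ext_orth C M N"
  using assms(1,3)
proof (induction rule: filtration.induct)
  case (filtration_zero X)
  then show ?case using ext_orth_zero filtration_obj[OF assms(2)] by blast
next
  case (filtration_step X Ps Y P f g)
  have "P \<in> Obj C" using short_exactD(10)[OF filtration_step(2)] .
  moreover have "ext_orth C P N"
    using ext_orth_filtration_right[OF assms(2), of P] filtration_step.prems \<open>P \<in> Obj C\<close> by simp
  ultimately show ?case
    using ext_orth_extension_left[OF filtration_step(2)] filtration_step by simp
qed

text \<open>
  The next lemmas match the Yoneda description of \<open>Ext\<^sup>1\<close>, by sequences indexed by natural numbers, with
  short exact sequences. Exactness in the middle is phrased with an epimorphism onto the kernel; at the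
  left end this epimorphism is also mono, hence invertible.
\<close>

lemma extension1_short_exact:
  assumes "is_extension C 1 X Y (E, d)" shows "short_exact C Y (E 1) X (d 0) (d 1)"
proof -
  have *: "E 0 = Y" "E 2 = X" "is_mono C Y (E 1) (d 0)" "is_epi C (E 1) X (d 1)"
    "exact_at C Y (E 1) X (d 0) (d 1)"
    using assms by (auto simp: is_extension_def numeral_2_eq_2)
  then obtain K k e where k: "is_kernel C (E 1) X (d 1) K k" "is_epi C Y K e" "d 0 = k \<cdot> e"
    unfolding exact_at_def by blast
  note K = kernelD[OF k(1)] and e = epi_hom[OF k(2)]
  have "is_mono C Y K e" using mono_right_factor[OF _ e K(2)] *(3) k(3) by simp
  then have e_iso: "is_iso C Y K e" using mono_epi_iso k(2) by blast
  note I = inv_morD[OF e_iso]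
  have "is_kernel C (E 1) X (d 1) Y (d 0)"
  proof (rule kernelI[OF K(1) *(3)])
    show "d 1 \<cdot> d 0 = 0" using comp_assoc[OF e K(2,1)] k(3) K(3) comp_zero_left[OF e] by simp
    fix W u assume u: "u \<in> Hom C W (E 1)" "d 1 \<cdot> u = 0"
    then obtain t where t: "t \<in> Hom C W K" "k \<cdot> t = u" using kernelE[OF k(1)] by blast
    let ?v = "inv_mor C Y K e \<cdot> t"
    have v: "?v \<in> Hom C W Y" using comp_hom[OF t(1) I(2)] .
    have "d 0 \<cdot> ?v = k \<cdot> (e \<cdot> ?v)" using comp_assoc[OF v e K(2)] k(3) by simp
    also have "\<dots> = u" using comp_assoc[OF t(1) I(2,1)] I(4) id_left[OF t(1)] t(2) by simp
    finally show "\<exists>v\<in>Hom C W Y. d 0 \<cdot> v = u" using v by blast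
  qed
  then show ?thesis using epi_short_exact *(4) by blast
qed

lemma short_exact_extension1:
  assumes "short_exact C Y M X f g"
  shows "is_extension C 1 X Y ((!) [Y, M, X], (!) [f, g])"
proof -
  note S = short_exactD[OF assms]
  have "is_epi C Y Y (Id C Y)"
    using iso_epi[OF isoI[OF id_hom[OF S(8)] id_hom[OF S(8)]]] id_left[OF id_hom[OF S(8)]] by simp
  then have "exact_at C Y M X f g"
    unfolding exact_at_def using S(6) id_right[OF S(1)] by metis
  then show ?thesis
    using S by (auto simp: is_extension_def le_Suc_eq)
qed

text \<open>
  A morphism of extensions transports a section forwards and a retraction backwards, so splitting is
  invariant under the equivalence that defines \<open>Ext\<^sup>1\<close>.
\<close>

lemma extension_rel_retraction:
  assumes "((E, d), (E', d')) \<in> extension_rel C 1 X Y"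
  shows "(\<exists>r \<in> Hom C (E 1) Y. r \<cdot> d 0 = Id C Y) \<longleftrightarrow> (\<exists>r \<in> Hom C (E' 1) Y. r \<cdot> d' 0 = Id C Y)"
proof -
  obtain \<phi> where \<phi>: "\<forall>i \<le> Suc 1. \<phi> i \<in> Hom C (E i) (E' i)" "\<phi> 0 = Id C Y" "\<phi> (Suc 1) = Id C X"
      "\<forall>i \<le> 1. \<phi> (Suc i) \<cdot> d i = d' i \<cdot> \<phi> i"
    and ext: "is_extension C 1 X Y (E, d)" "is_extension C 1 X Y (E', d')"
    using assms unfolding extension_rel_def by blast
  note S = extension1_short_exact[OF ext(1)] and S' = extension1_short_exact[OF ext(2)]
  note D = short_exactD[OF S] and D' = short_exactD[OF S']
  have p: "\<phi> 1 \<in> Hom C (E 1) (E' 1)" and 0: "\<phi> 1 \<cdot> d 0 = d' 0" and 1: "d' 1 \<cdot> \<phi> 1 = d 1"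
    using \<phi> id_right[OF D'(1)] id_left[OF D(2)] by (auto simp: le_Suc_eq)
  show ?thesis
  proof
    assume "\<exists>r \<in> Hom C (E 1) Y. r \<cdot> d 0 = Id C Y"
    then obtain s where s: "s \<in> Hom C X (E 1)" "d 1 \<cdot> s = Id C X"
      using retraction_imp_section[OF S] by blast
    have "d' 1 \<cdot> (\<phi> 1 \<cdot> s) = Id C X" using comp_assoc[OF s(1) p D'(2)] 1 s(2) by simp
    then show "\<exists>r \<in> Hom C (E' 1) Y. r \<cdot> d' 0 = Id C Y"
      using section_imp_retraction[OF S' comp_hom[OF s(1) p]] by blast
  next
    assume "\<exists>r \<in> Hom C (E' 1) Y. r \<cdot> d' 0 = Id C Y"
    then obtain r where r: "r \<in> Hom C (E' 1) Y" "r \<cdot> d' 0 = Id C Y" by blast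
    have "r \<cdot> \<phi> 1 \<cdot> d 0 = Id C Y" using comp_assoc[OF D(1) p r(1)] 0 r(2) by simp
    then show "\<exists>r \<in> Hom C (E 1) Y. r \<cdot> d 0 = Id C Y" using comp_hom[OF p r(1)] by blast
  qed
qed

lemma biproduct_short_exact:
  assumes "is_biproduct C A B S i j p q" shows "short_exact C A S B i q"
proof -
  have i: "i \<in> Hom C A S" and j: "j \<in> Hom C B S" and p: "p \<in> Hom C S A" and q: "q \<in> Hom C S B"
    and pi: "p \<cdot> i = Id C A" and qj: "q \<cdot> j = Id C B" and qi: "q \<cdot> i = 0" and pj: "p \<cdot> j = 0"
    and ipjq: "i \<cdot> p + j \<cdot> q = Id C S"
    using assms unfolding is_biproduct_def by blast+
  have "is_epi C S B q"
  proof (rule epiI[OF q])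
    fix W u assume u: "u \<in> Hom C B W" "u \<cdot> q = 0"
    then have "u \<cdot> q \<cdot> j = 0" using comp_zero_left[OF j] by simp
    then show "u = 0" using comp_assoc[OF j q u(1)] qj id_right[OF u(1)] by simp
  qed
  moreover have "is_kernel C S B q A i"
  proof (rule kernelI[OF q _ qi])
    show "is_mono C A S i"
    proof (rule monoI[OF i])
      fix W u assume u: "u \<in> Hom C W A" "i \<cdot> u = 0"
      then have "p \<cdot> (i \<cdot> u) = 0" using comp_zero_right[OF p] by simp
      then show "u = 0" using comp_assoc[OF u(1) i p] pi id_left[OF u(1)] by simp
    qed
    fix W u assume u: "u \<in> Hom C W S" "q \<cdot> u = 0"
    have "u = i \<cdot> p \<cdot> u + j \<cdot> q \<cdot> u"
      using comp_add_left[OF u(1) comp_hom[OF p i] comp_hom[OF q j]] ipjq id_left[OF u(1)] by simp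
    also have "j \<cdot> q \<cdot> u = 0" using comp_assoc[OF u(1) q j] u(2) comp_zero_right[OF j] by simp
    finally have "i \<cdot> (p \<cdot> u) = u" using comp_assoc[OF u(1) p i] by simp
    then show "\<exists>v\<in>Hom C W A. i \<cdot> v = u" using comp_hom[OF u(1) p] by blast
  qed
  ultimately show ?thesis by (rule epi_short_exact)
qed

text \<open>
  If there is only one class, every extension is equivalent to the one given by the
  biproduct, which splits.
\<close>

lemma Ext1_singleton_imp_ext_orth:
  assumes "is_singleton (Ext C 1 X Y)" "X \<in> Obj C" "Y \<in> Obj C"
  shows "ext_orth C X Y"
  unfolding ext_orth_def
proof (intro allI impI)
  fix M f g assume fg: "short_exact C Y M X f g"
  obtain S i j p q where bi: "is_biproduct C Y X S i j p q" using biproduct_exists assms by blast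
  let ?R = "extension_rel C 1 X Y \<union> (extension_rel C 1 X Y)\<inverse>"
  let ?split = "\<lambda>(E, d). \<exists>r \<in> Hom C (E (1::nat)) Y. r \<cdot> d (0::nat) = Id C Y"
  let ?ext = "((!) [Y, M, X], (!) [f, g])" and ?triv = "((!) [Y, S, X], (!) [i, q])"
  have "is_extension C 1 X Y ?ext" "is_extension C 1 X Y ?triv"
    using short_exact_extension1 fg biproduct_short_exact[OF bi] by blast+
  then have "?R\<^sup>* `` {?ext} \<in> Ext C 1 X Y" "?R\<^sup>* `` {?triv} \<in> Ext C 1 X Y"
    unfolding Ext_def by (auto intro!: quotientI)
  then have "?R\<^sup>* `` {?ext} = ?R\<^sup>* `` {?triv}"
    using assms(1) by (auto simp: is_singleton_def)
  then have "(?triv, ?ext) \<in> ?R\<^sup>*" by blast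
  moreover have "?split ?triv" using bi unfolding is_biproduct_def by simp blast
  moreover have "?split y" if "(x, y) \<in> ?R\<^sup>*" "?split x" for x y
    using that
  proof (induction rule: rtrancl_induct)
    case (step y z)
    then show ?case using extension_rel_retraction[of "fst y" "snd y" "fst z" "snd z" X Y]
      extension_rel_retraction[of "fst z" "snd z" "fst y" "snd y" X Y]
      by (auto simp: case_prod_beta)
  qed
  ultimately have "?split ?ext" by blast
  then show "\<exists>r\<in>Hom C M Y. r \<cdot> f = Id C Y" by simp
qed

end

section \<open>Composition factors\<close>

context abelian_category
begin

lemma epi_to_zero_map: "is_epi C X Y 0 \<Longrightarrow> zero_obj C Y"
  using epi_zeroD[of X Y 0 "Id C Y" Y] id_hom hom_objD epi_hom comp_zero_right zero_obj_iff by metis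

lemma simple_obj_nonzero: "simple_obj C S \<Longrightarrow> \<not> zero_obj C S" "simple_obj C S \<Longrightarrow> S \<in> Obj C"
  by (auto simp: simple_obj_def)

lemma simple_epi:
  assumes "simple_obj C S" "f \<in> Hom C X S" "f \<noteq> 0" shows "is_epi C X S f"
proof -
  obtain I q m where qm: "is_epi C X I q" "is_mono C I S m" "m \<cdot> q = f"
    by (rule epi_mono_factorization[OF assms(2)])
  have "\<not> zero_obj C I"
    using zero_obj_hom(2)[OF _ epi_hom[OF qm(1)]] comp_zero_right[OF mono_hom[OF qm(2)]] qm(3) assms(3)
    by auto
  then have "is_iso C I S m" using assms(1) qm(2) unfolding simple_obj_def by blast
  then show ?thesis using epi_comp[OF qm(1) iso_epi] qm(3) by blast
qed

lemma simple_mono: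
  assumes "simple_obj C S" "f \<in> Hom C S X" "f \<noteq> 0" shows "is_mono C S X f"
proof -
  obtain K k where k: "is_kernel C S X f K k" using kernel_exists[OF assms(2)] by blast
  note K = kernelD[OF k]
  have "\<not> is_iso C K S k"
    using epi_zeroD[OF iso_epi K(1,3)] assms(3) by blast
  then have Z: "zero_obj C K" using assms(1) K(4) unfolding simple_obj_def by blast
  show ?thesis
  proof (rule monoI[OF assms(2)])
    fix W u assume "u \<in> Hom C W S" "f \<cdot> u = 0"
    then obtain v where "v \<in> Hom C W K" "k \<cdot> v = u" using kernelE[OF k] by blast
    then show "u = 0" using zero_obj_hom(2)[OF Z] comp_zero_right[OF K(2)] by blast
  qed
qed

lemma simple_iso:
  "simple_obj C S \<Longrightarrow> simple_obj C R \<Longrightarrow> f \<in> Hom C S R \<Longrightarrow> f \<noteq> 0 \<Longrightarrow> is_iso C S R f"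
  using mono_epi_iso simple_mono simple_epi by blast

lemma simple_isomorphic:
  assumes "simple_obj C S" "isomorphic C S R" shows "simple_obj C R"
proof -
  obtain h where h: "is_iso C R S h" using assms(2) isomorphic_sym unfolding isomorphic_def by blast
  note H = inv_morD[OF h]
  have "\<not> zero_obj C R" using epi_from_zero[OF iso_epi[OF h]] assms(1) unfolding simple_obj_def by blast
  moreover have "zero_obj C M \<or> is_iso C M R m" if m: "is_mono C M R m" for M m
  proof -
    note M = mono_hom[OF m]
    have "zero_obj C M \<or> is_iso C M S (h \<cdot> m)"
      using assms(1) mono_comp[OF m iso_mono[OF h]] unfolding simple_obj_def by blast
    moreover have "inv_mor C R S h \<cdot> (h \<cdot> m) = m"
      using comp_assoc[OF M H(1,2)] H(3) id_left[OF M] by simp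
    ultimately show ?thesis using is_iso_comp[OF _ is_iso_inv[OF h]] by metis
  qed
  ultimately show ?thesis using hom_objD(1)[OF H(1)] unfolding simple_obj_def by blast
qed

lemma filtration_isomorphic_quotients:
  assumes "filtration C X Qs" "list_all2 (isomorphic C) Qs Rs" shows "filtration C X Rs"
  using assms
proof (induction arbitrary: Rs rule: filtration.induct)
  case (filtration_step X Qs Y Q f g)
  then obtain R Rs' where Rs: "Rs = R # Rs'" "isomorphic C Q R" "list_all2 (isomorphic C) Qs Rs'"
    by (auto simp: list_all2_Cons1)
  then obtain h where "is_iso C Q R h" unfolding isomorphic_def by blast
  then show ?case
    unfolding Rs(1)
    using filtration.filtration_step[OF filtration_step.IH[OF Rs(3)] short_exact_iso_quotient[OF filtration_step(2)]]
    by blast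
qed (auto intro: filtration.intros)

lemma zero_cokernel_iso:
  "short_exact C A X Z a b \<Longrightarrow> zero_obj C Z \<Longrightarrow> is_iso C A X a"
  using abelian_category.epi_with_zero_kernel_iso[OF abelian_category_op, of Z X A b a]
    linear_category.iso_op[OF linear_category_axioms] by simp

lemma short_exact_iso_middle:
  assumes "short_exact C A X B a b" "is_iso C X Y h" obtains c where "short_exact C A Y B (h \<cdot> a) c"
proof -
  note S = short_exactD[OF assms(1)] and H = inv_morD[OF assms(2)]
  let ?c = "b \<cdot> inv_mor C X Y h"
  have epi: "is_epi C Y B ?c" using epi_comp[OF iso_epi[OF is_iso_inv[OF assms(2)]] S(5)] .
  have c: "?c \<in> Hom C Y B" by (rule epi_hom[OF epi])
  have "is_kernel C Y B ?c A (h \<cdot> a)"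
  proof (rule kernelI[OF c mono_comp[OF S(4) iso_mono[OF assms(2)]]])
    have "inv_mor C X Y h \<cdot> (h \<cdot> a) = a" using comp_assoc[OF S(1) H(1,2)] H(3) id_left[OF S(1)] by simp
    then show "?c \<cdot> (h \<cdot> a) = 0" using comp_assoc[OF comp_hom[OF S(1) H(1)] H(2) S(2)] S(3) by simp
    fix W u assume u: "u \<in> Hom C W Y" "?c \<cdot> u = 0"
    note hu = comp_hom[OF u(1) H(2)]
    have "b \<cdot> (inv_mor C X Y h \<cdot> u) = 0" using comp_assoc[OF u(1) H(2) S(2)] u(2) by simp
    then obtain t where t: "t \<in> Hom C W A" "a \<cdot> t = inv_mor C X Y h \<cdot> u" using kernelE[OF S(6) hu] by blast
    have "h \<cdot> a \<cdot> t = u"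
      using comp_assoc[OF t(1) S(1) H(1)] t(2) comp_assoc[OF u(1) H(2,1)] H(4) id_left[OF u(1)] by simp
    then show "\<exists>v\<in>Hom C W A. h \<cdot> a \<cdot> v = u" using t(1) by blast
  qed
  then show ?thesis using that epi_short_exact[OF epi] by blast
qed

lemma filtration_iso:
  assumes "filtration C X Qs" "is_iso C X Y h" shows "filtration C Y Qs"
  using assms(1)
proof cases
  case filtration_zero
  then show ?thesis using epi_from_zero[OF iso_epi[OF assms(2)]] filtration.filtration_zero by simp
next
  case (filtration_step X' Qs' Q f g)
  obtain c where "short_exact C X' Y Q (h \<cdot> f) c"
    by (rule short_exact_iso_middle[OF filtration_step(3) assms(2)])
  then show ?thesis unfolding filtration_step(1) by (rule filtration.filtration_step[OF filtration_step(2)])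
qed

text \<open>
  Induction on the filtration of \<open>B\<close>: the last step of it pulls back to a step from the preimage \<open>K\<close> of
  \<open>B'\<close> to \<open>X\<close>, and \<open>K\<close> is an extension of \<open>B'\<close> by \<open>A\<close>.
\<close>

lemma filtration_append:
  assumes "filtration C B Rs" "short_exact C A X B a b" "filtration C A Qs"
  shows "filtration C X (Rs @ Qs)"
  using assms(1,2)
proof (induction arbitrary: X a b rule: filtration.induct)
  case (filtration_zero Z)
  then show ?case using filtration_iso[OF assms(3)] zero_cokernel_iso by (metis append_Nil)
next
  case (filtration_step B' Rs B R f g)
  note F = short_exactD[OF filtration_step(2)] and P = short_exactD[OF filtration_step.prems]
  obtain K k where k: "short_exact C K X R k (g \<cdot> b)"
    using epi_short_exactE[OF epi_comp[OF P(5) F(5)]] by blast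
  obtain v w where "short_exact C A K B' v w"
    by (rule short_exact_subobjects[OF filtration_step.prems k F(2) refl F(6)])
  then have "filtration C K (Rs @ Qs)" by (rule filtration_step.IH)
  then show ?case using k filtration.filtration_step by simp
qed

text \<open>
  Composition factors are distributed over subobject and quotient; counting them with
  multiplicity is what later shows that \<open>L l\<close>, occurring once in \<open>Tl l\<close> and at least once
  in \<open>\<Delta> l\<close>, does not occur in \<open>Tl l / \<Delta> l\<close>. The induction removes the top factor \<open>L l\<close> of \<open>X\<close>,
  with kernel \<open>X'\<close>: it is a quotient of \<open>B\<close> if \<open>A\<close> lies in \<open>X'\<close>, and a quotient of \<open>A\<close> otherwise.
\<close>

lemma composition_factors_additive:
  assumes "filtration C X (map L ls)" "\<And>l. l \<in> set ls \<Longrightarrow> simple_obj C (L l)" "short_exact C A X B a b"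
  obtains la lb where "filtration C A (map L la)" "filtration C B (map L lb)"
    "\<And>l. count_list la l + count_list lb l = count_list ls l"
proof -
  have "\<exists>la lb. filtration C A (map L la) \<and> filtration C B (map L lb) \<and>
      (\<forall>l. count_list la l + count_list lb l = count_list ls l)"
    using assms
  proof (induction ls arbitrary: X A B a b)
    case Nil
    then have "zero_obj C X" by (auto elim: filtration.cases)
    then have "zero_obj C A" "zero_obj C B"
      using mono_into_zero epi_from_zero short_exactD[OF Nil(3)] by blast+
    then show ?case by (intro exI[of _ "[]"]) (auto intro: filtration.intros)
  next
    case (Cons l ls)
    from Cons.prems(1) obtain X' x s where X': "filtration C X' (map L ls)" "short_exact C X' X (L l) x s"
      by (cases rule: filtration.cases) auto
    note P = short_exactD[OF Cons.prems(3)] and S = short_exactD[OF X'(2)]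
    have sa: "s \<cdot> a \<in> Hom C A (L l)" using comp_hom[OF P(1) S(2)] .
    show ?case
    proof (cases "s \<cdot> a = 0")
      case True
      \<comment> \<open>\<open>A \<subseteq> X'\<close>, so that \<open>B\<close> is an extension of \<open>L l\<close> by \<open>X'/A\<close>.\<close>
      then obtain a' where a': "a' \<in> Hom C A X'" "x \<cdot> a' = a" using kernelE[OF S(6) P(1)] by blast
      have a'_mono: "is_mono C A X' a'" using mono_right_factor[OF _ a'(1) S(1)] a'(2) P(4) by simp
      obtain B' b' where b': "short_exact C A X' B' a' b'" using mono_short_exactE[OF a'_mono] by blast
      obtain v w where "short_exact C B' B (L l) v w"
        by (rule short_exact_quotients[OF Cons.prems(3) X'(2) a' short_exactD(7)[OF b']])
      moreover obtain la lb where "filtration C A (map L la)" "filtration C B' (map L lb)"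
          "\<forall>l. count_list la l + count_list lb l = count_list ls l"
        using Cons.IH[OF X'(1) _ b'] Cons.prems(2) by auto
      ultimately show ?thesis
        using filtration.filtration_step by (intro exI[of _ la] exI[of _ "l # lb"]) auto
    next
      case False
      \<comment> \<open>\<open>A\<close> and \<open>X'\<close> generate \<open>X\<close>, so that \<open>B\<close> is the quotient of \<open>X'\<close> by \<open>A' = A \<inter> X'\<close>.\<close>
      then have sa_epi: "is_epi C A (L l) (s \<cdot> a)" using simple_epi sa Cons.prems(2) by simp
      obtain A' k where k: "short_exact C A' A (L l) k (s \<cdot> a)" using epi_short_exactE[OF sa_epi] by blast
      note K = short_exactD[OF k]
      have "s \<cdot> (a \<cdot> k) = 0" using comp_assoc[OF K(1) P(1) S(2)] K(3) by simp
      then obtain x' where x': "x' \<in> Hom C A' X'" "x \<cdot> x' = a \<cdot> k"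
        using kernelE[OF S(6) comp_hom[OF K(1) P(1)]] by blast
      have bx: "b \<cdot> x \<in> Hom C X' B" using comp_hom[OF S(1) P(2)] .
      have "is_kernel C X' B (b \<cdot> x) A' x'"
      proof (rule kernelI[OF bx])
        show "is_mono C A' X' x'"
          using mono_right_factor[OF _ x'(1) S(1)] x'(2) mono_comp[OF K(4) P(4)] by simp
        show "b \<cdot> x \<cdot> x' = 0"
          using comp_assoc[OF x'(1) S(1) P(2)] x'(2) comp_assoc[OF K(1) P(1,2)] P(3)
            comp_zero_left[OF K(1)] by simp
        fix W u assume u: "u \<in> Hom C W X'" "b \<cdot> x \<cdot> u = 0"
        then have "b \<cdot> (x \<cdot> u) = 0" using comp_assoc[OF u(1) S(1) P(2)] by simp
        then obtain u' where u': "u' \<in> Hom C W A" "a \<cdot> u' = x \<cdot> u"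
          using kernelE[OF P(6) comp_hom[OF u(1) S(1)]] by blast
        have "s \<cdot> a \<cdot> u' = 0"
          using comp_assoc[OF u'(1) P(1) S(2)] u'(2) comp_assoc[OF u(1) S(1,2)] S(3)
            comp_zero_left[OF u(1)] by simp
        then obtain t where t: "t \<in> Hom C W A'" "k \<cdot> t = u'" using kernelE[OF K(6) u'(1)] by blast
        have "x \<cdot> (x' \<cdot> t) = x \<cdot> u"
          using comp_assoc[OF t(1) x'(1) S(1)] x'(2) comp_assoc[OF t(1) K(1) P(1)] t(2) u'(2) by simp
        then have "x' \<cdot> t = u" using mono_cancel[OF S(4)] comp_hom[OF t(1) x'(1)] u(1) by blast
        then show "\<exists>v\<in>Hom C W A'. x' \<cdot> v = u" using t(1) by blast
      qed
      moreover have "is_epi C X' B (b \<cdot> x)"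
      proof (rule epiI[OF bx])
        fix W t assume t: "t \<in> Hom C B W" "t \<cdot> (b \<cdot> x) = 0"
        have tb: "t \<cdot> b \<in> Hom C X W" using comp_hom[OF P(2) t(1)] .
        have "t \<cdot> b \<cdot> x = 0" using comp_assoc[OF S(1) P(2) t(1)] t(2) by simp
        then obtain z where z: "z \<in> Hom C (L l) W" "z \<cdot> s = t \<cdot> b" using cokernelE[OF S(7) tb] by blast
        have "z \<cdot> (s \<cdot> a) = 0"
          using comp_assoc[OF P(1) S(2) z(1)] z(2) comp_assoc[OF P(1,2) t(1)] P(3) comp_zero_right[OF t(1)]
          by simp
        then have "z = 0" using epi_zeroD[OF sa_epi z(1)] by blast
        then have "t \<cdot> b = 0" using z(2) comp_zero_left[OF S(2)] by simp
        then show "t = 0" using epi_zeroD[OF P(5) t(1)] by blast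
      qed
      ultimately have *: "short_exact C A' X' B x' (b \<cdot> x)" using epi_short_exact by blast
      obtain la lb where "filtration C A' (map L la)" "filtration C B (map L lb)"
          "\<forall>l. count_list la l + count_list lb l = count_list ls l"
        using Cons.IH[OF X'(1) _ *] Cons.prems(2) by auto
      then show ?thesis
        using k filtration.filtration_step by (intro exI[of _ "l # la"] exI[of _ lb]) auto
    qed
  qed
  then show ?thesis using that by blast
qed

end

text \<open>
  The composition factors of \<open>X\<close> have labels in \<open>P\<close>. Subobjects, quotients and extensions inherit this
  property, so the maps that factor through such objects form a two-sided ideal.
\<close>

definition supported_on :: "('o, 'm::ab_group_add, 'k) lin_cat \<Rightarrow> ('l \<Rightarrow> 'o) \<Rightarrow> 'l set \<Rightarrow> 'o \<Rightarrow> bool" where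
  "supported_on C L P X \<longleftrightarrow> (\<exists>ls. set ls \<subseteq> P \<and> filtration C X (map L ls))"

definition factors_through ::
  "('o, 'm::ab_group_add, 'k) lin_cat \<Rightarrow> ('l \<Rightarrow> 'o) \<Rightarrow> 'l set \<Rightarrow> 'o \<Rightarrow> 'o \<Rightarrow> 'm \<Rightarrow> bool" where
  "factors_through C L P X Y \<phi> \<longleftrightarrow>
     (\<exists>Z a b. supported_on C L P Z \<and> a \<in> Hom C X Z \<and> b \<in> Hom C Z Y \<and> \<phi> = b \<cdot>\<^bsub>C\<^esub> a)"

context abelian_category
begin

lemma supported_on_short_exact:
  assumes "supported_on C L P X" "\<And>l. l \<in> P \<Longrightarrow> simple_obj C (L l)" "short_exact C A X B a b"
  shows "supported_on C L P A" "supported_on C L P B"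
proof -
  obtain ls where ls: "set ls \<subseteq> P" "filtration C X (map L ls)" using assms(1) unfolding supported_on_def by blast
  obtain la lb where *: "filtration C A (map L la)" "filtration C B (map L lb)"
      "\<And>l. count_list la l + count_list lb l = count_list ls l"
    by (rule composition_factors_additive[OF ls(2) _ assms(3)]) (use ls assms(2) in blast)+
  then have "l \<in> set ls" if "l \<in> set la \<or> l \<in> set lb" for l
    using that by (metis add_is_0 count_list_0_iff)
  then show "supported_on C L P A" "supported_on C L P B"
    using * ls(1) unfolding supported_on_def by blast+
qed

lemma supported_on_simple:
  assumes "supported_on C L P S" "simple_obj C S" "\<And>l. l \<in> P \<Longrightarrow> simple_obj C (L l)"
  obtains l where "l \<in> P" "isomorphic C S (L l)"
proof -
  obtain ls where ls: "set ls \<subseteq> P" "filtration C S (map L ls)" using assms(1) unfolding supported_on_def by blast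
  have "ls \<noteq> []"
  proof
    assume "ls = []"
    then have "zero_obj C S" using ls(2) by (auto elim: filtration.cases)
    then show False using assms(2) simple_obj_nonzero by blast
  qed
  then obtain l ls' where l: "ls = l # ls'" by (cases ls) auto
  with ls(2) obtain X' x s where "short_exact C X' S (L l) x s"
    by (auto elim: filtration.cases)
  note S = short_exactD[OF this]
  have simple: "simple_obj C (L l)" using assms(3) ls(1) l by simp
  then have "s \<noteq> 0" using epi_to_zero_map S(5) simple_obj_nonzero by blast
  then show ?thesis
    using that[of l] simple_iso[OF assms(2) simple S(2)] ls(1) l unfolding isomorphic_def by auto
qed

lemma supported_on_simple_subobject:
  assumes "supported_on C L P X" "\<not> zero_obj C X" "\<And>l. l \<in> P \<Longrightarrow> simple_obj C (L l)"
  obtains l m where "l \<in> P" "is_mono C (L l) X m"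
proof -
  obtain ls where ls: "set ls \<subseteq> P" "filtration C X (map L ls)"
    using assms(1) unfolding supported_on_def by blast
  have "\<exists>l\<in>P. \<exists>m. is_mono C (L l) X m" using ls assms(2)
  proof (induction ls arbitrary: X)
    case Nil
    then show ?case by (auto elim: filtration.cases)
  next
    case (Cons l ls)
    from Cons.prems(2) obtain X' x s where X': "filtration C X' (map L ls)" "short_exact C X' X (L l) x s"
      by (cases rule: filtration.cases) auto
    show ?case
    proof (cases "zero_obj C X'")
      case True
      then have "is_iso C X (L l) s" using epi_with_zero_kernel_iso[OF X'(2)] by blast
      then show ?thesis using iso_mono[OF is_iso_inv] Cons.prems(1) by (meson list.set_intros(1) subsetD)
    next
      case False
      then show ?thesis using Cons.IH[OF _ X'(1)] Cons.prems(1) mono_comp short_exactD(4)[OF X'(2)] by fastforce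
    qed
  qed
  then show ?thesis using that by blast
qed

lemma supported_on_biproduct:
  assumes "is_biproduct C A B S i j p q" "supported_on C L P A" "supported_on C L P B"
  shows "supported_on C L P S"
proof -
  obtain la lb where "set la \<subseteq> P" "filtration C A (map L la)" "set lb \<subseteq> P" "filtration C B (map L lb)"
    using assms(2,3) unfolding supported_on_def by blast
  then show ?thesis
    using filtration_append[OF _ biproduct_short_exact[OF assms(1)], of "map L lb" "map L la"]
    unfolding supported_on_def by (intro exI[of _ "lb @ la"]) auto
qed

lemma factors_through_hom: "factors_through C L P X Y \<phi> \<Longrightarrow> \<phi> \<in> Hom C X Y"
  unfolding factors_through_def using comp_hom by blast

text \<open>
  The difference passes through the biproduct of the two intermediate objects.
\<close>

lemma factors_through_diff:
  assumes "factors_through C L P X Y \<phi>" "factors_through C L P X Y \<psi>"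
  shows "factors_through C L P X Y (\<phi> - \<psi>)"
proof -
  obtain Z a b where 1: "supported_on C L P Z" "a \<in> Hom C X Z" "b \<in> Hom C Z Y" "\<phi> = b \<cdot> a"
    using assms(1) unfolding factors_through_def by blast
  obtain Z' a' b' where 2: "supported_on C L P Z'" "a' \<in> Hom C X Z'" "b' \<in> Hom C Z' Y" "\<psi> = b' \<cdot> a'"
    using assms(2) unfolding factors_through_def by blast
  obtain S i j p q where bi: "is_biproduct C Z Z' S i j p q"
    using biproduct_exists hom_objD(2)[OF 1(2)] hom_objD(2)[OF 2(2)] by blast
  then have i: "i \<in> Hom C Z S" and j: "j \<in> Hom C Z' S" and p: "p \<in> Hom C S Z" and q: "q \<in> Hom C S Z'"
    and pi: "p \<cdot> i = Id C Z" and qj: "q \<cdot> j = Id C Z'" and qi: "q \<cdot> i = 0" and pj: "p \<cdot> j = 0"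
    unfolding is_biproduct_def by blast+
  let ?a = "i \<cdot> a - j \<cdot> a'" and ?b = "b \<cdot> p + b' \<cdot> q"
  have ia: "i \<cdot> a \<in> Hom C X S" and ja: "j \<cdot> a' \<in> Hom C X S" using 1 2 i j comp_hom by blast+
  have bp: "b \<cdot> p \<in> Hom C S Y" and bq: "b' \<cdot> q \<in> Hom C S Y" using 1 2 p q comp_hom by blast+
  have a: "?a \<in> Hom C X S" and b: "?b \<in> Hom C S Y" using hom_closed(2,3) ia ja bp bq by blast+
  have "p \<cdot> ?a = a"
    using comp_diff_right[OF ia ja p] comp_assoc[OF 1(2) i p] comp_assoc[OF 2(2) j p] pi pj
      comp_zero_left[OF 2(2)] id_left[OF 1(2)] by simp
  moreover have "q \<cdot> ?a = - a'"
    using comp_diff_right[OF ia ja q] comp_assoc[OF 1(2) i q] comp_assoc[OF 2(2) j q] qi qj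
      comp_zero_left[OF 1(2)] id_left[OF 2(2)] by simp
  ultimately have "?b \<cdot> ?a = b \<cdot> a + b' \<cdot> (0 - a')"
    using comp_add_left[OF a bp bq] comp_assoc[OF a p 1(3)] comp_assoc[OF a q 2(3)] by simp
  also have "\<dots> = b \<cdot> a - b' \<cdot> a'"
    using comp_diff_right[OF hom_closed(1) 2(2,3)] hom_objD[OF 2(2)] comp_zero_right[OF 2(3)] by simp
  finally have "\<phi> - \<psi> = ?b \<cdot> ?a" using 1(4) 2(4) by simp
  then show ?thesis
    using a b supported_on_biproduct[OF bi 1(1) 2(1)] unfolding factors_through_def by blast
qed

text \<open>
  If \<open>\<phi>\<close> factors through \<open>Z\<close>, replacing \<open>Z\<close> by the image of \<open>X\<close> in it makes the first factor epi. Then \<open>p\<close>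
  already kills the second factor, which therefore lands in the kernel.
\<close>

lemma factors_through_kernel:
  assumes "factors_through C L P X Y \<phi>" "\<And>l. l \<in> P \<Longrightarrow> simple_obj C (L l)"
    "is_kernel C Y Q p K k" "p \<cdot> \<phi> = 0"
  obtains \<psi> where "factors_through C L P X K \<psi>" "k \<cdot> \<psi> = \<phi>"
proof -
  obtain Z a b where 1: "supported_on C L P Z" "a \<in> Hom C X Z" "b \<in> Hom C Z Y" "\<phi> = b \<cdot> a"
    using assms(1) unfolding factors_through_def by blast
  obtain I e m where em: "is_epi C X I e" "is_mono C I Z m" "m \<cdot> e = a"
    by (rule epi_mono_factorization[OF 1(2)])
  note e = epi_hom[OF em(1)] and m = mono_hom[OF em(2)] and K = kernelD[OF assms(3)]
  obtain R r where "short_exact C I Z R m r" using mono_short_exactE[OF em(2)] by blast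
  then have I: "supported_on C L P I" using supported_on_short_exact(1)[OF 1(1) assms(2)] by blast
  have bm: "b \<cdot> m \<in> Hom C I Y" using comp_hom[OF m 1(3)] .
  have \<phi>: "\<phi> = b \<cdot> m \<cdot> e" using 1(4) em(3) comp_assoc[OF e m 1(3)] by simp
  then have "p \<cdot> (b \<cdot> m) \<cdot> e = 0" using assms(4) comp_assoc[OF e bm K(1)] by simp
  then have "p \<cdot> (b \<cdot> m) = 0" using epi_zeroD[OF em(1) comp_hom[OF bm K(1)]] by blast
  then obtain v where v: "v \<in> Hom C I K" "k \<cdot> v = b \<cdot> m" using kernelE[OF assms(3) bm] by blast
  have "k \<cdot> (v \<cdot> e) = \<phi>" using comp_assoc[OF e v(1) K(2)] v(2) \<phi> by simp
  moreover have "factors_through C L P X K (v \<cdot> e)" using I e v(1) unfolding factors_through_def by blast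
  ultimately show ?thesis using that by blast
qed

end

section \<open>Composition factors in a standard category\<close>

context standard_category
begin

lemma L_isomorphic_imp_eq: "l \<in> \<Lambda> \<Longrightarrow> m \<in> \<Lambda> \<Longrightarrow> isomorphic C (L l) (L m) \<Longrightarrow> l = m"
  using L_complete[OF simple_L] is_iso_comp isomorphic_sym isomorphic_trans by metis

lemma supported_on_weights: "X \<in> Obj C \<Longrightarrow> supported_on C L \<Lambda> X"
proof -
  assume "X \<in> Obj C"
  then obtain Ss where Ss: "filtration C X Ss" "\<forall>S \<in> set Ss. simple_obj C S"
    using finite_length unfolding composition_series_def by blast
  then obtain h where "\<forall>S \<in> set Ss. h S \<in> \<Lambda> \<and> isomorphic C S (L (h S))" using L_complete by metis
  then have "set (map h Ss) \<subseteq> \<Lambda>" "list_all2 (isomorphic C) Ss (map L (map h Ss))"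
    by (auto simp: list_all2_conv_all_nth)
  then show ?thesis unfolding supported_on_def using filtration_isomorphic_quotients Ss(1) by blast
qed

lemma tilting_obj: "tilting C \<Lambda> Nabla \<Delta> X \<Longrightarrow> X \<in> Obj C"
  unfolding tilting_def filtered_by_def using filtration_obj by blast

lemma T_composition_factors:
  assumes "l \<in> \<Lambda>"
  obtains ls where "filtration C (T l) (map L ls)" "set ls \<subseteq> {m \<in> \<Lambda>. m \<le> l}" "count_list ls l = 1"
proof -
  define Ss where "Ss = (SOME Ss. composition_series C (T l) Ss)"
  have "composition_series C (T l) Ss"
    unfolding Ss_def using someI_ex finite_length tilting_obj[OF T_tilting[OF assms]] by metis
  then have Ss: "filtration C (T l) Ss" "\<forall>S \<in> set Ss. simple_obj C S"
    unfolding composition_series_def by blast+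
  then obtain h where h: "\<forall>S \<in> set Ss. h S \<in> \<Lambda> \<and> isomorphic C S (L (h S))" using L_complete by metis
  have iso: "isomorphic C (L m) S \<longleftrightarrow> h S = m" if "S \<in> set Ss" "m \<in> \<Lambda>" for S m
    using h that L_isomorphic_imp_eq isomorphic_sym isomorphic_trans by metis
  have mult: "comp_mult C (T l) (L m) = count_list (map h Ss) m" if "m \<in> \<Lambda>" for m
  proof -
    have "filter (isomorphic C (L m)) Ss = filter (\<lambda>S. h S = m) Ss"
      using iso that by (intro filter_cong) auto
    then show ?thesis
      unfolding comp_mult_def Ss_def[symmetric] by (simp add: count_list_eq_length_filter filter_map o_def eq_commute)
  qed
  have "set (map h Ss) \<subseteq> {m \<in> \<Lambda>. m \<le> l}"
  proof
    fix m assume m: "m \<in> set (map h Ss)"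
    then have "m \<in> \<Lambda>" using h by auto
    then show "m \<in> {m \<in> \<Lambda>. m \<le> l}"
      using T_weights[OF assms, of m] mult m by (auto simp: count_list_0_iff)
  qed
  moreover have "count_list (map h Ss) l = 1" using T_highest[OF assms] mult[OF assms] by simp
  moreover have "filtration C (T l) (map L (map h Ss))"
    using filtration_isomorphic_quotients[OF Ss(1)] h by (auto simp: list_all2_conv_all_nth)
  ultimately show ?thesis using that by blast
qed

text \<open>
  The simple head of \<open>\<Delta> l\<close> uses up the only composition factor \<open>L l\<close> of \<open>T l\<close>.
\<close>

lemma T_quotient_supported:
  assumes "l \<in> \<Lambda>" "short_exact C (\<Delta> l) (T l) Q i q"
  shows "supported_on C L {m \<in> \<Lambda>. m < l} Q"
proof -
  obtain ls where ls: "filtration C (T l) (map L ls)" "set ls \<subseteq> {m \<in> \<Lambda>. m \<le> l}" "count_list ls l = 1"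
    by (rule T_composition_factors[OF assms(1)])
  obtain la lb where lab: "filtration C (\<Delta> l) (map L la)" "filtration C Q (map L lb)"
      "\<And>l. count_list la l + count_list lb l = count_list ls l"
    by (rule composition_factors_additive[OF ls(1) _ assms(2)]) (use ls simple_L in blast)+
  have subset: "m \<in> set ls" if "m \<in> set la \<or> m \<in> set lb" for m
    using that lab(3) by (metis add_is_0 count_list_0_iff)
  obtain R r H h where rh: "is_radical C (\<Delta> l) R r" "is_cokernel C R (\<Delta> l) r H h" "isomorphic C H (L l)"
    using standard[OF assms(1)] unfolding is_standard_def by blast
  have "is_mono C R (\<Delta> l) r" using rh(1) unfolding is_radical_def by blast
  then have "short_exact C R (\<Delta> l) H r h" using mono_short_exact rh(2) by blast
  moreover have "supported_on C L (set la) (\<Delta> l)" unfolding supported_on_def using lab(1) by blast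
  ultimately have "supported_on C L (set la) H"
    using supported_on_short_exact(2) subset ls(2) simple_L by blast
  moreover have "simple_obj C H" using simple_isomorphic[OF simple_L[OF assms(1)]] rh(3) isomorphic_sym by blast
  ultimately obtain m where m: "m \<in> set la" "isomorphic C H (L m)"
    using supported_on_simple subset ls(2) simple_L by blast
  then have "m = l"
    using L_isomorphic_imp_eq assms(1) subset ls(2) rh(3) isomorphic_sym isomorphic_trans by blast
  then have "count_list la l \<noteq> 0" using m(1) by (simp add: count_list_0_iff)
  then have "count_list lb l = 0" using lab(3)[of l] ls(3) by simp
  then have "set lb \<subseteq> {m \<in> \<Lambda>. m < l}"
    using subset ls(2) by (fastforce simp: count_list_0_iff order.strict_iff_order)
  then show ?thesis unfolding supported_on_def using lab(2) by blast
qed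

text \<open>
  The image of \<open>f\<close> contains a simple subobject, labelled by \<open>P\<close> since the image is a quotient of \<open>X\<close>.
  A simple subobject of \<open>Nabla l\<close> lies in the socle \<open>L l\<close>, hence is isomorphic to \<open>L l\<close>.
\<close>

lemma nonzero_to_Nabla:
  assumes "supported_on C L P X" "P \<subseteq> \<Lambda>" "f \<in> Hom C X (Nabla l)" "f \<noteq> 0" "l \<in> \<Lambda>"
  shows "l \<in> P"
proof -
  have simple: "simple_obj C (L m)" if "m \<in> P" for m using simple_L assms(2) that by blast
  obtain I e m where em: "is_epi C X I e" "is_mono C I (Nabla l) m" "m \<cdot> e = f"
    by (rule epi_mono_factorization[OF assms(3)])
  obtain K k where "short_exact C K X I k e" using epi_short_exactE[OF em(1)] by blast
  then have "supported_on C L P I" using supported_on_short_exact(2)[OF assms(1) simple] by blast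
  moreover have "\<not> zero_obj C I"
    using zero_obj_hom(2)[OF _ epi_hom[OF em(1)]] comp_zero_right[OF mono_hom[OF em(2)]] em(3) assms(4) by auto
  ultimately obtain n u where u: "n \<in> P" "is_mono C (L n) I u"
    using supported_on_simple_subobject[of L P I] simple by blast
  have mu: "is_mono C (L n) (Nabla l) (m \<cdot> u)" using mono_comp[OF u(2) em(2)] .
  have "minimal_sub C (Nabla l) (L n) (m \<cdot> u)"
    unfolding minimal_sub_def
  proof (intro conjI allI impI mu)
    show "\<not> zero_obj C (L n)" using simple[OF u(1)] simple_obj_nonzero by blast
    fix N v assume v: "is_mono C N (Nabla l) v \<and> sub_le C N v (L n) (m \<cdot> u)"
    then obtain t where t: "t \<in> Hom C N (L n)" "m \<cdot> u \<cdot> t = v" unfolding sub_le_def by blast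
    then have "is_mono C N (L n) t" using mono_right_factor[OF _ t(1) mono_hom[OF mu]] v by simp
    then consider "zero_obj C N" | "is_iso C N (L n) t" using simple[OF u(1)] unfolding simple_obj_def by blast
    then show "sub_le C (L n) (m \<cdot> u) N v \<or> zero_obj C N"
    proof cases
      case 2
      note I = inv_morD[OF 2]
      have "v \<cdot> inv_mor C N (L n) t = m \<cdot> u"
        using t(2) comp_assoc[OF I(2) t(1) mono_hom[OF mu]] I(4) id_right[OF mono_hom[OF mu]] by simp
      then show ?thesis unfolding sub_le_def using I(2) by blast
    qed simp
  qed
  moreover obtain S s where S: "is_socle C (Nabla l) S s" "isomorphic C S (L l)"
    using costandard[OF assms(5)] unfolding is_costandard_def by blast
  ultimately obtain t where t: "t \<in> Hom C (L n) S" "s \<cdot> t = m \<cdot> u"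
    unfolding is_socle_def sub_le_def by blast
  have "s \<in> Hom C S (Nabla l)" using S(1) mono_hom unfolding is_socle_def by blast
  then have "is_mono C (L n) S t" using mono_right_factor[of "L n" "Nabla l" s t S] t mu by simp
  moreover have "simple_obj C S" using simple_isomorphic[OF simple_L[OF assms(5)]] S(2) isomorphic_sym by blast
  ultimately have "is_iso C (L n) S t"
    using simple[OF u(1)] simple_obj_nonzero unfolding simple_obj_def by blast
  then have "isomorphic C (L n) (L l)" using S(2) isomorphic_trans unfolding isomorphic_def by blast
  then show ?thesis using L_isomorphic_imp_eq assms(2,5) u(1) by blast
qed

lemma filtered_by_family:
  assumes "filtered_by C (F ` \<Lambda>) X"
  obtains ls where "set ls \<subseteq> \<Lambda>" "filtration C X (map F ls)"
proof -
  obtain Qs where Qs: "filtration C X Qs" "\<forall>Q \<in> set Qs. \<exists>l \<in> \<Lambda>. isomorphic C Q (F l)"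
    using assms unfolding filtered_by_def by blast
  then obtain h where h: "\<forall>Q \<in> set Qs. h Q \<in> \<Lambda> \<and> isomorphic C Q (F (h Q))" by metis
  then have "filtration C X (map F (map h Qs))"
    using filtration_isomorphic_quotients[OF Qs(1)] by (auto simp: list_all2_conv_all_nth)
  then show ?thesis using that[of "map h Qs"] h by auto
qed

lemma Nabla_obj: "l \<in> \<Lambda> \<Longrightarrow> Nabla l \<in> Obj C"
  using costandard hom_objD mono_hom unfolding is_costandard_def is_socle_def by metis

lemma \<Delta>_obj: "l \<in> \<Lambda> \<Longrightarrow> \<Delta> l \<in> Obj C"
  using standard hom_objD mono_hom unfolding is_standard_def is_radical_def by metis

lemma T_obj: "l \<in> \<Lambda> \<Longrightarrow> T l \<in> Obj C"
  using tilting_obj T_tilting by blast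

lemma ext_orth_\<Delta>_Nabla: "l \<in> \<Lambda> \<Longrightarrow> m \<in> \<Lambda> \<Longrightarrow> ext_orth C (\<Delta> l) (Nabla m)"
  using Ext1_singleton_imp_ext_orth[OF Ext1 \<Delta>_obj Nabla_obj] by blast

lemma ext_orth_\<Delta>_filtered_Nabla_filtered:
  assumes "filtration C M (map \<Delta> ls)" "filtration C N (map Nabla ms)" "set ls \<subseteq> \<Lambda>" "set ms \<subseteq> \<Lambda>"
  shows "ext_orth C M N"
  using assms by (intro ext_orth_filtration[OF assms(1,2)]) (auto simp: \<Delta>_obj intro!: ext_orth_\<Delta>_Nabla)

text \<open>
  A tilting object enters the proof in the two roles of \<open>M\<close> and \<open>N\<close>: its standard filtration makes it
  projective relative to objects with a costandard filtration.
\<close>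

lemma tilting_ext_orth:
  assumes "tilting C \<Lambda> Nabla \<Delta> M" "filtration C N (map Nabla ms)" "set ms \<subseteq> \<Lambda>"
  shows "ext_orth C M N"
  using filtered_by_family[of \<Delta> M] ext_orth_\<Delta>_filtered_Nabla_filtered assms unfolding tilting_def by metis

lemma \<Delta>_ext_orth:
  "l \<in> \<Lambda> \<Longrightarrow> filtration C N (map Nabla ms) \<Longrightarrow> set ms \<subseteq> \<Lambda> \<Longrightarrow> ext_orth C (\<Delta> l) N"
  by (erule ext_orth_filtration_right) (auto simp: \<Delta>_obj intro!: ext_orth_\<Delta>_Nabla)

end

section \<open>Dimension counting\<close>

context vector_space
begin

text \<open>
  Composition with a fixed map and the duality are linear only between Hom-spaces, not on the whole
  ambient vector space, so linearity has to be relative to subspaces.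
\<close>

definition linear_between :: "'b set \<Rightarrow> 'b set \<Rightarrow> ('b \<Rightarrow> 'b) \<Rightarrow> bool" where
  "linear_between V W u \<longleftrightarrow> subspace V \<and> subspace W \<and> u ` V \<subseteq> W \<and>
     (\<forall>x \<in> V. \<forall>y \<in> V. u (x + y) = u x + u y) \<and> (\<forall>a. \<forall>x \<in> V. u (scale a x) = scale a (u x))"

end

(* Reopening the context makes unqualified names refer to this vector space again: real vector spaces
   interpret the locale and put their own instance of each new constant in front. *)
context vector_space
begin

lemma linear_between_sum:
  fixes v :: "'i \<Rightarrow> 'b"
  assumes "linear_between V W u" "\<And>i. i \<in> I \<Longrightarrow> v i \<in> V"
  shows "u (\<Sum>i\<in>I. scale (a i) (v i)) = (\<Sum>i\<in>I. scale (a i) (u (v i)))"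
proof -
  have V: "subspace V" and add: "\<And>x y. x \<in> V \<Longrightarrow> y \<in> V \<Longrightarrow> u (x + y) = u x + u y"
    and sc: "\<And>a x. x \<in> V \<Longrightarrow> u (scale a x) = scale a (u x)"
    using assms(1) by (auto simp: linear_between_def)
  have "u 0 = 0" using sc[of 0 0] subspace_0[OF V] by simp
  then show ?thesis using assms(2)
  proof (induction I rule: infinite_finite_induct)
    case (insert i I)
    then have "(\<Sum>i\<in>I. scale (a i) (v i)) \<in> V" "scale (a i) (v i) \<in> V"
      using V by (auto intro!: subspace_sum subspace_scale)
    then show ?case using insert add sc by simp
  qed simp_all
qed

lemma finite_basis_exists:
  assumes "finite S" "span S = V"
  obtains B where "finite B" "B \<subseteq> V" "independent B" "span B = V" "card B = dim V"
proof -
  obtain B where B: "B \<subseteq> V" "independent B" "V \<subseteq> span B" "card B = dim V" by (rule basis_exists)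
  have "finite B" using independent_span_bound[OF assms(1) B(2)] B(1) assms(2) by blast
  moreover have "span B = V" using B span_minimal subspace_span[of S] assms(2) by blast
  ultimately show ?thesis using that B by blast
qed

text \<open>
  The image of a basis of \<open>A\<close>, together with preimages of the elements of a basis of \<open>B\<close>, is a basis
  of \<open>V\<close>.
\<close>

lemma dim_short_exact:
  assumes u: "linear_between A V u" and p: "linear_between V B p"
    and inj: "\<And>x. x \<in> A \<Longrightarrow> u x = 0 \<Longrightarrow> x = 0"
    and pu: "\<And>x. x \<in> A \<Longrightarrow> p (u x) = 0"
    and exact: "\<And>v. v \<in> V \<Longrightarrow> p v = 0 \<Longrightarrow> v \<in> u ` A"
    and surj: "B \<subseteq> p ` V"
    and fin: "finite S" "span S = A" "finite R" "span R = B"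
  shows "dim V = dim A + dim B"
proof -
  obtain X where X: "finite X" "X \<subseteq> A" "independent X" "span X = A" "card X = dim A"
    by (rule local.finite_basis_exists[OF fin(1,2)])
  obtain Y where Y: "finite Y" "Y \<subseteq> B" "independent Y" "span Y = B" "card Y = dim B"
    by (rule local.finite_basis_exists[OF fin(3,4)])
  have "\<forall>y \<in> Y. \<exists>v. v \<in> V \<and> p v = y" using surj Y(2) by blast
  from bchoice[OF this] obtain s where s: "\<And>y. y \<in> Y \<Longrightarrow> s y \<in> V \<and> p (s y) = y" by blast
  have V: "subspace V" and uV: "\<And>x. x \<in> A \<Longrightarrow> u x \<in> V" and pB: "\<And>v. v \<in> V \<Longrightarrow> p v \<in> B"
    and p_add: "\<And>x y. x \<in> V \<Longrightarrow> y \<in> V \<Longrightarrow> p (x + y) = p x + p y"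
    using u p by (auto simp: linear_between_def image_subset_iff)
  have A: "subspace A" and u_add: "\<And>x y. x \<in> A \<Longrightarrow> y \<in> A \<Longrightarrow> u (x + y) = u x + u y"
    using u by (auto simp: linear_between_def)
  have zero: "(\<forall>x\<in>X. a x = 0) \<and> (\<forall>y\<in>Y. b y = 0)"
    if *: "(\<Sum>x\<in>X. scale (a x) (u x)) + (\<Sum>y\<in>Y. scale (b y) (s y)) = 0" for a b
  proof
    have "(\<Sum>x\<in>X. scale (a x) (u x)) \<in> V" "(\<Sum>y\<in>Y. scale (b y) (s y)) \<in> V"
      using V X(2) uV s by (auto intro!: subspace_sum subspace_scale)
    then have "p (\<Sum>x\<in>X. scale (a x) (u x)) + p (\<Sum>y\<in>Y. scale (b y) (s y)) = p 0"
      using p_add * by metis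
    moreover have "p (\<Sum>x\<in>X. scale (a x) (u x)) = 0"
      using local.linear_between_sum[OF p, of X u a] X(2) uV pu by (simp add: subset_eq)
    moreover have "p (\<Sum>y\<in>Y. scale (b y) (s y)) = (\<Sum>y\<in>Y. scale (b y) y)"
      using local.linear_between_sum[OF p, of Y s b] s by simp
    moreover have "p 0 = 0" using local.linear_between_sum[OF p, of "{}"] by simp
    ultimately have "(\<Sum>y\<in>Y. scale (b y) y) = 0" by simp
    then show b: "\<forall>y\<in>Y. b y = 0" using independentD[OF Y(3,1) order_refl] by blast
    have "u (\<Sum>x\<in>X. scale (a x) x) = 0"
      using local.linear_between_sum[OF u, of X "\<lambda>x. x" a] X(2) * b by (simp add: subset_eq)
    moreover have "(\<Sum>x\<in>X. scale (a x) x) \<in> A" unfolding X(4)[symmetric] by (intro span_sum span_scale span_base)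
    ultimately have "(\<Sum>x\<in>X. scale (a x) x) = 0" using inj by blast
    then show "\<forall>x\<in>X. a x = 0" using independentD[OF X(3,1) order_refl] by blast
  qed
  have inj_u: "inj_on u X"
  proof (rule inj_onI)
    fix x x' assume x: "x \<in> X" "x' \<in> X" "u x = u x'"
    then have A': "x - x' \<in> A" "x' \<in> A" using subspace_diff[OF A] X(2) by auto
    then have "u (x - x') = 0" using u_add[OF A'] x(3) by simp
    moreover note A'(1)
    ultimately show "x = x'" using inj by fastforce
  qed
  have inj_s: "inj_on s Y" using s by (metis inj_onI)
  have disj: "u ` X \<inter> s ` Y = {}"
  proof (rule ccontr)
    assume "u ` X \<inter> s ` Y \<noteq> {}"
    then obtain x y where "x \<in> X" "y \<in> Y" "u x = s y" by blast
    then have "y = 0" using pu[of x] X(2) s[of y] by auto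
    then show False using dependent_zero Y(3) \<open>y \<in> Y\<close> by blast
  qed
  define Z where "Z = u ` X \<union> s ` Y"
  have Z: "finite Z" "Z \<subseteq> V" unfolding Z_def using X(1,2) Y(1) uV s by auto
  have split: "(\<Sum>z\<in>Z. h z) = (\<Sum>x\<in>X. h (u x)) + (\<Sum>y\<in>Y. h (s y))" for h :: "'b \<Rightarrow> 'b"
    unfolding Z_def using disj X(1) Y(1) inj_u inj_s
    by (simp add: sum.union_disjoint sum.reindex)
  have "independent Z"
  proof (rule independent_if_scalars_zero[OF Z(1)])
    fix f z assume f: "(\<Sum>z\<in>Z. scale (f z) z) = 0" and z: "z \<in> Z"
    have "(\<forall>x\<in>X. f (u x) = 0) \<and> (\<forall>y\<in>Y. f (s y) = 0)"
      by (rule zero) (rule f[unfolded split])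
    then show "f z = 0" using z unfolding Z_def by blast
  qed
  moreover have "V \<subseteq> span Z"
  proof
    fix v assume v: "v \<in> V"
    then have "p v \<in> span Y" using pB Y(4) by blast
    then obtain b where b: "p v = (\<Sum>y\<in>Y. scale (b y) y)" using span_finite[OF Y(1)] by auto
    let ?w = "\<Sum>y\<in>Y. scale (b y) (s y)"
    have w: "?w \<in> V" using V s by (auto intro!: subspace_sum subspace_scale)
    have w_span: "?w \<in> span Z"
      by (intro span_sum span_scale span_base) (simp add: Z_def)
    have "p ?w = p v" using local.linear_between_sum[OF p, of Y s b] s b by simp
    moreover have "p v = p (v - ?w) + p ?w" using p_add[OF subspace_diff[OF V v w] w] by simp
    ultimately have "p (v - ?w) = 0" by simp
    then obtain x where x: "x \<in> A" "v - ?w = u x" using exact[OF subspace_diff[OF V v w]] by blast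
    then obtain a where "x = (\<Sum>x\<in>X. scale (a x) x)" using X(4) span_finite[OF X(1)] by auto
    then have "u x = (\<Sum>x\<in>X. scale (a x) (u x))"
      using local.linear_between_sum[OF u, of X "\<lambda>x. x" a] X(2) by (simp add: subset_eq)
    also have "\<dots> \<in> span Z"
      by (intro span_sum span_scale span_base) (simp add: Z_def)
    finally have "v - ?w \<in> span Z" using x(2) by simp
    then have "v - ?w + ?w \<in> span Z" using w_span span_add by blast
    then show "v \<in> span Z" by simp
  qed
  moreover have "card Z = dim A + dim B"
    unfolding Z_def using disj X Y inj_u inj_s by (simp add: card_Un_disjoint card_image)
  ultimately show ?thesis using dim_unique[OF Z(2)] by blast
qed

lemma dim_bijective_linear:
  assumes p: "linear_between V W p" and "\<And>x. x \<in> V \<Longrightarrow> p x = 0 \<Longrightarrow> x = 0" "W \<subseteq> p ` V"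
    and R: "finite R" "span R = W"
  shows "dim V = dim W"
proof -
  have V: "subspace V" using p by (simp add: linear_between_def)
  have p0: "p 0 = 0" using local.linear_between_sum[OF p, of "{}" "\<lambda>x. x" "\<lambda>x. 0"] by simp
  have "dim V = dim {0} + dim W"
  proof (rule local.dim_short_exact[of "{0}" V "\<lambda>x. x" W p "{}"])
    show "linear_between {0} V (\<lambda>x. x)"
      using V subspace_0[OF V] by (simp add: linear_between_def)
  qed (use assms p0 in auto)
  then show ?thesis using dim_unique[of "{}" "{0}" 0] by (simp add: independent_empty)
qed

text \<open>
  A family that spans and is no longer than the dimension contains a basis as a subset of its range, and
  comparing sizes shows that nothing is lost and nothing is repeated.
\<close>

lemma spanning_family_is_basis:
  fixes b :: "'i \<Rightarrow> 'b"
  assumes "finite I" "span (b ` I) = V" "card I \<le> dim V"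
  shows "family_basis scale V I b"
proof -
  obtain B where B: "B \<subseteq> b ` I" "independent B" "b ` I \<subseteq> span B"
    by (rule maximal_independent_subset)
  have "span B = V" using B(1,3) assms(2) span_mono span_minimal[OF B(3) subspace_span] by blast
  then have "card B = dim V" using dim_eq_card B(2) span_span by metis
  moreover have "card B \<le> card (b ` I)" "card (b ` I) \<le> card I"
    using card_mono[OF _ B(1)] card_image_le assms(1) by auto
  ultimately have "B = b ` I" "card (b ` I) = card I"
    using assms(1,3) card_subset_eq[OF _ B(1)] by auto
  then show ?thesis
    unfolding family_basis_def using B(2) assms eq_card_imp_inj_on by blast
qed

lemma family_basis_expansion:
  fixes b :: "'i \<Rightarrow> 'b"
  assumes "family_basis scale V I b" "finite I" "v \<in> V"
  obtains a where "v = (\<Sum>i\<in>I. scale (a i) (b i))"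
proof -
  have "inj_on b I" "v \<in> span (b ` I)" using assms(1,3) unfolding family_basis_def by auto
  then obtain a where "v = (\<Sum>x\<in>b ` I. scale (a x) x)" using span_finite[of "b ` I"] assms(2) by auto
  then have "v = (\<Sum>i\<in>I. scale (a (b i)) (b i))" using \<open>inj_on b I\<close> by (simp add: sum.reindex)
  then show ?thesis using that[of "\<lambda>i. a (b i)"] by blast
qed

end

lemma (in linear_category) linear_between_comp_left:
  "f \<in> Hom C Y Z \<Longrightarrow> X \<in> Obj C \<Longrightarrow> V.linear_between (Hom C X Y) (Hom C X Z) (\<lambda>h. f \<cdot> h)"
  unfolding V.linear_between_def
  using hom_subspace hom_objD comp_add_right comp_scale_right comp_hom by auto

context standard_category
begin

text \<open>
  The hypothesis on \<open>M\<close> makes \<open>Hom(M, _)\<close> exact on each step of the filtration, so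
  dimensions add up.
\<close>

lemma dim_Hom_Nabla_filtered:
  assumes "filtration C N (map Nabla ms)" "set ms \<subseteq> \<Lambda>" "M \<in> Obj C"
    "\<And>N ms. filtration C N (map Nabla ms) \<Longrightarrow> set ms \<subseteq> \<Lambda> \<Longrightarrow> ext_orth C M N"
  shows "V.dim (Hom C M N) = (\<Sum>m\<leftarrow>ms. V.dim (Hom C M (Nabla m)))"
  using assms(1,2)
proof (induction ms arbitrary: N)
  case Nil
  then have Z: "zero_obj C N" by (auto elim: filtration.cases)
  then have "N \<in> Obj C" by (simp add: zero_obj_def)
  then have "Hom C M N = {0}" using zero_obj_hom(2)[OF Z] hom_closed(1)[OF assms(3)] by blast
  then show ?case using V.dim_eq_card[of "{}" "{0}"] by (simp add: V.span_zero V.independent_empty V.span_insert_0)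
next
  case (Cons m ms)
  from Cons.prems(1) obtain N' x s where N': "filtration C N' (map Nabla ms)" "short_exact C N' N (Nabla m) x s"
    by (cases rule: filtration.cases) auto
  note S = short_exactD[OF N'(2)]
  obtain X Y where X: "finite X" "V.span X = Hom C M N'" and Y: "finite Y" "V.span Y = Hom C M (Nabla m)"
    using finite_dim_hom assms(3) S(8,10) by meson
  have "V.dim (Hom C M N) = V.dim (Hom C M N') + V.dim (Hom C M (Nabla m))"
  proof (rule V.dim_short_exact[OF linear_between_comp_left[OF S(1) assms(3)]
          linear_between_comp_left[OF S(2) assms(3)] _ _ _ _ X Y])
    show "h = 0" if "h \<in> Hom C M N'" "x \<cdot> h = 0" for h using mono_zeroD[OF S(4)] that by blast
    show "s \<cdot> (x \<cdot> h) = 0" if "h \<in> Hom C M N'" for h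
      using comp_assoc[OF that S(1,2)] S(3) comp_zero_left[OF that] by simp
    show "h \<in> (\<lambda>h. x \<cdot> h) ` Hom C M N'" if "h \<in> Hom C M N" "s \<cdot> h = 0" for h
      using kernelE[OF S(6) that] by blast
    show "Hom C M (Nabla m) \<subseteq> (\<lambda>h. s \<cdot> h) ` Hom C M N"
    proof
      fix h assume h: "h \<in> Hom C M (Nabla m)"
      have "ext_orth C M N'" using assms(4) N'(1) Cons.prems(2) by simp
      then obtain e where "e \<in> Hom C M N" "s \<cdot> e = h" using ext_orth_lift N'(2) h by blast
      then show "h \<in> (\<lambda>h. s \<cdot> h) ` Hom C M N" by blast
    qed
  qed
  then show ?case using Cons.IH[OF N'(1)] Cons.prems(2) by simp
qed

lemma dim_Hom_\<Delta>:
  assumes "l \<in> \<Lambda>" "filtration C N (map Nabla ms)" "set ms \<subseteq> \<Lambda>"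
  shows "V.dim (Hom C (\<Delta> l) N) = count_list ms l"
proof -
  have "V.dim (Hom C (\<Delta> l) N) = (\<Sum>m\<leftarrow>ms. V.dim (Hom C (\<Delta> l) (Nabla m)))"
    using dim_Hom_Nabla_filtered[OF assms(2,3) \<Delta>_obj[OF assms(1)]] \<Delta>_ext_orth[OF assms(1)] by blast
  also have "\<dots> = count_list ms l" using assms(3) by (induction ms) (auto simp: Ext0[OF assms(1)])
  finally show ?thesis .
qed

end

section \<open>Transposition along a duality\<close>

context duality
begin

lemma Dmor_iso: "is_iso C X Y f \<Longrightarrow> is_iso C (Dob Y) (Dob X) (Dmor f)"
proof -
  assume f: "is_iso C X Y f"
  note F = inv_morD[OF f]
  show ?thesis
    using Dmor_comp[OF F(1,2)] Dmor_comp[OF F(2,1)] F Dmor_id hom_objD[OF F(1)] Dmor_hom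
    by (intro isoI[of _ _ _ "Dmor (inv_mor C X Y f)"]) simp_all
qed

lemma linear_between_Dmor:
  "X \<in> Obj C \<Longrightarrow> Y \<in> Obj C \<Longrightarrow> V.linear_between (Hom C X Y) (Hom C (Dob Y) (Dob X)) Dmor"
  unfolding V.linear_between_def
  using hom_subspace Dob_obj Dmor_hom Dmor_add Dmor_scale by auto

lemma Dmor_faithful:
  assumes "f \<in> Hom C X Y" "Dmor f = 0" shows "f = 0"
proof -
  note X = hom_objD[OF assms(1)]
  have "Dmor 0 = 0"
    using V.linear_between_sum[OF linear_between_Dmor[OF Dob_obj[OF X(2)] Dob_obj[OF X(1)]], of "{}"] by simp
  then have "\<xi> Y \<cdot> f = 0"
    using \<xi>_natural[OF assms(1)] assms(2) comp_zero_left inv_morD(1)[OF \<xi>_iso[OF X(1)]] by metis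
  then show ?thesis using mono_zeroD[OF iso_mono[OF \<xi>_iso[OF X(2)]] assms(1)] by blast
qed

text \<open>
  The preimage of \<open>h\<close> is \<open>Dmor h\<close>, transported along \<open>\<xi>\<close>. The triangle identity \<open>\<xi>_dual\<close> shows that
  the inverse of \<open>\<xi> Y\<close> is sent to \<open>\<xi> (Dob Y)\<close>, and that the transports then cancel.
\<close>

lemma Dmor_full:
  assumes "h \<in> Hom C (Dob Y) (Dob X)" "X \<in> Obj C" "Y \<in> Obj C"
  obtains f where "f \<in> Hom C X Y" "Dmor f = h"
proof -
  note xiX = inv_morD[OF \<xi>_iso[OF assms(2)]] and xiY = inv_morD[OF \<xi>_iso[OF assms(3)]]
  note xiDY = inv_morD(1)[OF \<xi>_iso[OF Dob_obj[OF assms(3)]]]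
  note xiDX = inv_morD(1)[OF \<xi>_iso[OF Dob_obj[OF assms(2)]]]
  let ?i = "inv_mor C Y (Dob (Dob Y)) (\<xi> Y)"
  have Dh: "Dmor h \<in> Hom C (Dob (Dob X)) (Dob (Dob Y))" by (rule Dmor_hom[OF assms(1)])
  have "Dmor ?i \<cdot> Dmor (\<xi> Y) = Id C (Dob (Dob (Dob Y)))"
    using Dmor_comp[OF xiY(1,2)] Dmor_comp[OF xiY(2,1)] xiY Dmor_id Dob_obj assms(3) by metis
  moreover have "Dmor ?i = Dmor ?i \<cdot> (Dmor (\<xi> Y) \<cdot> \<xi> (Dob Y))"
    using \<xi>_dual[OF assms(3)] id_right[OF Dmor_hom[OF xiY(2)]] by simp
  ultimately have Di: "Dmor ?i = \<xi> (Dob Y)"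
    using comp_assoc[OF xiDY Dmor_hom[OF xiY(1)] Dmor_hom[OF xiY(2)]] id_left[OF xiDY] by simp
  let ?f = "?i \<cdot> (Dmor h \<cdot> \<xi> X)"
  have hx: "Dmor h \<cdot> \<xi> X \<in> Hom C X (Dob (Dob Y))" by (rule comp_hom[OF xiX(1) Dh])
  have "Dmor ?f = Dmor (\<xi> X) \<cdot> Dmor (Dmor h) \<cdot> \<xi> (Dob Y)"
    using Dmor_comp[OF hx xiY(2)] Dmor_comp[OF xiX(1) Dh] Di by simp
  also have "\<dots> = Dmor (\<xi> X) \<cdot> (\<xi> (Dob X) \<cdot> h)"
    using comp_assoc[OF xiDY Dmor_hom[OF Dh] Dmor_hom[OF xiX(1)]] \<xi>_natural[OF assms(1)] by simp
  also have "\<dots> = h"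
    using comp_assoc[OF assms(1) xiDX Dmor_hom[OF xiX(1)]] \<xi>_dual[OF assms(2)] id_left[OF assms(1)] by simp
  finally show ?thesis using that[OF comp_hom[OF hx xiY(2)]] by blast
qed

text \<open>
  The duality read on objects that it fixes, like the adjoint of a matrix with respect to chosen
  bilinear forms \<open>\<Phi>\<close> and \<open>\<Psi>\<close>. The target of \<open>\<Phi>\<close> is left free: with \<open>\<Phi> : Dob (\<Delta> l) \<rightarrow> Nabla l\<close> the same
  operation sends \<open>Hom(\<Delta> l, X)\<close> to \<open>Hom(X, Nabla l)\<close>.
\<close>

definition transpose :: "'m \<Rightarrow> 'o \<Rightarrow> 'm \<Rightarrow> 'm \<Rightarrow> 'm" where
  "transpose \<Phi> Y \<Psi> f = \<Phi> \<cdot> Dmor f \<cdot> inv_mor C (Dob Y) Y \<Psi>"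

lemma transpose_hom:
  assumes "f \<in> Hom C X Y" "\<Phi> \<in> Hom C (Dob X) X'" "is_iso C (Dob Y) Y \<Psi>"
  shows "transpose \<Phi> Y \<Psi> f \<in> Hom C Y X'"
  unfolding transpose_def
  using inv_morD[OF assms(3)] Dmor_hom[OF assms(1)] assms(2) comp_hom by meson

lemma transpose_comp:
  assumes "f \<in> Hom C X Y" "g \<in> Hom C Y Z"
    and \<Phi>: "\<Phi> \<in> Hom C (Dob X) X'" and iso: "is_iso C (Dob Y) Y \<Psi>" "is_iso C (Dob Z) Z \<Theta>"
  shows "transpose \<Phi> Z \<Theta> (g \<cdot> f) = transpose \<Phi> Y \<Psi> f \<cdot> transpose \<Psi> Z \<Theta> g"
proof -
  note B = inv_morD[OF iso(1)] and T = inv_morD[OF iso(2)]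
  note f = Dmor_hom[OF assms(1)] and g = Dmor_hom[OF assms(2)]
  let ?a = "\<Phi> \<cdot> Dmor f" and ?b = "Dmor g \<cdot> inv_mor C (Dob Z) Z \<Theta>"
  have a: "?a \<in> Hom C (Dob Y) X'" and b: "?b \<in> Hom C Z (Dob Y)"
    using comp_hom[OF f \<Phi>] comp_hom[OF T(2) g] .
  have 1: "transpose \<Psi> Z \<Theta> g = \<Psi> \<cdot> ?b"
    unfolding transpose_def by (rule comp_assoc[OF T(2) g B(1)])
  have "transpose \<Phi> Y \<Psi> f \<cdot> transpose \<Psi> Z \<Theta> g = ?a \<cdot> (inv_mor C (Dob Y) Y \<Psi> \<cdot> (\<Psi> \<cdot> ?b))"
    unfolding 1 by (simp add: transpose_def comp_assoc[OF comp_hom[OF b B(1)] B(2) a])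
  also have "inv_mor C (Dob Y) Y \<Psi> \<cdot> (\<Psi> \<cdot> ?b) = ?b"
    using comp_assoc[OF b B(1,2)] B(3) id_left[OF b] by simp
  also have "?a \<cdot> ?b = transpose \<Phi> Z \<Theta> (g \<cdot> f)"
    unfolding transpose_def Dmor_comp[OF assms(1,2)]
    using comp_assoc[OF T(2) g a] comp_assoc[OF g f \<Phi>] by simp
  finally show ?thesis by simp
qed

lemma linear_between_transpose:
  assumes "X \<in> Obj C" "\<Phi> \<in> Hom C (Dob X) X'" "is_iso C (Dob Y) Y \<Psi>"
  shows "V.linear_between (Hom C X Y) (Hom C Y X') (transpose \<Phi> Y \<Psi>)"
proof -
  note I = inv_morD[OF assms(3)]
  note Y = hom_objD(2)[OF I(1)]
  have \<Phi>D: "\<Phi> \<cdot> Dmor f \<in> Hom C (Dob Y) X'" if "f \<in> Hom C X Y" for f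
    by (rule comp_hom[OF Dmor_hom[OF that] assms(2)])
  have "transpose \<Phi> Y \<Psi> (f + f') = transpose \<Phi> Y \<Psi> f + transpose \<Phi> Y \<Psi> f'"
    if "f \<in> Hom C X Y" "f' \<in> Hom C X Y" for f f'
    unfolding transpose_def Dmor_add[OF that] comp_add_right[OF Dmor_hom[OF that(1)] Dmor_hom[OF that(2)] assms(2)]
    by (rule comp_add_left[OF I(2) \<Phi>D[OF that(1)] \<Phi>D[OF that(2)]])
  moreover have "transpose \<Phi> Y \<Psi> (Scale C a f) = Scale C a (transpose \<Phi> Y \<Psi> f)"
    if "f \<in> Hom C X Y" for a f
    unfolding transpose_def Dmor_scale[OF that] comp_scale_right[OF Dmor_hom[OF that] assms(2)]
    by (rule comp_scale_left[OF I(2) comp_hom[OF Dmor_hom[OF that] assms(2)]])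
  ultimately show ?thesis
    unfolding V.linear_between_def
    using hom_subspace assms(1) Y hom_objD(2)[OF assms(2)] transpose_hom[OF _ assms(2,3)] by auto
qed

lemma transpose_inject:
  assumes f: "f \<in> Hom C X Y" and iso: "is_iso C (Dob X) X' \<Phi>" "is_iso C (Dob Y) Y \<Psi>"
    and 0: "transpose \<Phi> Y \<Psi> f = 0"
  shows "f = 0"
proof -
  note A = inv_morD[OF iso(1)] and I = inv_morD[OF iso(2)]
  have "\<Phi> \<cdot> Dmor f = 0"
    using epi_zeroD[OF iso_epi[OF is_iso_inv[OF iso(2)]] comp_hom[OF Dmor_hom[OF f] A(1)]] 0
    unfolding transpose_def by blast
  then have "Dmor f = 0" using mono_zeroD[OF iso_mono[OF iso(1)] Dmor_hom[OF f]] by blast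
  then show ?thesis using Dmor_faithful[OF f] by blast
qed

lemma transpose_surject:
  assumes h: "h \<in> Hom C Y X'" and iso: "is_iso C (Dob X) X' \<Phi>" "is_iso C (Dob Y) Y \<Psi>" and X: "X \<in> Obj C"
  obtains f where "f \<in> Hom C X Y" "transpose \<Phi> Y \<Psi> f = h"
proof -
  note A = inv_morD[OF iso(1)] and I = inv_morD[OF iso(2)]
  let ?i = "inv_mor C (Dob X) X' \<Phi>" and ?j = "inv_mor C (Dob Y) Y \<Psi>"
  have ih: "?i \<cdot> h \<in> Hom C Y (Dob X)" by (rule comp_hom[OF h A(2)])
  obtain f where f: "f \<in> Hom C X Y" "Dmor f = ?i \<cdot> h \<cdot> \<Psi>"
    by (rule Dmor_full[OF comp_hom[OF I(1) ih] X hom_objD(2)[OF I(1)]])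
  have "\<Phi> \<cdot> Dmor f = h \<cdot> \<Psi>"
    unfolding f(2) using comp_assoc[OF I(1) ih A(1)] comp_assoc[OF h A(2,1)] A(4) id_left[OF h] by simp
  then have "transpose \<Phi> Y \<Psi> f = h"
    unfolding transpose_def using comp_assoc[OF I(2,1) h] I(4) id_right[OF h] by simp
  then show ?thesis using that f(1) by blast
qed

text \<open>
  The second form of the fixed point condition is obtained by solving the defining one for \<open>\<xi> X\<close>.
\<close>

lemma fixed_viaD:
  assumes "fixed_via C Dob Dmor \<xi> X \<Phi>"
  shows "is_iso C (Dob X) X \<Phi>" "Dmor \<Phi> \<cdot> inv_mor C (Dob X) X \<Phi> = \<xi> X"
    "\<Phi> \<cdot> Dmor (inv_mor C (Dob X) X \<Phi>) \<cdot> \<xi> X = Id C X"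
proof -
  show iso: "is_iso C (Dob X) X \<Phi>" and fx: "\<Phi> \<cdot> Dmor (inv_mor C (Dob X) X \<Phi>) \<cdot> \<xi> X = Id C X"
    using assms by (auto simp: fixed_via_def)
  note A = inv_morD[OF iso]
  let ?i = "inv_mor C (Dob X) X \<Phi>"
  note X = hom_objD(2)[OF A(1)]
  note xi = inv_morD(1)[OF \<xi>_iso[OF X]] and Di = Dmor_hom[OF A(2)] and D\<Phi> = Dmor_hom[OF A(1)]
  have d: "Dmor ?i \<cdot> \<xi> X \<in> Hom C X (Dob X)" by (rule comp_hom[OF xi Di])
  have "Dmor ?i \<cdot> \<xi> X = ?i \<cdot> \<Phi> \<cdot> (Dmor ?i \<cdot> \<xi> X)" using A(3) id_left[OF d] by simp
  also have "\<dots> = ?i \<cdot> (\<Phi> \<cdot> Dmor ?i \<cdot> \<xi> X)"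
    using comp_assoc[OF d A(1,2)] comp_assoc[OF xi Di A(1)] by simp
  also have "\<dots> = ?i" using fx id_right[OF A(2)] by simp
  finally have "Dmor \<Phi> \<cdot> ?i = Dmor \<Phi> \<cdot> Dmor ?i \<cdot> \<xi> X" using comp_assoc[OF xi Di D\<Phi>] by simp
  also have "Dmor \<Phi> \<cdot> Dmor ?i = Id C (Dob (Dob X))"
    using Dmor_comp[OF A(1,2)] A(3) Dmor_id Dob_obj[OF X] by simp
  finally show "Dmor \<Phi> \<cdot> ?i = \<xi> X" using id_left[OF xi] by simp
qed

text \<open>
  The two forms of the fixed point condition identify what surrounds \<open>Dmor (Dmor f)\<close> with \<open>\<xi> X\<close> on one
  side and the inverse of \<open>\<xi> Y\<close> on the other; naturality of \<open>\<xi>\<close> does the rest.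
\<close>

lemma transpose_transpose:
  assumes f: "f \<in> Hom C X Y"
    and fixed: "fixed_via C Dob Dmor \<xi> X \<Phi>" "fixed_via C Dob Dmor \<xi> Y \<Psi>"
  shows "transpose \<Psi> X \<Phi> (transpose \<Phi> Y \<Psi> f) = f"
proof -
  note FX = fixed_viaD[OF fixed(1)] and FY = fixed_viaD[OF fixed(2)]
  note A = inv_morD[OF FX(1)] and B = inv_morD[OF FY(1)]
  let ?i = "inv_mor C (Dob X) X \<Phi>" and ?j = "inv_mor C (Dob Y) Y \<Psi>"
  note Df = Dmor_hom[OF f] and Dj = Dmor_hom[OF B(2)] and D\<Phi> = Dmor_hom[OF A(1)]
  note DDf = Dmor_hom[OF Df]
  note xiX = inv_morD(1)[OF \<xi>_iso[OF hom_objD(2)[OF A(1)]]] and xiY = inv_morD(1)[OF \<xi>_iso[OF hom_objD(2)[OF B(1)]]]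
  have "Dmor (transpose \<Phi> Y \<Psi> f) = Dmor ?j \<cdot> (Dmor (Dmor f) \<cdot> Dmor \<Phi>)"
    unfolding transpose_def using Dmor_comp[OF B(2) comp_hom[OF Df A(1)]] Dmor_comp[OF Df A(1)] by simp
  then have "transpose \<Psi> X \<Phi> (transpose \<Phi> Y \<Psi> f) = \<Psi> \<cdot> (Dmor ?j \<cdot> (Dmor (Dmor f) \<cdot> Dmor \<Phi>)) \<cdot> ?i"
    by (simp add: transpose_def[of \<Psi>])
  also have "\<dots> = \<Psi> \<cdot> Dmor ?j \<cdot> (Dmor (Dmor f) \<cdot> (Dmor \<Phi> \<cdot> ?i))"
    using comp_assoc[OF comp_hom[OF D\<Phi> DDf] Dj B(1)] comp_assoc[OF A(2) comp_hom[OF D\<Phi> DDf] comp_hom[OF Dj B(1)]]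
      comp_assoc[OF A(2) D\<Phi> DDf] by simp
  also have "\<dots> = \<Psi> \<cdot> Dmor ?j \<cdot> \<xi> Y \<cdot> f"
    using FX(2) \<xi>_natural[OF f] comp_assoc[OF f xiY comp_hom[OF Dj B(1)]] by simp
  also have "\<dots> = f" using FY(3) id_left[OF f] by simp
  finally show ?thesis .
qed

end

section \<open>The cellular basis of a tilting object\<close>

locale lifted_hom_bases =
  standard_duality C \<Lambda> L Nabla \<Delta> Tl Dob Dmor \<xi>
  for C :: "('o, 'm::ab_group_add, 'k::field) lin_cat" (structure)
    and \<Lambda> :: "'l::order set" and L Nabla \<Delta> Tl :: "'l \<Rightarrow> 'o"
    and Dob :: "'o \<Rightarrow> 'o" and Dmor :: "'m \<Rightarrow> 'm" and \<xi> :: "'o \<Rightarrow> 'm" +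
  fixes X :: 'o and incl :: "'l \<Rightarrow> 'm" and \<Phi>X :: 'm and \<Phi> :: "'l \<Rightarrow> 'm"
    and g ghat fhat :: "'l \<Rightarrow> nat \<Rightarrow> 'm"
  assumes tilting_X: "tilting C \<Lambda> Nabla \<Delta> X"
    and incl_mono: "l \<in> \<Lambda> \<Longrightarrow> is_mono C (\<Delta> l) (Tl l) (incl l)"
    and X_fixed: "fixed_via C Dob Dmor \<xi> X \<Phi>X"
    and Tl_fixed: "l \<in> \<Lambda> \<Longrightarrow> fixed_via C Dob Dmor \<xi> (Tl l) (\<Phi> l)"
    and g_basis: "l \<in> \<Lambda> \<Longrightarrow> family_basis (Scale C) (Hom C (\<Delta> l) X) (hom_index C (\<Delta> l) X) (g l)"
    and ghat_lift: "l \<in> \<Lambda> \<Longrightarrow> i \<in> hom_index C (\<Delta> l) X \<Longrightarrow>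
      ghat l i \<in> Hom C (Tl l) X \<and> ghat l i \<cdot> incl l = g l i"
    and fhat_eq: "l \<in> \<Lambda> \<Longrightarrow> i \<in> hom_index C (\<Delta> l) X \<Longrightarrow>
      fhat l i = \<Phi> l \<cdot> Dmor (ghat l i) \<cdot> inv_mor C (Dob X) X \<Phi>X"
begin

abbreviation I :: "'l \<Rightarrow> nat set" where
  "I l \<equiv> hom_index C (\<Delta> l) X"

definition cell :: "'l \<Rightarrow> nat \<Rightarrow> nat \<Rightarrow> 'm" where
  "cell l i j = ghat l i \<cdot> fhat l j"

definition cells :: "'l set \<Rightarrow> 'm set" where
  "cells P = {cell l i j | l i j. l \<in> P \<and> i \<in> I l \<and> j \<in> I l}"

abbreviation \<alpha> :: "'m \<Rightarrow> 'm" where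
  "\<alpha> \<equiv> transpose \<Phi>X X \<Phi>X"

lemma I_finite: "finite (I l)" and card_I: "card (I l) = V.dim (Hom C (\<Delta> l) X)"
  by (simp_all add: hom_index_def)

lemma X_obj: "X \<in> Obj C"
  by (rule tilting_obj[OF tilting_X])

lemmas \<Phi>X_iso = fixed_viaD(1)[OF X_fixed]

lemma \<Phi>_iso: "l \<in> \<Lambda> \<Longrightarrow> is_iso C (Dob (Tl l)) (Tl l) (\<Phi> l)"
  by (rule fixed_viaD(1)[OF Tl_fixed])

lemma ghat_hom: "l \<in> \<Lambda> \<Longrightarrow> i \<in> I l \<Longrightarrow> ghat l i \<in> Hom C (Tl l) X"
  using ghat_lift by blast

lemma fhat_transpose: "l \<in> \<Lambda> \<Longrightarrow> i \<in> I l \<Longrightarrow> fhat l i = transpose (\<Phi> l) X \<Phi>X (ghat l i)"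
  by (simp add: fhat_eq transpose_def)

lemma fhat_hom: "l \<in> \<Lambda> \<Longrightarrow> i \<in> I l \<Longrightarrow> fhat l i \<in> Hom C X (Tl l)"
  using transpose_hom[OF ghat_hom inv_morD(1)[OF \<Phi>_iso] \<Phi>X_iso] fhat_transpose by simp

lemma cell_hom: "l \<in> \<Lambda> \<Longrightarrow> i \<in> I l \<Longrightarrow> j \<in> I l \<Longrightarrow> cell l i j \<in> Hom C X X"
  unfolding cell_def using comp_hom fhat_hom ghat_hom by blast

lemma \<alpha>_hom: "\<phi> \<in> Hom C X X \<Longrightarrow> \<alpha> \<phi> \<in> Hom C X X"
  using transpose_hom inv_morD(1)[OF \<Phi>X_iso] \<Phi>X_iso by blast

lemma \<alpha>_mult: "\<phi> \<in> Hom C X X \<Longrightarrow> \<psi> \<in> Hom C X X \<Longrightarrow> \<alpha> (\<phi> \<cdot> \<psi>) = \<alpha> \<psi> \<cdot> \<alpha> \<phi>"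
  using transpose_comp inv_morD(1)[OF \<Phi>X_iso] \<Phi>X_iso by blast

lemma \<alpha>_involution: "\<phi> \<in> Hom C X X \<Longrightarrow> \<alpha> (\<alpha> \<phi>) = \<phi>"
  using transpose_transpose X_fixed by blast

lemma \<alpha>_linear: "V.linear_between (Hom C X X) (Hom C X X) \<alpha>"
  using linear_between_transpose[OF X_obj] inv_morD(1)[OF \<Phi>X_iso] \<Phi>X_iso by blast

lemma \<alpha>_add: "\<phi> \<in> Hom C X X \<Longrightarrow> \<psi> \<in> Hom C X X \<Longrightarrow> \<alpha> (\<phi> + \<psi>) = \<alpha> \<phi> + \<alpha> \<psi>"
  and \<alpha>_scale: "\<phi> \<in> Hom C X X \<Longrightarrow> \<alpha> (Scale C a \<phi>) = Scale C a (\<alpha> \<phi>)"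
  using \<alpha>_linear by (simp_all add: V.linear_between_def)

lemma \<alpha>_one: "\<alpha> (Id C X) = Id C X"
  using inv_morD[OF \<Phi>X_iso] Dmor_id[OF X_obj] id_right by (simp add: transpose_def)

text \<open>
  The transpose of \<open>fhat l j\<close> is \<open>ghat l j\<close> again.
\<close>

lemma \<alpha>_cell:
  assumes "l \<in> \<Lambda>" "i \<in> I l" "j \<in> I l" shows "\<alpha> (cell l i j) = cell l j i"
proof -
  have "\<alpha> (cell l i j) = transpose \<Phi>X (Tl l) (\<Phi> l) (fhat l j) \<cdot> transpose (\<Phi> l) X \<Phi>X (ghat l i)"
    unfolding cell_def using transpose_comp[OF fhat_hom ghat_hom inv_morD(1)[OF \<Phi>X_iso] \<Phi>_iso \<Phi>X_iso] assms by blast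
  also have "transpose \<Phi>X (Tl l) (\<Phi> l) (fhat l j) = ghat l j"
    using transpose_transpose[OF ghat_hom Tl_fixed X_fixed] fhat_transpose assms by simp
  finally show ?thesis using fhat_transpose assms by (simp add: cell_def)
qed

text \<open>
  Apply the duality to \<open>Dob (Nabla l) \<rightarrow> \<Delta> l\<close> and cancel the double dual.
\<close>

lemma Dob_\<Delta>_iso:
  assumes "l \<in> \<Lambda>" shows "\<exists>\<theta>. is_iso C (Dob (\<Delta> l)) (Nabla l) \<theta>"
proof -
  obtain h where "is_iso C (Dob (Nabla l)) (\<Delta> l) h"
    using dual_costandard[OF assms] unfolding isomorphic_def by blast
  then show ?thesis
    using is_iso_comp[OF Dmor_iso is_iso_inv[OF \<xi>_iso[OF Nabla_obj[OF assms]]]] by blast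
qed

definition \<theta> :: "'l \<Rightarrow> 'm" where
  "\<theta> l = (SOME \<theta>. is_iso C (Dob (\<Delta> l)) (Nabla l) \<theta>)"

definition proj :: "'l \<Rightarrow> 'm" where
  "proj l = transpose (\<theta> l) (Tl l) (\<Phi> l) (incl l)"

lemma \<theta>_iso: "l \<in> \<Lambda> \<Longrightarrow> is_iso C (Dob (\<Delta> l)) (Nabla l) (\<theta> l)"
  unfolding \<theta>_def using someI_ex[OF Dob_\<Delta>_iso] by blast

lemma incl_hom: "l \<in> \<Lambda> \<Longrightarrow> incl l \<in> Hom C (\<Delta> l) (Tl l)"
  using incl_mono mono_hom by blast

lemma proj_hom: "l \<in> \<Lambda> \<Longrightarrow> proj l \<in> Hom C (Tl l) (Nabla l)"
  unfolding proj_def using transpose_hom[OF incl_hom inv_morD(1)[OF \<theta>_iso] \<Phi>_iso] by blast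

lemma proj_fhat: "l \<in> \<Lambda> \<Longrightarrow> i \<in> I l \<Longrightarrow> proj l \<cdot> fhat l i = transpose (\<theta> l) X \<Phi>X (g l i)"
  using transpose_comp[OF incl_hom ghat_hom inv_morD(1)[OF \<theta>_iso] \<Phi>_iso \<Phi>X_iso] ghat_lift fhat_transpose
  by (simp add: proj_def)

lemma dim_Hom_Nabla:
  assumes "l \<in> \<Lambda>" shows "V.dim (Hom C X (Nabla l)) = card (I l)"
proof -
  obtain R where R: "finite R" "V.span R = Hom C X (Nabla l)"
    using finite_dim_hom[OF X_obj Nabla_obj[OF assms]] by blast
  have "V.dim (Hom C (\<Delta> l) X) = V.dim (Hom C X (Nabla l))"
  proof (rule V.dim_bijective_linear[OF _ _ _ R])
    show "V.linear_between (Hom C (\<Delta> l) X) (Hom C X (Nabla l)) (transpose (\<theta> l) X \<Phi>X)"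
      by (rule linear_between_transpose[OF \<Delta>_obj[OF assms] inv_morD(1)[OF \<theta>_iso[OF assms]] \<Phi>X_iso])
    show "f = 0" if "f \<in> Hom C (\<Delta> l) X" "transpose (\<theta> l) X \<Phi>X f = 0" for f
      by (rule transpose_inject[OF that(1) \<theta>_iso[OF assms] \<Phi>X_iso that(2)])
    show "Hom C X (Nabla l) \<subseteq> transpose (\<theta> l) X \<Phi>X ` Hom C (\<Delta> l) X"
    proof
      fix h assume "h \<in> Hom C X (Nabla l)"
      then obtain f where "f \<in> Hom C (\<Delta> l) X" "transpose (\<theta> l) X \<Phi>X f = h"
        by (rule transpose_surject[OF _ \<theta>_iso[OF assms] \<Phi>X_iso \<Delta>_obj[OF assms]])
      then show "h \<in> transpose (\<theta> l) X \<Phi>X ` Hom C (\<Delta> l) X" by blast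
    qed
  qed
  then show ?thesis by (simp add: card_I)
qed

text \<open>
  Transposition sends the basis \<open>g l\<close> of \<open>Hom(\<Delta> l, X)\<close> to the maps \<open>proj l \<cdot> fhat l j\<close>.
\<close>

lemma Hom_Nabla_expansion:
  assumes "l \<in> \<Lambda>" "h \<in> Hom C X (Nabla l)"
  obtains b where "h = proj l \<cdot> (\<Sum>j\<in>I l. Scale C (b j) (fhat l j))"
proof -
  obtain f where f: "f \<in> Hom C (\<Delta> l) X" "transpose (\<theta> l) X \<Phi>X f = h"
    by (rule transpose_surject[OF assms(2) \<theta>_iso[OF assms(1)] \<Phi>X_iso \<Delta>_obj[OF assms(1)]])
  obtain b where b: "f = (\<Sum>j\<in>I l. Scale C (b j) (g l j))"
    by (rule V.family_basis_expansion[OF g_basis[OF assms(1)] I_finite f(1)])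
  have gh: "g l j \<in> Hom C (\<Delta> l) X" if "j \<in> I l" for j
    using ghat_lift[OF assms(1) that] incl_hom[OF assms(1)] comp_hom by metis
  have "h = (\<Sum>j\<in>I l. Scale C (b j) (transpose (\<theta> l) X \<Phi>X (g l j)))"
    using V.linear_between_sum[OF linear_between_transpose[OF \<Delta>_obj[OF assms(1)]
          inv_morD(1)[OF \<theta>_iso[OF assms(1)]] \<Phi>X_iso], of "I l" "g l" b] gh f(2) b by simp
  also have "\<dots> = (\<Sum>j\<in>I l. Scale C (b j) (proj l \<cdot> fhat l j))"
    using proj_fhat[OF assms(1)] by simp
  also have "\<dots> = proj l \<cdot> (\<Sum>j\<in>I l. Scale C (b j) (fhat l j))"
    using V.linear_between_sum[OF linear_between_comp_left[OF proj_hom[OF assms(1)] X_obj], of "I l" "fhat l" b]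
      fhat_hom[OF assms(1)] by simp
  finally show ?thesis using that by blast
qed

lemma cells_mono: "P \<subseteq> Q \<Longrightarrow> cells P \<subseteq> cells Q"
  unfolding cells_def by blast

lemma cells_hom: "P \<subseteq> \<Lambda> \<Longrightarrow> cells P \<subseteq> Hom C X X"
  unfolding cells_def using cell_hom by blast

text \<open>
  Expanding the restriction of \<open>u\<close> to \<open>\<Delta> l\<close> in the basis \<open>g l\<close> gives a combination of the lifts that
  agrees with \<open>u\<close> on \<open>\<Delta> l\<close>; the difference factors through \<open>Tl l / \<Delta> l\<close>. That the coefficients
  do not depend on \<open>f\<close> is what makes the structure constants of the left multiplication
  independent of the second index.
\<close>

lemma comp_from_Tl_mod_lower:
  assumes "l \<in> \<Lambda>" "u \<in> Hom C (Tl l) X"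
  shows "\<exists>a. \<forall>f \<in> Hom C X (Tl l).
    factors_through C L {m \<in> \<Lambda>. m < l} X X (u \<cdot> f - (\<Sum>i\<in>I l. Scale C (a i) (ghat l i \<cdot> f)))"
proof -
  note inc = incl_hom[OF assms(1)]
  obtain a where a: "u \<cdot> incl l = (\<Sum>i\<in>I l. Scale C (a i) (g l i))"
    by (rule V.family_basis_expansion[OF g_basis[OF assms(1)] I_finite comp_hom[OF inc assms(2)]])
  define s where "s = (\<Sum>i\<in>I l. Scale C (a i) (ghat l i))"
  have gh: "Scale C (a i) (ghat l i) \<in> Hom C (Tl l) X" if "i \<in> I l" for i
    using hom_closed(4) ghat_hom[OF assms(1) that] by blast
  have s: "s \<in> Hom C (Tl l) X"
    unfolding s_def by (rule hom_closed(5)[OF T_obj[OF assms(1)] X_obj]) (rule gh)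
  have s_comp: "s \<cdot> f = (\<Sum>i\<in>I l. Scale C (a i) (ghat l i \<cdot> f))" if "f \<in> Hom C Y (Tl l)" for f Y
  proof -
    have "s \<cdot> f = (\<Sum>i\<in>I l. Scale C (a i) (ghat l i) \<cdot> f)"
      unfolding s_def by (rule comp_sum_left[OF that X_obj gh])
    then show ?thesis using comp_scale_left[OF that ghat_hom[OF assms(1)]] by simp
  qed
  obtain Q q where q: "short_exact C (\<Delta> l) (Tl l) Q (incl l) q"
    using mono_short_exactE[OF incl_mono[OF assms(1)]] by blast
  note S = short_exactD[OF q]
  have us: "u - s \<in> Hom C (Tl l) X" using hom_closed(3) assms(2) s by blast
  have "(u - s) \<cdot> incl l = 0"
    using comp_diff_left[OF inc assms(2) s] s_comp[OF inc] a ghat_lift[OF assms(1)] by simp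
  then obtain w where w: "w \<in> Hom C Q X" "w \<cdot> q = u - s" using cokernelE[OF S(7) us] by blast
  have "factors_through C L {m \<in> \<Lambda>. m < l} X X (u \<cdot> f - (\<Sum>i\<in>I l. Scale C (a i) (ghat l i \<cdot> f)))"
    if f: "f \<in> Hom C X (Tl l)" for f
  proof -
    have "u \<cdot> f - (\<Sum>i\<in>I l. Scale C (a i) (ghat l i \<cdot> f)) = w \<cdot> (q \<cdot> f)"
      using comp_diff_left[OF f assms(2) s] s_comp[OF f] w(2) comp_assoc[OF f S(2) w(1)] by simp
    then show ?thesis
      unfolding factors_through_def
      using T_quotient_supported[OF assms(1) q] comp_hom[OF f S(2)] w(1) by blast
  qed
  then show ?thesis by blast
qed

text \<open>
  One round of the recursion over \<open>P\<close>: an induction on the costandard filtration of \<open>N\<close> removes the component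
  of \<open>\<phi>\<close> in each quotient \<open>Nabla m\<close>, at the cost of maps that factor through \<open>Tl m / \<Delta> m\<close>, which
  the hypothesis \<open>lower\<close> takes care of. The map \<open>n\<close> returns to \<open>X\<close>, and is
  arbitrary so that the induction can compose it with the inclusion \<open>N' \<rightarrow> N\<close>.
\<close>

lemma factors_through_span_step:
  assumes P: "P \<subseteq> \<Lambda>" and down: "\<And>m n. m \<in> P \<Longrightarrow> n \<in> \<Lambda> \<Longrightarrow> n \<le> m \<Longrightarrow> n \<in> P"
    and F: "F \<subseteq> \<Lambda>"
    and lower: "\<And>m \<phi>. m \<in> P \<inter> F \<Longrightarrow> factors_through C L {n \<in> \<Lambda>. n < m} X X \<phi> \<Longrightarrow>
        \<phi> \<in> V.span (cells {n \<in> \<Lambda>. n < m})"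
    and "filtration C N (map Nabla ms)" "set ms \<subseteq> F" "n \<in> Hom C N X" "factors_through C L P X N \<phi>"
  shows "n \<cdot> \<phi> \<in> V.span (cells P)"
  using assms(5-8)
proof (induction ms arbitrary: N n \<phi>)
  case Nil
  then have "zero_obj C N" by (auto elim: filtration.cases)
  then have "n = 0" using zero_obj_hom(1) Nil.prems(3) by blast
  then show ?case using comp_zero_left[OF factors_through_hom[OF Nil.prems(4)]] V.span_zero by simp
next
  case (Cons m ms)
  have simple: "\<And>l. l \<in> P \<Longrightarrow> simple_obj C (L l)" using simple_L P by blast
  have m: "m \<in> \<Lambda>" "m \<in> F" and ms: "set ms \<subseteq> F" "set ms \<subseteq> \<Lambda>" using Cons.prems(2) F by auto
  from Cons.prems(1) obtain N' x s where N': "filtration C N' (map Nabla ms)" "short_exact C N' N (Nabla m) x s"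
    by (cases rule: filtration.cases) auto
  note S = short_exactD[OF N'(2)] and n = Cons.prems(3)
  have kernel_case: "n \<cdot> \<psi> \<in> V.span (cells P)" if \<psi>: "factors_through C L P X N \<psi>" "s \<cdot> \<psi> = 0" for \<psi>
  proof -
    obtain \<psi>' where \<psi>': "factors_through C L P X N' \<psi>'" "x \<cdot> \<psi>' = \<psi>"
      by (rule factors_through_kernel[OF \<psi>(1) simple S(6) \<psi>(2)])
    have "n \<cdot> x \<cdot> \<psi>' \<in> V.span (cells P)"
      by (rule Cons.IH[OF N'(1) ms(1) comp_hom[OF S(1) n] \<psi>'(1)])
    then show ?thesis using comp_assoc[OF factors_through_hom[OF \<psi>'(1)] S(1) n] \<psi>'(2) by simp
  qed
  note \<phi> = factors_through_hom[OF Cons.prems(4)]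
  show ?case
  proof (cases "s \<cdot> \<phi> = 0")
    case True
    then show ?thesis using kernel_case Cons.prems(4) by blast
  next
    case False
    obtain Z a b where Z: "supported_on C L P Z" "a \<in> Hom C X Z" "b \<in> Hom C Z N" "\<phi> = b \<cdot> a"
      using Cons.prems(4) unfolding factors_through_def by blast
    have "s \<cdot> b \<noteq> 0"
      using False Z(4) comp_assoc[OF Z(2,3) S(2)] comp_zero_left[OF Z(2)] by auto
    \<comment> \<open>So the cell labelled \<open>m\<close> may be used, and subtracting a map through \<open>Tl m\<close> does not leave the ideal.\<close>
    then have mP: "m \<in> P" by (rule nonzero_to_Nabla[OF Z(1) P comp_hom[OF Z(3) S(2)] _ m(1)])
    obtain c where c: "s \<cdot> \<phi> = proj m \<cdot> (\<Sum>j\<in>I m. Scale C (c j) (fhat m j))"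
      by (rule Hom_Nabla_expansion[OF m(1) comp_hom[OF \<phi> S(2)]])
    define f where "f = (\<Sum>j\<in>I m. Scale C (c j) (fhat m j))"
    have f: "f \<in> Hom C X (Tl m)"
      unfolding f_def by (intro hom_closed(5)[OF X_obj T_obj[OF m(1)]] hom_closed(4) fhat_hom[OF m(1)])
    have "ext_orth C (Tl m) N'" using tilting_ext_orth[OF T_tilting[OF m(1)] N'(1) ms(2)] .
    then obtain e where e: "e \<in> Hom C (Tl m) N" "s \<cdot> e = proj m"
      using ext_orth_lift[OF _ N'(2) proj_hom[OF m(1)]] by blast
    note ef = comp_hom[OF f e(1)]
    have "supported_on C L P (Tl m)"
    proof -
      obtain ls where "filtration C (Tl m) (map L ls)" "set ls \<subseteq> {n \<in> \<Lambda>. n \<le> m}"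
        by (rule T_composition_factors[OF m(1)])
      then show ?thesis unfolding supported_on_def using down[OF mP] by blast
    qed
    then have "factors_through C L P X N (e \<cdot> f)" unfolding factors_through_def using f e(1) by blast
    then have "factors_through C L P X N (\<phi> - e \<cdot> f)" using factors_through_diff Cons.prems(4) by blast
    moreover have "s \<cdot> (\<phi> - e \<cdot> f) = 0"
      using comp_diff_right[OF \<phi> ef S(2)] comp_assoc[OF f e(1) S(2)] e(2) c f_def by simp
    ultimately have 1: "n \<cdot> (\<phi> - e \<cdot> f) \<in> V.span (cells P)" using kernel_case by blast
    obtain a where a: "factors_through C L {n \<in> \<Lambda>. n < m} X X
        (n \<cdot> e \<cdot> f - (\<Sum>i\<in>I m. Scale C (a i) (ghat m i \<cdot> f)))"
      using comp_from_Tl_mod_lower[OF m(1) comp_hom[OF e(1) n]] f by blast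
    have "V.span (cells {n \<in> \<Lambda>. n < m}) \<subseteq> V.span (cells P)"
      by (intro V.span_mono cells_mono) (auto intro: down[OF mP])
    then have 2: "n \<cdot> e \<cdot> f - (\<Sum>i\<in>I m. Scale C (a i) (ghat m i \<cdot> f)) \<in> V.span (cells P)"
      using lower[OF _ a] mP m(2) by blast
    have 3: "(\<Sum>i\<in>I m. Scale C (a i) (ghat m i \<cdot> f)) \<in> V.span (cells P)"
    proof (intro V.span_sum V.span_scale)
      fix i assume i: "i \<in> I m"
      have "ghat m i \<cdot> f = (\<Sum>j\<in>I m. Scale C (c j) (cell m i j))"
        unfolding f_def cell_def
        using V.linear_between_sum[OF linear_between_comp_left[OF ghat_hom[OF m(1) i] X_obj], of "I m" "fhat m" c]
          fhat_hom[OF m(1)] by simp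
      also have "\<dots> \<in> V.span (cells P)"
        by (intro V.span_sum V.span_scale V.span_base) (use i mP in \<open>auto simp: cells_def\<close>)
      finally show "ghat m i \<cdot> f \<in> V.span (cells P)" .
    qed
    have "n \<cdot> e \<cdot> f \<in> V.span (cells P)" using V.span_add[OF 2 3] by simp
    moreover have "n \<cdot> (\<phi> - e \<cdot> f) = n \<cdot> \<phi> - n \<cdot> e \<cdot> f"
      using comp_diff_right[OF \<phi> ef n] comp_assoc[OF f e(1) n] by simp
    ultimately show ?thesis using V.span_add[OF 1] by fastforce
  qed
qed

lemma Nabla_filtration_X:
  obtains ms where "set ms \<subseteq> \<Lambda>" "filtration C X (map Nabla ms)"
  using tilting_X filtered_by_family[of Nabla X] unfolding tilting_def by blast

text \<open>
  Each round passes from \<open>P\<close> to sets \<open>{n. n < m}\<close> with \<open>m\<close> in \<open>P\<close> a label of the costandard filtration of \<open>X\<close>,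
  and these contain fewer such labels since \<open>m\<close> is lost. So the recursion ends although the poset may be infinite.
\<close>

lemma factors_through_span:
  assumes "P \<subseteq> \<Lambda>" "\<And>m n. m \<in> P \<Longrightarrow> n \<in> \<Lambda> \<Longrightarrow> n \<le> m \<Longrightarrow> n \<in> P" "factors_through C L P X X \<phi>"
  shows "\<phi> \<in> V.span (cells P)"
proof -
  obtain ms where ms: "set ms \<subseteq> \<Lambda>" "filtration C X (map Nabla ms)" by (rule Nabla_filtration_X)
  show ?thesis
    using assms
  proof (induction "card (P \<inter> set ms)" arbitrary: P \<phi> rule: less_induct)
    case less
    have lower: "\<phi>' \<in> V.span (cells {n \<in> \<Lambda>. n < m})"
      if m: "m \<in> P \<inter> set ms" and \<phi>': "factors_through C L {n \<in> \<Lambda>. n < m} X X \<phi>'" for m \<phi>'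
    proof (rule less.hyps[OF _ _ _ \<phi>'])
      have "{n \<in> \<Lambda>. n < m} \<inter> set ms \<subset> P \<inter> set ms" using m less.prems(2)[of m] by auto
      then show "card ({n \<in> \<Lambda>. n < m} \<inter> set ms) < card (P \<inter> set ms)" by (intro psubset_card_mono) auto
    qed auto
    have "Id C X \<cdot> \<phi> \<in> V.span (cells P)"
      by (rule factors_through_span_step[OF less.prems(1) _ ms(1) lower ms(2) order_refl id_hom[OF X_obj] less.prems(3)])
        (rule less.prems(2))
    then show ?case using id_left[OF factors_through_hom[OF less.prems(3)]] by simp
  qed
qed

lemma lower_span_cells: "lower_span (Scale C) \<Lambda> I I cell l = V.span (cells {m \<in> \<Lambda>. m < l})"
  unfolding lower_span_def cells_def by (rule arg_cong[where f = V.span]) blast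

lemma left_mult_cell:
  assumes "l \<in> \<Lambda>" "\<phi> \<in> Hom C X X" "i \<in> I l"
  shows "\<exists>r. \<forall>j \<in> I l.
    \<phi> \<cdot> cell l i j - (\<Sum>k\<in>I l. Scale C (r k) (cell l k j)) \<in> V.span (cells {m \<in> \<Lambda>. m < l})"
proof -
  note gi = ghat_hom[OF assms(1,3)]
  obtain r where r: "\<forall>f \<in> Hom C X (Tl l). factors_through C L {m \<in> \<Lambda>. m < l} X X
      (\<phi> \<cdot> ghat l i \<cdot> f - (\<Sum>k\<in>I l. Scale C (r k) (ghat l k \<cdot> f)))"
    using comp_from_Tl_mod_lower[OF assms(1) comp_hom[OF gi assms(2)]] by blast
  have "\<phi> \<cdot> cell l i j - (\<Sum>k\<in>I l. Scale C (r k) (cell l k j)) \<in> V.span (cells {m \<in> \<Lambda>. m < l})"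
    if j: "j \<in> I l" for j
  proof (rule factors_through_span)
    note fj = fhat_hom[OF assms(1) j]
    show "factors_through C L {m \<in> \<Lambda>. m < l} X X (\<phi> \<cdot> cell l i j - (\<Sum>k\<in>I l. Scale C (r k) (cell l k j)))"
      using bspec[OF r fj] comp_assoc[OF fj gi assms(2)] by (simp add: cell_def)
  qed auto
  then show ?thesis by blast
qed

lemma \<alpha>_span_cells:
  assumes "P \<subseteq> \<Lambda>" "\<phi> \<in> V.span (cells P)" shows "\<alpha> \<phi> \<in> V.span (cells P)"
proof -
  obtain t r where t: "finite t" "t \<subseteq> cells P" "\<phi> = (\<Sum>a\<in>t. Scale C (r a) a)"
    using assms(2) unfolding V.span_explicit by blast
  have "\<alpha> \<phi> = (\<Sum>a\<in>t. Scale C (r a) (\<alpha> a))"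
    unfolding t(3) using V.linear_between_sum[OF \<alpha>_linear, of t "\<lambda>a. a" r] t(2) cells_hom[OF assms(1)] by blast
  also have "\<dots> \<in> V.span (cells P)"
  proof (intro V.span_sum V.span_scale V.span_base)
    fix a assume "a \<in> t"
    then obtain l i j where "a = cell l i j" "l \<in> P" "i \<in> I l" "j \<in> I l" using t(2) unfolding cells_def by blast
    then show "\<alpha> a \<in> cells P" using \<alpha>_cell assms(1) unfolding cells_def by blast
  qed
  finally show ?thesis .
qed

text \<open>
  The left rule for \<open>\<alpha> \<phi>\<close>, transposed.
\<close>

lemma right_mult_cell:
  assumes "l \<in> \<Lambda>" "\<phi> \<in> Hom C X X" "j \<in> I l"
  shows "\<exists>r. \<forall>i \<in> I l.
    cell l i j \<cdot> \<phi> - (\<Sum>k\<in>I l. Scale C (r k) (cell l i k)) \<in> V.span (cells {m \<in> \<Lambda>. m < l})"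
proof -
  obtain r where r: "\<forall>i \<in> I l.
      \<alpha> \<phi> \<cdot> cell l j i - (\<Sum>k\<in>I l. Scale C (r k) (cell l k i)) \<in> V.span (cells {m \<in> \<Lambda>. m < l})"
    using left_mult_cell[OF assms(1) \<alpha>_hom[OF assms(2)] assms(3)] by blast
  have "cell l i j \<cdot> \<phi> - (\<Sum>k\<in>I l. Scale C (r k) (cell l i k)) \<in> V.span (cells {m \<in> \<Lambda>. m < l})"
    if i: "i \<in> I l" for i
  proof -
    let ?x = "\<alpha> \<phi> \<cdot> cell l j i" and ?y = "\<Sum>k\<in>I l. Scale C (r k) (cell l k i)"
    have x: "?x \<in> Hom C X X" using comp_hom[OF cell_hom \<alpha>_hom] assms i by blast
    have y: "?y \<in> Hom C X X"
      by (intro hom_closed(5)[OF X_obj X_obj] hom_closed(4) cell_hom[OF assms(1) _ i])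
    have "\<alpha> (?x - ?y) = \<alpha> ?x - \<alpha> ?y"
      using \<alpha>_add[OF hom_closed(3)[OF x y] y] by simp
    moreover have "\<alpha> ?x = cell l i j \<cdot> \<phi>"
      using \<alpha>_mult[OF \<alpha>_hom[OF assms(2)] cell_hom[OF assms(1,3) i]] \<alpha>_cell[OF assms(1,3) i]
        \<alpha>_involution[OF assms(2)] by simp
    moreover have "\<alpha> ?y = (\<Sum>k\<in>I l. Scale C (r k) (cell l i k))"
      using V.linear_between_sum[OF \<alpha>_linear, of "I l" "\<lambda>k. cell l k i" r] cell_hom[OF assms(1) _ i]
        \<alpha>_cell[OF assms(1) _ i] by simp
    ultimately show ?thesis using \<alpha>_span_cells[OF _ bspec[OF r i]] by simp
  qed
  then show ?thesis by blast
qed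

text \<open>
  The cells span, so it remains to see that their index set has the right size. The sum over the labels
  of a costandard filtration of \<open>X\<close> contains the label \<open>m\<close> as often as \<open>Nabla m\<close> occurs, which is
  \<open>card (I m)\<close> times.
\<close>

lemma cell_basis:
  "family_basis (Scale C) (Hom C X X) (SIGMA l : \<Lambda>. I l \<times> I l) (\<lambda>(l, i, j). cell l i j)"
proof -
  obtain ms where ms: "set ms \<subseteq> \<Lambda>" "filtration C X (map Nabla ms)" by (rule Nabla_filtration_X)
  have card_I_count: "card (I l) = count_list ms l" if "l \<in> \<Lambda>" for l
    using dim_Hom_\<Delta>[OF that ms(2,1)] card_I by simp
  have "I l = {}" if "l \<in> \<Lambda>" "l \<notin> set ms" for l
    using card_I_count[OF that(1)] that(2) I_finite[of l] card_eq_0_iff count_list_0_iff by metis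
  then have idx: "(SIGMA l : \<Lambda>. I l \<times> I l) = (SIGMA l : set ms. I l \<times> I l)" using ms(1) by blast
  have "V.dim (Hom C X X) = (\<Sum>m\<leftarrow>ms. V.dim (Hom C X (Nabla m)))"
    using dim_Hom_Nabla_filtered[OF ms(2,1) X_obj] tilting_ext_orth[OF tilting_X] by blast
  also have "\<dots> = (\<Sum>m\<leftarrow>ms. card (I m))"
    using ms(1) dim_Hom_Nabla by (intro arg_cong[where f = sum_list] map_cong) auto
  also have "\<dots> = (\<Sum>m\<in>set ms. card (I m) * card (I m))"
    unfolding sum_list_map_eq_sum_count using ms(1) card_I_count by (intro sum.cong) auto
  also have "\<dots> = card (SIGMA l : \<Lambda>. I l \<times> I l)"
    unfolding idx card_SigmaI[OF List.finite_set ballI[OF finite_cartesian_product[OF I_finite I_finite]]]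
    by (simp only: card_cartesian_product)
  finally have card: "card (SIGMA l : \<Lambda>. I l \<times> I l) \<le> V.dim (Hom C X X)" by simp
  have image: "(\<lambda>(l, i, j). cell l i j) ` (SIGMA l : \<Lambda>. I l \<times> I l) = cells \<Lambda>"
    unfolding cells_def by (auto simp: image_def split: prod.splits)
  have "Hom C X X \<subseteq> V.span (cells \<Lambda>)"
  proof
    fix \<phi> assume \<phi>: "\<phi> \<in> Hom C X X"
    then have "factors_through C L \<Lambda> X X \<phi>"
      unfolding factors_through_def
      using supported_on_weights[OF X_obj] id_hom[OF X_obj] id_right[OF \<phi>] by metis
    then show "\<phi> \<in> V.span (cells \<Lambda>)" by (intro factors_through_span) auto
  qed
  then have "V.span (cells \<Lambda>) = Hom C X X"
    using V.span_minimal[OF cells_hom[OF order_refl] hom_subspace[OF X_obj X_obj]] by blast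
  then have span: "V.span ((\<lambda>(l, i, j). cell l i j) ` (SIGMA l : \<Lambda>. I l \<times> I l)) = Hom C X X"
    unfolding image .
  have "finite (SIGMA l : \<Lambda>. I l \<times> I l)"
    unfolding idx by (rule finite_SigmaI[OF List.finite_set finite_cartesian_product[OF I_finite I_finite]])
  then show ?thesis using span card by (rule V.spanning_family_is_basis)
qed

lemma cellular_basis_cell: "cellular_basis (Scale C) (Hom C X X) (Comp C) (Id C X) \<Lambda> I cell \<alpha>"
proof unfold_locales
  show "V.subspace (Hom C X X)" by (rule hom_subspace[OF X_obj X_obj])
  show "\<exists>B. finite B \<and> V.span B = Hom C X X" by (rule finite_dim_hom[OF X_obj X_obj])
  show "Id C X \<in> Hom C X X" by (rule id_hom[OF X_obj])
  show "family_basis (Scale C) (Hom C X X) (SIGMA l : \<Lambda>. I l \<times> I l) (\<lambda>(l, i, j). cell l i j)"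
    by (rule cell_basis)
  show "\<exists>r. \<forall>j\<in>I l. \<phi> \<cdot> cell l i j - (\<Sum>k\<in>I l. Scale C (r k) (cell l k j)) \<in> lower_span (Scale C) \<Lambda> I I cell l"
    if "l \<in> \<Lambda>" "\<phi> \<in> Hom C X X" "i \<in> I l" for l \<phi> i
    unfolding lower_span_cells by (rule left_mult_cell[OF that])
  show "\<exists>r. \<forall>i\<in>I l. cell l i j \<cdot> \<phi> - (\<Sum>k\<in>I l. Scale C (r k) (cell l i k)) \<in> lower_span (Scale C) \<Lambda> I I cell l"
    if "l \<in> \<Lambda>" "\<phi> \<in> Hom C X X" "j \<in> I l" for l \<phi> j
    unfolding lower_span_cells by (rule right_mult_cell[OF that])
qed (auto intro: comp_hom comp_assoc id_left id_right comp_add_left comp_add_right comp_scale_left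
    comp_scale_right \<alpha>_add \<alpha>_scale \<alpha>_hom \<alpha>_mult \<alpha>_one \<alpha>_involution \<alpha>_cell)

end

theorem theorem3p16:
  fixes C :: "('o, 'm::ab_group_add, 'k::field) lin_cat"
    and \<Lambda> :: "'l::order set"
    and L Nabla \<Delta> Tl :: "'l \<Rightarrow> 'o"
    and Dob :: "'o \<Rightarrow> 'o" and Dmor :: "'m \<Rightarrow> 'm" and \<xi> :: "'o \<Rightarrow> 'm"
    and T :: 'o
    and incl :: "'l \<Rightarrow> 'm"
    and \<Phi>T :: 'm and \<Phi> :: "'l \<Rightarrow> 'm"
    and g ghat fhat :: "'l \<Rightarrow> nat \<Rightarrow> 'm"
  assumes "standard_category C \<Lambda> L Nabla \<Delta> Tl"
    and "standard_duality C \<Lambda> L Nabla \<Delta> Tl Dob Dmor \<xi>"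
    and "tilting C \<Lambda> Nabla \<Delta> T"
    and "\<And>l. l \<in> \<Lambda> \<Longrightarrow> is_mono C (\<Delta> l) (Tl l) (incl l)"
    and "fixed_via C Dob Dmor \<xi> T \<Phi>T"
    and "\<And>l. l \<in> \<Lambda> \<Longrightarrow> fixed_via C Dob Dmor \<xi> (Tl l) (\<Phi> l)"
    and "\<And>l. l \<in> \<Lambda> \<Longrightarrow>
           family_basis (Scale C) (Hom C (\<Delta> l) T) (hom_index C (\<Delta> l) T) (g l)"
    and "\<And>l i. l \<in> \<Lambda> \<Longrightarrow> i \<in> hom_index C (\<Delta> l) T \<Longrightarrow>
           ghat l i \<in> Hom C (Tl l) T \<and> ghat l i \<cdot>\<^bsub>C\<^esub> incl l = g l i"
    and "\<And>l i. l \<in> \<Lambda> \<Longrightarrow> i \<in> hom_index C (\<Delta> l) T \<Longrightarrow>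
           fhat l i = \<Phi> l \<cdot>\<^bsub>C\<^esub> Dmor (ghat l i) \<cdot>\<^bsub>C\<^esub> inv_mor C (Dob T) T \<Phi>T"
  shows "cellular_basis (Scale C) (Hom C T T) (Comp C) (Id C T) \<Lambda>
           (\<lambda>l. hom_index C (\<Delta> l) T)
           (\<lambda>l i j. ghat l i \<cdot>\<^bsub>C\<^esub> fhat l j)
           (\<lambda>\<phi>. \<Phi>T \<cdot>\<^bsub>C\<^esub> Dmor \<phi> \<cdot>\<^bsub>C\<^esub> inv_mor C (Dob T) T \<Phi>T)"
proof -
  interpret lifted_hom_bases C \<Lambda> L Nabla \<Delta> Tl Dob Dmor \<xi> T incl \<Phi>T \<Phi> g ghat fhat
    by (rule lifted_hom_bases.intro[OF assms(2)], unfold_locales) (fact assms)+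
  show ?thesis using cellular_basis_cell by (simp add: cell_def[abs_def] transpose_def[abs_def])
qed

end
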